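(* Let $d\ge2$ be an integer. For all $p\in(p_0(d),\infty]$ one has $$\sup_{f\in L^2(\mathbb{S}^{d-1}),\,f\ne0}\Phi^{\mathrm{mn}}_{p,d}(f)\le\Phi^{\mathrm{mn}}_{p,d}(\mathbf 1),$$ $$\sup_{Y_k,\,Y_k\neq 0}\Phi_{p,d}(Y_k)\le\Phi_{p,d}(Y_0),$$ where the second supremum runs over all nonzero spherical harmonics $Y_k$ on $\mathbb{S}^{d-1}$ of all degrees $k\ge0$, and $Y_0$ on the right-hand side is a nonzero constant function. That is, for all such $p$, constant functions are maximizers of $\Phi^{\mathrm{mn}}_{p,d}$ over nonzero $f\in L^2(\mathbb{S}^{d-1})$ and of $\Phi_{p,d}$ over nonzero spherical harmonics.
   Context: Let $\sigma=\sigma_{d-1}$ be the surface measure on the unit sphere $\mathbb{S}^{d-1}\subset\mathbb{R}^d$; $L^q(\mathbb{S}^{d-1})$ is taken with respect to $\sigma$ and functions are complex-valued. $\mathbf 1$ is the constant function $1$ on $\mathbb{S}^{d-1}$. Define $$\widehat{f\sigma}(x)=\int_{\mathbb{S}^{d-1}}e^{-ix\cdot\xi}f(\xi)\,d\sigma(\xi),\qquad x\in\mathbb{R}^d,$$ $$\|\widehat{f\sigma}\|_{L^p_{rad}L^2_{ang}(\mathbb{R}^d)}=\left(\int_0^\infty\left(\int_{\mathbb{S}^{d-1}}|\widehat{f\sigma}(r\omega)|^2\,d\sigma(\omega)\right)^{p/2}r^{d-1}\,dr\right)^{1/p},$$ with the usual modification (supremum over $r$) if $p=\infty$. For nonzero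 $f$ set $$\Phi^{\mathrm{mn}}_{p,d}(f):=\frac{\|\widehat{f\sigma}\|_{L^p_{rad}L^2_{ang}(\mathbb{R}^d)}}{\|f\|_{L^2(\mathbb{S}^{d-1})}},\qquad \Phi_{p,d}(f):=\frac{\|\widehat{f\sigma}\|_{L^p(\mathbb{R}^d)}}{\|f\|_{L^p(\mathbb{S}^{d-1})}}.$$ Here $Y_k$ denotes a spherical harmonic of degree $k$ on $\mathbb{S}^{d-1}$. Let $J_\nu$ be the Bessel function of the first kind of order $\nu$. For a non-negative integer $k$ and $\frac{2d}{d-1}<p<\infty$ define $$\Lambda_{d,p}(k):=\left(\int_0^\infty \left|J_{\frac d2-1+k}(r)\,r^{-\frac d2+1}\right|^p r^{d-1}\,dr\right)^{1/p},\qquad \Lambda_{d,\infty}(k):=\sup_{r\ge 0}\left|J_{\frac d2-1+k}(r)\,r^{-\frac d2+1}\right|$$ (the value at $r=0$ being understood as the limit $r\to0^+$). The exponent $p_0(d)$ is the left endpoint of the largest neighborhood of infinity $(p_0(d),\infty]$ of exponents for which $\max_{k\ge0}\Lambda_{d,p}(k)$ is attained at $k=0$ and only at $k=0$; that is, $p_0(d)$ is the infimum of all real $q\ge\frac{2d}{d-1}$ such that for every $p\in(q,\infty]$ and every integer $k\ge1$ one has $\Lambda_{d,p}(k)<\Lambda_{d,p}(0)$. *)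

theory Defs
  imports "HOL-Analysis.Analysis" "HOL-Probability.Essential_Supremum"
begin

section \<open>Powers and Lebesgue norms with values in the extended non-negative reals\<close>

text \<open>Real powers of extended non-negative reals; only used with exponent \<open>a > 0\<close>.\<close>

definition ennpowr :: "ennreal \<Rightarrow> real \<Rightarrow> ennreal"
  where "ennpowr x a = (if x = \<infinity> then \<infinity> else ennreal (enn2real x powr a))"

definition Lp_norm :: "ennreal \<Rightarrow> 'a measure \<Rightarrow> ('a \<Rightarrow> complex) \<Rightarrow> ennreal"
  where "Lp_norm p M f =
    (if p = \<infinity> then esssup M (\<lambda>x. ennreal (norm (f x)))
     else ennpowr (\<integral>\<^sup>+ x. ennreal (norm (f x) powr enn2real p) \<partial>M) (1 / enn2real p))"

section \<open>Surface measure on the unit sphere\<close>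

text \<open>The surface measure of a Borel set \<open>A\<close> of the unit sphere is \<open>d\<close> times the Lebesgue measure
  of the part of the open unit ball lying in the cone over \<open>A\<close>; see
  \<open>emeasure_sphere_measure\<close> below. This is the normalisation for which integration in polar
  coordinates has density \<open>r ^ (d - 1)\<close>.\<close>

definition sphere_measure :: "(real ^ 'n) measure"
  where "sphere_measure =
    scale_measure (of_nat CARD('n))
      (distr (restrict_space lborel (ball 0 1 - {0})) (restrict_space borel (sphere 0 1))
         (\<lambda>x. x /\<^sub>R norm x))"

lemma space_sphere_measure: "space (sphere_measure :: (real ^ 'n) measure) = sphere 0 1"
  by (simp add: sphere_measure_def space_restrict_space space_scale_measure)

lemma sets_sphere_measure:
  "sets (sphere_measure :: (real ^ 'n) measure) = sets (restrict_space borel (sphere 0 1))"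
  by (simp add: sphere_measure_def)

lemma emeasure_sphere_measure:
  assumes "A \<in> sets borel" "A \<subseteq> sphere 0 1"
  shows "emeasure (sphere_measure :: (real ^ 'n) measure) A =
    of_nat CARD('n) * emeasure lborel {r *\<^sub>R w | r w. 0 < r \<and> r < 1 \<and> w \<in> A}"
proof -
  let ?B = "ball 0 1 - {0} :: (real ^ 'n) set"
  let ?h = "\<lambda>x :: real ^ 'n. x /\<^sub>R norm x"
  have h: "?h \<in> restrict_space lborel ?B \<rightarrow>\<^sub>M restrict_space borel (sphere 0 1)"
    by (rule measurable_restrict_space2)
       (auto simp: space_restrict_space intro!: measurable_restrict_space1)
  have A: "A \<in> sets (restrict_space borel (sphere 0 1))"
    using assms by (subst sets_restrict_space_iff) auto
  have "?h -` A \<inter> ?B = {r *\<^sub>R w | r w. 0 < r \<and> r < 1 \<and> w \<in> A}"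
  proof (intro set_eqI iffI)
    fix x assume "x \<in> ?h -` A \<inter> ?B"
    then have "x = norm x *\<^sub>R ?h x \<and> 0 < norm x \<and> norm x < 1 \<and> ?h x \<in> A"
      by auto
    then show "x \<in> {r *\<^sub>R w | r w. 0 < r \<and> r < 1 \<and> w \<in> A}"
      by blast
  next
    fix x assume "x \<in> {r *\<^sub>R w | r w. 0 < r \<and> r < 1 \<and> w \<in> A}"
    then obtain r w where "x = r *\<^sub>R w" "0 < r" "r < 1" "w \<in> A" by blast
    moreover from this assms(2) have "norm w = 1" by auto
    ultimately show "x \<in> ?h -` A \<inter> ?B" by auto
  qed
  moreover have "emeasure (restrict_space lborel ?B) (?h -` A \<inter> ?B) = emeasure lborel (?h -` A \<inter> ?B)"
    by (rule emeasure_restrict_space) auto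
  ultimately show ?thesis
    using h A by (simp add: sphere_measure_def emeasure_distr space_restrict_space)
qed

section \<open>The extension operator and the two functionals\<close>

definition extension :: "(real ^ 'n \<Rightarrow> complex) \<Rightarrow> real ^ 'n \<Rightarrow> complex"
  where "extension f x = (\<integral>\<xi>. exp (- \<i> * complex_of_real (x \<bullet> \<xi>)) * f \<xi> \<partial>sphere_measure)"

definition mixed_norm :: "ennreal \<Rightarrow> (real ^ 'n \<Rightarrow> complex) \<Rightarrow> ennreal"
  where "mixed_norm p g =
    (if p = \<infinity> then
       (SUP r\<in>{0::real..}.
          ennpowr (\<integral>\<^sup>+ \<omega>. ennreal ((norm (g (r *\<^sub>R \<omega>)))\<^sup>2) \<partial>sphere_measure) (1 / 2))
     else
       ennpowr
         (\<integral>\<^sup>+ r\<in>{0::real<..}.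
            ennpowr (\<integral>\<^sup>+ \<omega>. ennreal ((norm (g (r *\<^sub>R \<omega>)))\<^sup>2) \<partial>sphere_measure) (enn2real p / 2)
            * ennreal (r ^ (CARD('n) - 1)) \<partial>lborel)
         (1 / enn2real p))"

definition Phi_mn :: "ennreal \<Rightarrow> (real ^ 'n \<Rightarrow> complex) \<Rightarrow> ennreal"
  where "Phi_mn p f = mixed_norm p (extension f) / Lp_norm 2 sphere_measure f"

definition Phi :: "ennreal \<Rightarrow> (real ^ 'n \<Rightarrow> complex) \<Rightarrow> ennreal"
  where "Phi p f = Lp_norm p lborel (extension f) / Lp_norm p sphere_measure f"

definition nonzero_L2_sphere :: "(real ^ 'n \<Rightarrow> complex) set"
  where "nonzero_L2_sphere =
    {f. f \<in> borel_measurable sphere_measure \<and> Lp_norm 2 sphere_measure f < \<infinity>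
        \<and> \<not> (AE \<omega> in sphere_measure. f \<omega> = 0)}"

section \<open>Spherical harmonics\<close>

definition partial_deriv :: "'n \<Rightarrow> (real ^ 'n \<Rightarrow> complex) \<Rightarrow> real ^ 'n \<Rightarrow> complex"
  where "partial_deriv i u x = vector_derivative (\<lambda>t. u (x + t *\<^sub>R axis i 1)) (at 0)"

definition laplacian :: "(real ^ 'n \<Rightarrow> complex) \<Rightarrow> real ^ 'n \<Rightarrow> complex"
  where "laplacian u x = (\<Sum>i\<in>UNIV. partial_deriv i (partial_deriv i u) x)"

text \<open>A homogeneous polynomial is a combination of monomials with multi-indices
  \<open>\<alpha> :: 'n \<Rightarrow> nat\<close> of total degree \<open>k\<close>; the zero polynomial counts as homogeneous of every degree.\<close>

definition homogeneous_polynomial :: "nat \<Rightarrow> (real ^ 'n \<Rightarrow> complex) \<Rightarrow> bool"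
  where "homogeneous_polynomial k P \<longleftrightarrow>
    (\<exists>c :: ('n \<Rightarrow> nat) \<Rightarrow> complex. \<forall>x.
       P x = (\<Sum>\<alpha> | sum \<alpha> UNIV = k. c \<alpha> * (\<Prod>i\<in>UNIV. complex_of_real (x $ i) ^ \<alpha> i)))"

text \<open>Only the values of \<open>Y\<close> on the unit sphere are constrained; none of the notions
  above depends on the values elsewhere.\<close>

definition spherical_harmonic :: "nat \<Rightarrow> (real ^ 'n \<Rightarrow> complex) \<Rightarrow> bool"
  where "spherical_harmonic k Y \<longleftrightarrow>
    (\<exists>P. homogeneous_polynomial k P \<and> (\<forall>x. laplacian P x = 0) \<and> (\<forall>\<omega>\<in>sphere 0 1. Y \<omega> = P \<omega>))"

definition nonzero_spherical_harmonics :: "(real ^ 'n \<Rightarrow> complex) set"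
  where "nonzero_spherical_harmonics =
    {Y. (\<exists>k. spherical_harmonic k Y) \<and> (\<exists>\<omega>\<in>sphere 0 1. Y \<omega> \<noteq> 0)}"

section \<open>Bessel functions and the exponent \<open>p\<^sub>0(d)\<close>\<close>

text \<open>Power series of the Bessel function of the first kind, for argument \<open>r > 0\<close>.
  Since \<open>0 powr 0 = 0\<close>, the value at \<open>r = 0\<close> is not the intended one when \<open>\<nu> = 0\<close>.\<close>

definition bessel_J :: "real \<Rightarrow> real \<Rightarrow> real"
  where "bessel_J \<nu> r =
    (\<Sum>m. (-1) ^ m * rGamma (real m + \<nu> + 1) / fact m * (r / 2) powr (2 * real m + \<nu>))"

definition bessel_profile :: "nat \<Rightarrow> nat \<Rightarrow> real \<Rightarrow> real"
  where "bessel_profile d k r =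
    bessel_J (real d / 2 - 1 + real k) r * r powr (- (real d / 2) + 1)"

definition bessel_profile0 :: "nat \<Rightarrow> nat \<Rightarrow> real \<Rightarrow> real"
  where "bessel_profile0 d k r =
    (if r = 0 then Lim (at_right 0) (bessel_profile d k) else bessel_profile d k r)"

definition Lambda :: "nat \<Rightarrow> ennreal \<Rightarrow> nat \<Rightarrow> ennreal"
  where "Lambda d p k =
    (if p = \<infinity> then (SUP r\<in>{0::real..}. ennreal \<bar>bessel_profile0 d k r\<bar>)
     else ennpowr
       (\<integral>\<^sup>+ r\<in>{0::real<..}.
          ennreal (\<bar>bessel_profile d k r\<bar> powr enn2real p * r ^ (d - 1)) \<partial>lborel)
       (1 / enn2real p))"

definition p0 :: "nat \<Rightarrow> ennreal"
  where "p0 d = Inf {ennreal q | q :: real.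
    2 * real d / (real d - 1) \<le> q \<and> (\<forall>p > ennreal q. \<forall>k\<ge>1. Lambda d p k < Lambda d p 0)}"

end

theory Submission
  imports Defs "HOL-Probability.Distributions"
begin

text \<open>If \<open>P\<close> is a solid harmonic of degree \<open>k\<close>, then its extension at \<open>r \<omega>\<close> is \<open>P \<omega>\<close>
  times \<open>(-\<i>)\<^sup>k E \<beta>\<^sub>k(r)\<close>, where \<open>\<beta>\<^sub>k\<close> is the Bessel profile and \<open>E\<close> does not depend on \<open>k\<close>. To
  see this, expand the exponential in powers of \<open>\<xi> \<bullet> \<omega>\<close>; by polar coordinates the moments of \<open>P\<close>
  against these powers are read off from Gaussian moments, which integration by parts reduces to
  lower ones using only harmonicity and Euler's identity. So \<open>\<Phi>\<close> is at most \<open>E \<Lambda>(k)\<close> on harmonics of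
  degree \<open>k\<close>, with equality on constants.

  For general \<open>f\<close> let \<open>f\<^sub>k\<close> be its projection onto the harmonics of degree \<open>k\<close>. The difference of \<open>f\<close>
  and \<open>f\<^sub>0 + \<dots> + f\<^sub>N\<close> annihilates all \<open>(\<xi> \<bullet> \<omega>)\<^sup>m\<close> with \<open>m \<le> N\<close>, so the extensions of the partial
  sums converge pointwise, without appeal to completeness of the spherical harmonics. Fatou's lemma
  bounds the square mean over the sphere of radius \<open>r\<close> by the sum of the
  \<open>(E \<beta>\<^sub>k(r))\<^sup>2 \<parallel>f\<^sub>k\<parallel>\<^sup>2\<close>. Since \<open>p / 2 > 1\<close>, the power mean inequality with weights \<open>\<parallel>f\<^sub>k\<parallel>\<^sup>2\<close>,
  whose sum is at most \<open>\<parallel>f\<parallel>\<^sup>2\<close>, gives the bound \<open>E \<Lambda>(0)\<close>, which constants attain.\<close>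

section \<open>Polar coordinates\<close>

text \<open>Integration by parts is carried out on the whole space against
  \<open>exp (- (y \<bullet> y))\<close>: for a homogeneous integrand the radial part splits off as
  a Gamma value that depends on the degree alone. Up to powers of 2, this value and the factorial
  left by the integration by parts form the coefficients of the Bessel series, and that series is
  the only description of Bessel functions that enters. The kernels
  \<open>(\<xi> \<bullet> \<omega>) ^ m\<close> act on harmonics of degree \<open>k\<close> by a
  scalar that is zero for \<open>m < k\<close> and positive for \<open>m = k\<close>. This
  triangular shape yields orthogonality, the normalisation of the projections and the vanishing of
  the moments of the remainder. The projections are explicit combinations of moments, so no
  decomposition of polynomials into harmonics has to be established. The constant \<open>E\<close>
  is \<open>extension_const\<close>, in closed form \<open>(2 pi) powr (d / 2)\<close>; it occurs on
  both sides, so only its positivity matters. Norms stay in \<open>ennreal\<close>, hence the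
  estimates hold whether or not \<open>Lambda\<close> is finite.\<close>

lemma finite_measure_sphere_measure: "finite_measure (sphere_measure :: (real ^ 'n) measure)"
proof
  have "emeasure (sphere_measure :: (real ^ 'n) measure) (sphere 0 1) =
    of_nat CARD('n) * emeasure lborel {r *\<^sub>R w | r w. 0 < r \<and> r < 1 \<and> w \<in> (sphere 0 1 :: (real^'n) set)}"
    by (rule emeasure_sphere_measure) auto
  also have "\<dots> \<le> of_nat CARD('n) * emeasure lborel (ball 0 1 :: (real^'n) set)"
    by (intro mult_left_mono emeasure_mono) (auto simp: abs_if)
  also have "\<dots> < \<infinity>"
    using emeasure_lborel_ball_finite[of "0::real^'n" 1]
    by (simp add: ennreal_mult_less_top of_nat_less_top)
  finally show "emeasure (sphere_measure :: (real ^ 'n) measure) (space sphere_measure) \<noteq> \<infinity>"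
    by (simp add: space_sphere_measure)
qed

interpretation sphere: finite_measure "sphere_measure :: (real ^ 'n) measure"
  by (rule finite_measure_sphere_measure)

interpretation sphere_pair: pair_sigma_finite "sphere_measure :: (real ^ 'n) measure"
    "sphere_measure :: (real ^ 'n) measure"
  by unfold_locales

lemma measurable_sphere_measure_id [measurable]: "(\<lambda>x. x) \<in> sphere_measure \<rightarrow>\<^sub>M borel"
  using measurable_restrict_space1[of "\<lambda>x. x" borel borel "sphere 0 1"]
  by (simp cong: measurable_cong_sets add: sets_sphere_measure)

lemma borel_measurable_sphere_measure:
  "f \<in> borel_measurable borel \<Longrightarrow> f \<in> borel_measurable (sphere_measure :: (real ^ 'n) measure)"
  using measurable_compose[OF measurable_sphere_measure_id] by simp

lemma norm_sphere_measure: "x \<in> space sphere_measure \<Longrightarrow> norm x = 1"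
  by (simp add: space_sphere_measure)

text \<open>A measure on all of the real line without mass on the non-positive half, so that polar
  coordinates become an identity between a product measure and an image of
  \<open>lborel\<close>.\<close>

definition radial_measure :: "nat \<Rightarrow> real measure"
  where "radial_measure d = density lborel (\<lambda>r. ennreal (r ^ (d - 1)) * indicator {0<..} r)"

lemma sets_radial_measure [simp, measurable_cong]: "sets (radial_measure d) = sets borel"
  by (simp add: radial_measure_def)

lemma space_radial_measure [simp]: "space (radial_measure d) = UNIV"
  by (simp add: radial_measure_def)

lemma nn_integral_radial_measure:
  "f \<in> borel_measurable borel \<Longrightarrow>
    (\<integral>\<^sup>+ r. f r \<partial>radial_measure d) = (\<integral>\<^sup>+ r\<in>{0<..}. f r * ennreal (r ^ (d - 1)) \<partial>lborel)"
  unfolding radial_measure_def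
  by (subst nn_integral_density) (auto simp: mult_ac)

lemma emeasure_radial_measure_lessThan:
  assumes "d \<ge> 1"
  shows "emeasure (radial_measure d) {..<a} = ennreal (max 0 a ^ d / d)"
proof (cases "a > 0")
  case False
  then have "emeasure (radial_measure d) {..<a} = nn_integral lborel (\<lambda>_::real. 0)"
    unfolding radial_measure_def
    by (subst emeasure_density) (auto intro!: nn_integral_cong simp del: nn_integral_const split: split_indicator)
  with False assms show ?thesis by (simp add: max_def)
next
  case True
  have "emeasure (radial_measure d) {..<a} =
      (\<integral>\<^sup>+ r. ennreal (r ^ (d - 1)) * indicator {0..a} r \<partial>lborel)"
    unfolding radial_measure_def
    using AE_lborel_singleton[of 0] AE_lborel_singleton[of a]
    by (subst emeasure_density) (auto intro!: nn_integral_cong_AE split: split_indicator)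
  also have "\<dots> = ennreal (a ^ d / d - 0 ^ d / d)"
  proof (rule nn_integral_FTC_Icc[where F = "\<lambda>x. x ^ d / d"])
    fix x assume "x \<in> {0..a}"
    show "((\<lambda>x. x ^ d / d) has_real_derivative x ^ (d - 1)) (at x)"
      using assms by (auto intro!: derivative_eq_intros)
  qed (use True in auto)
  finally show ?thesis using assms True by (simp add: power_0_left)
qed

lemma sigma_finite_radial_measure:
  assumes "d \<ge> 1" shows "sigma_finite_measure (radial_measure d)"
proof
  show "\<exists>A. countable A \<and> A \<subseteq> sets (radial_measure d) \<and> \<Union> A = space (radial_measure d) \<and>
      (\<forall>a\<in>A. emeasure (radial_measure d) a \<noteq> \<infinity>)"
    by (intro exI[of _ "range (\<lambda>i::nat. {..<real i})"])
       (auto simp: emeasure_radial_measure_lessThan[OF assms] reals_Archimedean2)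
qed

text \<open>The value at the origin is irrelevant, but makes the direction a total map into the sphere.\<close>

definition direction :: "real ^ 'n \<Rightarrow> real ^ 'n"
  where "direction x = (if x = 0 then axis undefined 1 else x /\<^sub>R norm x)"

lemma norm_direction [simp]: "norm (direction x) = 1"
  by (simp add: direction_def norm_axis_1)

lemma norm_scaleR_direction: "norm x *\<^sub>R direction x = x"
  by (simp add: direction_def)

lemma measurable_direction [measurable]:
  "(direction :: real ^ 'n \<Rightarrow> _) \<in> borel \<rightarrow>\<^sub>M sphere_measure"
proof -
  have "(direction :: real ^ 'n \<Rightarrow> _) \<in> borel \<rightarrow>\<^sub>M borel"
    unfolding direction_def by measurable
  then have "(direction :: real ^ 'n \<Rightarrow> _) \<in> borel \<rightarrow>\<^sub>M restrict_space borel (sphere 0 1)"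
    by (intro measurable_restrict_space2) auto
  then show ?thesis
    by (simp cong: measurable_cong_sets add: sets_sphere_measure)
qed

text \<open>For \<open>a = 1\<close> this is how the surface measure was defined, up to the null set
  containing the origin. Scaling by \<open>a\<close> multiplies volumes by \<open>a ^ d\<close>,
  which matches the mass \<open>a ^ d / d\<close> of the half-line.\<close>

lemma emeasure_cone_lessThan:
  fixes B :: "(real ^ 'n) set"
  assumes B: "B \<in> sets sphere_measure"
  shows "emeasure lborel {x. norm x < a \<and> direction x \<in> B} =
    emeasure sphere_measure B * emeasure (radial_measure CARD('n)) {..<a}"
proof (cases "a > 0")
  case False
  then have *: "\<not> norm x < a" for x :: "real ^ 'n" using norm_ge_zero[of x] by linarith
  have "CARD('n) \<ge> 1" by (simp add: Suc_leI)
  with False show ?thesis by (simp add: emeasure_radial_measure_lessThan max_def *)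
next
  case a: True
  let ?d = "CARD('n)"
  have d: "?d \<ge> 1" by (simp add: Suc_leI)
  have sub: "B \<subseteq> sphere 0 1" and Bb: "B \<in> sets borel"
    using B by (auto simp: sets_sphere_measure sets_restrict_space)
  let ?C = "{r *\<^sub>R w | r w. 0 < r \<and> r < 1 \<and> w \<in> B}"
  have Ceq: "?C = {x. norm x < 1 \<and> direction x \<in> B} - {0}"
  proof (intro set_eqI iffI)
    fix x assume "x \<in> ?C"
    then obtain r w where *: "x = r *\<^sub>R w" "0 < r" "r < 1" "w \<in> B" by blast
    moreover from this sub have "norm w = 1" by auto
    ultimately show "x \<in> {x. norm x < 1 \<and> direction x \<in> B} - {0}"
      by (auto simp: direction_def)
  next
    fix x assume "x \<in> {x. norm x < 1 \<and> direction x \<in> B} - {0}"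
    then have "x = norm x *\<^sub>R direction x \<and> 0 < norm x \<and> norm x < 1 \<and> direction x \<in> B"
      by (auto simp: norm_scaleR_direction)
    then show "x \<in> ?C" by blast
  qed
  have meas: "{x :: real^'n. norm x < b \<and> direction x \<in> B} \<in> sets borel" for b
  proof -
    have "{x :: real^'n. norm x < b \<and> direction x \<in> B} = {x\<in>space borel. norm x < b} \<inter> (direction -` B \<inter> space borel)"
      by auto
    also have "\<dots> \<in> sets borel"
      using measurable_sets[OF measurable_direction B] by (intro sets.Int) auto
    finally show ?thesis .
  qed
  have Cm: "?C \<in> sets borel" unfolding Ceq using meas[of 1] by auto
  have scal: "{x. norm x < a \<and> direction x \<in> B} - {0} = (\<lambda>x. a *\<^sub>R x + 0) ` ?C"
  proof (intro set_eqI iffI)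
    fix x assume x: "x \<in> {x. norm x < a \<and> direction x \<in> B} - {0}"
    then have "x = a *\<^sub>R ((norm x / a) *\<^sub>R direction x) + 0" "0 < norm x / a" "norm x / a < 1"
      using a by (auto simp: norm_scaleR_direction)
    then show "x \<in> (\<lambda>x. a *\<^sub>R x + 0) ` ?C" using x by blast
  next
    fix x assume "x \<in> (\<lambda>x. a *\<^sub>R x + 0) ` ?C"
    then obtain r w where *: "x = a *\<^sub>R r *\<^sub>R w" "0 < r" "r < 1" "w \<in> B" by auto
    moreover from this sub have "norm w = 1" by auto
    ultimately show "x \<in> {x. norm x < a \<and> direction x \<in> B} - {0}"
      using a by (auto simp: direction_def field_simps)
  qed
  have "emeasure lborel {x. norm x < a \<and> direction x \<in> B} =
      emeasure lborel ({x. norm x < a \<and> direction x \<in> B} - {0})"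
    using meas[of a] by (subst emeasure_Diff_null_set) (auto simp: null_sets_def)
  also have "\<dots> = emeasure lebesgue ((\<lambda>x. a *\<^sub>R x + 0) ` ?C)"
    unfolding scal[symmetric] using meas[of a] by simp
  also have "\<dots> = ennreal (a ^ ?d) * emeasure lebesgue ?C"
    using emeasure_lebesgue_affine[of a 0 ?C] a by (simp add: algebra_simps)
  also have "emeasure lebesgue ?C = emeasure lborel ?C" using Cm by simp
  finally have 1: "emeasure lborel {x. norm x < a \<and> direction x \<in> B} = ennreal (a ^ ?d) * emeasure lborel ?C" .
  have "emeasure sphere_measure B * emeasure (radial_measure CARD('n)) {..<a}
     = of_nat ?d * ennreal (a ^ ?d / ?d) * emeasure lborel ?C"
    using a d by (simp add: emeasure_radial_measure_lessThan emeasure_sphere_measure[OF Bb sub] mult_ac)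
  also have "of_nat ?d * ennreal (a ^ ?d / ?d) = ennreal (a ^ ?d)"
    using a d by (simp add: ennreal_of_nat_eq_real_of_nat flip: ennreal_mult)
  finally show ?thesis using 1 by simp
qed

text \<open>A product of sigma-finite measures is determined by rectangles
  \<open>A \<times> B\<close>. For fixed \<open>B\<close> both sides are measures in
  \<open>A\<close>; they agree on the half-lines \<open>{..<a}\<close> by the cone formula, and
  these form an intersection-stable generator exhausting the line with sets of finite mass.\<close>

lemma polar_coordinates_distr:
  "radial_measure CARD('n) \<Otimes>\<^sub>M (sphere_measure :: (real ^ 'n) measure) =
     distr lborel (borel \<Otimes>\<^sub>M sphere_measure) (\<lambda>x. (norm x, direction x))"
proof (rule pair_measure_eqI)
  have d: "CARD('n) \<ge> 1" by (simp add: Suc_leI)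
  show "sigma_finite_measure (radial_measure CARD('n))"
    using d by (rule sigma_finite_radial_measure)
  show "sigma_finite_measure (sphere_measure :: (real ^ 'n) measure)" by unfold_locales
  show "sets (radial_measure CARD('n) \<Otimes>\<^sub>M sphere_measure) =
      sets (distr (lborel :: (real^'n) measure) (borel \<Otimes>\<^sub>M sphere_measure) (\<lambda>x. (norm x, direction x)))"
    by (auto intro!: sets_pair_measure_cong)
  fix A and B :: "(real ^ 'n) set"
  assume A: "A \<in> sets (radial_measure CARD('n))" and B: "B \<in> sets sphere_measure"
  let ?D = "direction -` B"
  have D [measurable]: "?D \<in> sets borel" using measurable_sets[OF measurable_direction B] by simp
  let ?M = "distr (density lborel (indicator ?D)) borel (norm :: real ^ 'n \<Rightarrow> real)"
  have Mem: "emeasure ?M X = emeasure lborel {x. norm x \<in> X \<and> direction x \<in> B}" if X: "X \<in> sets borel" for X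
  proof -
    have [measurable]: "norm -` X \<in> sets (borel :: (real^'n) measure)"
      using measurable_sets[OF borel_measurable_continuous_onI[OF continuous_on_norm_id] X]
      by (simp add: vimage_def)
    have "emeasure ?M X = (\<integral>\<^sup>+ x. indicator ?D x * indicator (norm -` X) x \<partial>lborel)"
      using X by (simp add: emeasure_distr emeasure_density)
    also have "\<dots> = (\<integral>\<^sup>+ x. indicator (?D \<inter> norm -` X) x \<partial>lborel)"
      by (simp only: indicator_inter_arith)
    also have "\<dots> = emeasure lborel (?D \<inter> norm -` X)"
      by (rule nn_integral_indicator) measurable
    also have "?D \<inter> norm -` X = {x. norm x \<in> X \<and> direction x \<in> B}" by auto
    finally show ?thesis .
  qed
  have "?M = scale_measure (emeasure sphere_measure B) (radial_measure CARD('n))"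
  proof (rule measure_eqI_generator_eq)
    show "Int_stable (range (lessThan :: real \<Rightarrow> _))"
    proof (rule Int_stableI)
      fix X Y assume "X \<in> range (lessThan :: real \<Rightarrow> _)" "Y \<in> range (lessThan :: real \<Rightarrow> _)"
      then obtain a b where "X = {..<a}" "Y = {..<b}" by auto
      then have "X \<inter> Y = {..<min a b}" by auto
      then show "X \<inter> Y \<in> range lessThan" by auto
    qed
    have "sets (borel :: real measure) = sigma_sets UNIV (range lessThan)"
      using arg_cong[OF borel_Iio, of sets] by (metis sets_measure_of top_greatest Pow_UNIV)
    then show "sets ?M = sigma_sets UNIV (range lessThan)"
      "sets (scale_measure (emeasure sphere_measure B) (radial_measure CARD('n))) = sigma_sets UNIV (range lessThan)"
      by simp_all
    show "emeasure ?M X = emeasure (scale_measure (emeasure sphere_measure B) (radial_measure CARD('n))) X"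
      if "X \<in> range lessThan" for X
    proof -
      from that obtain a where X: "X = {..<a}" by auto
      then show ?thesis using emeasure_cone_lessThan[OF B, of a] by (simp add: Mem)
    qed
    show "range (\<lambda>i::nat. {..<real i}) \<subseteq> range lessThan" by auto
    show "(\<Union>i::nat. {..<real i}) = UNIV" by (auto simp: reals_Archimedean2)
    fix i :: nat
    have "emeasure ?M {..<real i} = emeasure sphere_measure B * emeasure (radial_measure CARD('n)) {..<real i}"
      using emeasure_cone_lessThan[OF B, of i] by (simp add: Mem)
    also have "\<dots> < \<infinity>"
      using sphere.emeasure_finite[of B] d
      by (simp add: emeasure_radial_measure_lessThan ennreal_mult_less_top less_top del: sphere.emeasure_finite)
    finally show "emeasure ?M {..<real i} \<noteq> \<infinity>" by simp
  qed auto
  then have "emeasure ?M A = emeasure sphere_measure B * emeasure (radial_measure CARD('n)) A"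
    by simp
  moreover have "emeasure (distr lborel (borel \<Otimes>\<^sub>M sphere_measure) (\<lambda>x. (norm x, direction x))) (A \<times> B)
     = emeasure lborel {x. norm x \<in> A \<and> direction x \<in> B}"
    using A B by (subst emeasure_distr) (auto intro!: arg_cong[where f="emeasure _"])
  ultimately show "emeasure (radial_measure CARD('n)) A * emeasure sphere_measure B =
       emeasure (distr lborel (borel \<Otimes>\<^sub>M sphere_measure) (\<lambda>x. (norm x, direction x))) (A \<times> B)"
    using A by (simp add: Mem mult.commute)
qed

lemma nn_integral_polar:
  fixes h :: "real ^ 'n \<Rightarrow> ennreal"
  assumes [measurable]: "h \<in> borel_measurable borel"
  shows "(\<integral>\<^sup>+ x. h x \<partial>lborel) =
    (\<integral>\<^sup>+ r\<in>{0<..}. (\<integral>\<^sup>+ \<omega>. h (r *\<^sub>R \<omega>) \<partial>sphere_measure) * ennreal (r ^ (CARD('n) - 1)) \<partial>lborel)"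
proof -
  have "(\<integral>\<^sup>+ x. h x \<partial>lborel) = (\<integral>\<^sup>+ x. (\<lambda>(r, \<omega>). h (r *\<^sub>R \<omega>)) (norm x, direction x) \<partial>lborel)"
    by (simp add: norm_scaleR_direction)
  also have "\<dots> = (\<integral>\<^sup>+ z. (\<lambda>(r, \<omega>). h (r *\<^sub>R \<omega>)) z \<partial>distr lborel (borel \<Otimes>\<^sub>M sphere_measure) (\<lambda>x. (norm x, direction x)))"
    by (subst nn_integral_distr) auto
  also have "\<dots> = (\<integral>\<^sup>+ z. (\<lambda>(r, \<omega>). h (r *\<^sub>R \<omega>)) z \<partial>(radial_measure CARD('n) \<Otimes>\<^sub>M sphere_measure))"
    by (simp only: polar_coordinates_distr)
  also have "\<dots> = (\<integral>\<^sup>+ r. \<integral>\<^sup>+ \<omega>. h (r *\<^sub>R \<omega>) \<partial>sphere_measure \<partial>radial_measure CARD('n))"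
    by (subst sphere.nn_integral_fst[symmetric]) auto
  also have "\<dots> = (\<integral>\<^sup>+ r\<in>{0<..}. (\<integral>\<^sup>+ \<omega>. h (r *\<^sub>R \<omega>) \<partial>sphere_measure) * ennreal (r ^ (CARD('n) - 1)) \<partial>lborel)"
    by (rule nn_integral_radial_measure) measurable
  finally show ?thesis .
qed

section \<open>Polynomial functions and directional derivatives\<close>

text \<open>Polynomial functions without a normal form: growth bounds, existence of derivatives and
  their commutation follow by rule induction, with multiplication by one coordinate as the only
  product to treat.\<close>

inductive polyfun :: "(real ^ 'n \<Rightarrow> complex) \<Rightarrow> bool" where
  polyfun_const: "polyfun (\<lambda>_. c)"
| polyfun_coord: "polyfun P \<Longrightarrow> polyfun (\<lambda>x. of_real (x $ i) * P x)"
| polyfun_add: "polyfun P \<Longrightarrow> polyfun Q \<Longrightarrow> polyfun (\<lambda>x. P x + Q x)"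

lemma polyfun_cmult: "polyfun P \<Longrightarrow> polyfun (\<lambda>x. c * P x)"
  by (induction rule: polyfun.induct)
     (auto simp: ring_distribs mult.left_commute[of c] intro: polyfun.intros)

lemma polyfun_mult: "polyfun P \<Longrightarrow> polyfun Q \<Longrightarrow> polyfun (\<lambda>x. P x * Q x)"
  by (induction rule: polyfun.induct)
     (auto simp: ring_distribs mult.assoc intro: polyfun.intros polyfun_cmult)

lemma polyfun_sum: "(\<And>i. i \<in> I \<Longrightarrow> polyfun (P i)) \<Longrightarrow> polyfun (\<lambda>x. \<Sum>i\<in>I. P i x)"
  by (induction I rule: infinite_finite_induct) (auto intro: polyfun.intros)

lemma polyfun_prod: "(\<And>i. i \<in> I \<Longrightarrow> polyfun (P i)) \<Longrightarrow> polyfun (\<lambda>x. \<Prod>i\<in>I. P i x)"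
  by (induction I rule: infinite_finite_induct) (auto intro: polyfun_mult polyfun_const)

lemma polyfun_power: "polyfun P \<Longrightarrow> polyfun (\<lambda>x. P x ^ n)"
  by (induction n) (auto intro: polyfun_mult polyfun_const)

lemma polyfun_component: "polyfun (\<lambda>x. of_real (x $ i))"
  using polyfun_coord[OF polyfun_const[of 1], of i] by simp

lemma polyfun_inner: "polyfun (\<lambda>x. of_real (x \<bullet> v))"
  unfolding inner_vec_def inner_real_def of_real_sum of_real_mult
  by (intro polyfun_sum polyfun_mult polyfun_component polyfun_const)

lemma polyfun_inner_self: "polyfun (\<lambda>x. of_real (x \<bullet> x))"
  unfolding inner_vec_def inner_real_def of_real_sum of_real_mult
  by (intro polyfun_sum polyfun_mult polyfun_component)

lemma polyfun_cnj: "polyfun P \<Longrightarrow> polyfun (\<lambda>x. cnj (P x))"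
  by (induction rule: polyfun.induct) (auto intro: polyfun.intros)

lemma polyfun_continuous: "polyfun P \<Longrightarrow> continuous_on S P"
  by (induction rule: polyfun.induct) (auto intro!: continuous_intros)

lemma polyfun_measurable [measurable_dest]: "polyfun P \<Longrightarrow> P \<in> borel_measurable borel"
  by (intro borel_measurable_continuous_onI polyfun_continuous)

lemma polyfun_bounded:
  assumes "polyfun P"
  shows "\<exists>C M. \<forall>x. norm (P x) \<le> C * (1 + norm x) ^ M"
  using assms
proof (induction rule: polyfun.induct)
  case (polyfun_const c)
  then show ?case by (intro exI[of _ "norm c"] exI[of _ 0]) auto
next
  case (polyfun_coord P i)
  then obtain C M where *: "norm (P x) \<le> C * (1 + norm x) ^ M" for x by blast
  have "norm (of_real (x $ i) * P x) \<le> C * (1 + norm x) ^ Suc M" for x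
  proof -
    have "norm (of_real (x $ i) * P x) = \<bar>x $ i\<bar> * norm (P x)" by (simp add: norm_mult)
    also have "\<dots> \<le> (1 + norm x) * (C * (1 + norm x) ^ M)"
      using component_le_norm_cart[of x i] by (intro mult_mono *) auto
    finally show ?thesis by (simp add: mult_ac)
  qed
  then show ?case by blast
next
  case (polyfun_add P Q)
  then obtain C M C' M' where *: "norm (P x) \<le> C * (1 + norm x) ^ M"
    "norm (Q x) \<le> C' * (1 + norm x) ^ M'" for x by metis
  have pos: "C \<ge> 0" "C' \<ge> 0"
    using order_trans[OF norm_ge_zero *(1)[of 0]] order_trans[OF norm_ge_zero *(2)[of 0]] by auto
  have "norm (P x + Q x) \<le> (C + C') * (1 + norm x) ^ (M + M')" for x
  proof -
    have "norm (P x + Q x) \<le> C * (1 + norm x) ^ M + C' * (1 + norm x) ^ M'"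
      using *[of x] norm_triangle_ineq[of "P x" "Q x"] by linarith
    also have "\<dots> \<le> C * (1 + norm x) ^ (M + M') + C' * (1 + norm x) ^ (M + M')"
      using pos by (intro add_mono mult_left_mono power_increasing) auto
    finally show ?thesis by (simp add: algebra_simps)
  qed
  then show ?case by blast
qed

text \<open>Arbitrary directions are allowed because the moment recursion differentiates along
  \<omega> itself and Euler's identity along the point \<open>x\<close>.\<close>

definition dirderiv :: "real ^ 'n \<Rightarrow> (real ^ 'n \<Rightarrow> complex) \<Rightarrow> real ^ 'n \<Rightarrow> complex"
  where "dirderiv v P x = vector_derivative (\<lambda>t. P (x + t *\<^sub>R v)) (at 0)"

lemma partial_deriv_eq: "partial_deriv i = dirderiv (axis i 1)"
  by (intro ext) (simp add: partial_deriv_def dirderiv_def)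

lemma polyfun_has_dirderiv:
  assumes "polyfun P"
  shows "\<exists>P'. polyfun P' \<and> (\<forall>x. ((\<lambda>t. P (x + t *\<^sub>R v)) has_vector_derivative P' x) (at 0))"
  using assms
proof (induction rule: polyfun.induct)
  case (polyfun_const c)
  then show ?case by (intro exI[of _ "\<lambda>_. 0"]) (auto intro: polyfun.polyfun_const)
next
  case (polyfun_coord P i)
  then obtain P' where P': "polyfun P'"
    "((\<lambda>t. P (x + t *\<^sub>R v)) has_vector_derivative P' x) (at 0)" for x by blast
  have "((\<lambda>t. of_real ((x + t *\<^sub>R v) $ i) * P (x + t *\<^sub>R v)) has_vector_derivative
      of_real (x $ i) * P' x + of_real (v $ i) * P x) (at 0)" for x
  proof -
    have "((\<lambda>t. of_real ((x + t *\<^sub>R v) $ i) :: complex) has_vector_derivative of_real (v $ i)) (at 0)"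
      by (intro has_vector_derivative_of_real) (auto intro!: derivative_eq_intros)
    from has_vector_derivative_mult[OF this P'(2)] show ?thesis by simp
  qed
  moreover have "polyfun (\<lambda>x. of_real (x $ i) * P' x + of_real (v $ i) * P x)"
    by (intro polyfun.intros polyfun_cmult P' polyfun_coord)
  ultimately show ?case by blast
next
  case (polyfun_add P Q)
  then obtain P' Q' where P': "polyfun P'" "polyfun Q'"
    "((\<lambda>t. P (x + t *\<^sub>R v)) has_vector_derivative P' x) (at 0)"
    "((\<lambda>t. Q (x + t *\<^sub>R v)) has_vector_derivative Q' x) (at 0)" for x by metis
  show ?case
    by (intro exI[of _ "\<lambda>x. P' x + Q' x"] conjI allI has_vector_derivative_add P' polyfun.intros)
qed

lemma polyfun_dirderiv: "polyfun P \<Longrightarrow> polyfun (dirderiv v P)"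
  and has_vector_derivative_dirderiv:
    "polyfun P \<Longrightarrow> ((\<lambda>t. P (x + t *\<^sub>R v)) has_vector_derivative dirderiv v P x) (at 0)"
proof -
  assume "polyfun P"
  from polyfun_has_dirderiv[OF this, of v] obtain P' where P': "polyfun P'"
    "((\<lambda>t. P (x + t *\<^sub>R v)) has_vector_derivative P' x) (at 0)" for x by blast
  then have "dirderiv v P = P'"
    by (intro ext) (simp add: dirderiv_def vector_derivative_at)
  with P' show "polyfun (dirderiv v P)"
    "((\<lambda>t. P (x + t *\<^sub>R v)) has_vector_derivative dirderiv v P x) (at 0)" by simp_all
qed

lemma has_vector_derivative_dirderiv_at:
  assumes "polyfun P"
  shows "((\<lambda>s. P (x + s *\<^sub>R v)) has_vector_derivative dirderiv v P (x + t *\<^sub>R v)) (at t)"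
proof -
  have "((\<lambda>s. P ((x + t *\<^sub>R v) + s *\<^sub>R v)) has_vector_derivative dirderiv v P (x + t *\<^sub>R v)) (at (t - t))"
    using has_vector_derivative_dirderiv[OF assms, of "x + t *\<^sub>R v"] by simp
  then have "((\<lambda>s. P ((x + t *\<^sub>R v) + (s - t) *\<^sub>R v)) has_vector_derivative 1 *\<^sub>R dirderiv v P (x + t *\<^sub>R v)) (at t)"
    by (intro vector_diff_chain_at[where f = "\<lambda>s. s - t" and g = "\<lambda>s. P ((x + t *\<^sub>R v) + s *\<^sub>R v)",
          unfolded o_def]) (auto intro!: derivative_eq_intros)
  then show ?thesis by (simp add: algebra_simps)
qed

lemma dirderiv_const [simp]: "dirderiv v (\<lambda>_. c) x = 0"
  by (simp add: dirderiv_def)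

lemma dirderiv_add:
  "polyfun P \<Longrightarrow> polyfun Q \<Longrightarrow> dirderiv v (\<lambda>x. P x + Q x) x = dirderiv v P x + dirderiv v Q x"
  unfolding dirderiv_def[of v "\<lambda>x. P x + Q x"]
  by (intro vector_derivative_at has_vector_derivative_add has_vector_derivative_dirderiv)

lemma dirderiv_mult:
  assumes "polyfun P" "polyfun Q"
  shows "dirderiv v (\<lambda>x. P x * Q x) x = P x * dirderiv v Q x + dirderiv v P x * Q x"
  unfolding dirderiv_def[of v "\<lambda>x. P x * Q x"]
  using has_vector_derivative_mult[OF assms[THEN has_vector_derivative_dirderiv]]
  by (intro vector_derivative_at) simp

lemma dirderiv_cmult: "polyfun P \<Longrightarrow> dirderiv v (\<lambda>x. c * P x) x = c * dirderiv v P x"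
  by (subst dirderiv_mult) (auto intro: polyfun_const)

lemma dirderiv_sum:
  assumes "\<And>i. i \<in> I \<Longrightarrow> polyfun (P i)"
  shows "dirderiv v (\<lambda>x. \<Sum>i\<in>I. P i x) x = (\<Sum>i\<in>I. dirderiv v (P i) x)"
  using assms
  by (induction I rule: infinite_finite_induct) (auto simp: dirderiv_add polyfun_sum)

lemma dirderiv_power:
  assumes "polyfun P"
  shows "dirderiv v (\<lambda>x. P x ^ n) x = of_nat n * P x ^ (n - 1) * dirderiv v P x"
proof (induction n)
  case (Suc n)
  have "dirderiv v (\<lambda>x. P x ^ Suc n) x = P x * dirderiv v (\<lambda>x. P x ^ n) x + dirderiv v P x * P x ^ n"
    using assms by (simp add: dirderiv_mult polyfun_power)
  also have "\<dots> = of_nat (Suc n) * P x ^ n * dirderiv v P x"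
    unfolding Suc.IH by (cases n) (simp_all add: algebra_simps)
  finally show ?case by simp
qed simp

lemma dirderiv_inner: "dirderiv v (\<lambda>x. of_real (x \<bullet> w)) x = of_real (v \<bullet> w)"
  unfolding dirderiv_def
  by (intro vector_derivative_at)
     (intro has_vector_derivative_of_real, auto intro!: derivative_eq_intros simp: inner_add_left)

lemma dirderiv_component: "dirderiv v (\<lambda>x. of_real (x $ i)) x = of_real (v $ i)"
  using dirderiv_inner[of v "axis i 1" x] by (simp add: inner_axis)

lemma dirderiv_inner_self: "dirderiv v (\<lambda>x. of_real (x \<bullet> x)) x = of_real (2 * (x \<bullet> v))"
  unfolding dirderiv_def
  by (intro vector_derivative_at has_vector_derivative_of_real)
     (auto intro!: derivative_eq_intros simp: inner_add_left inner_add_right inner_commute)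

lemma dirderiv_coord:
  "polyfun P \<Longrightarrow> dirderiv v (\<lambda>x. of_real (x $ i) * P x) x = of_real (x $ i) * dirderiv v P x + of_real (v $ i) * P x"
  by (simp add: dirderiv_mult polyfun_component dirderiv_component)

lemma dirderiv_eq_sum:
  assumes "polyfun P"
  shows "dirderiv v P x = (\<Sum>i\<in>UNIV. of_real (v $ i) * partial_deriv i P x)"
  using assms unfolding partial_deriv_eq
proof (induction rule: polyfun.induct)
  case (polyfun_coord P i)
  have "(\<Sum>j\<in>UNIV. complex_of_real (v $ j) * (of_real (x $ i) * dirderiv (axis j 1) P x + of_real (axis j 1 $ i) * P x))
     = of_real (x $ i) * (\<Sum>j\<in>UNIV. of_real (v $ j) * dirderiv (axis j 1) P x) + of_real (v $ i) * P x"
    by (simp add: ring_distribs sum.distrib sum_distrib_left mult_ac axis_def if_distrib[of of_real]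
          if_distrib[of "\<lambda>x. _ * x"] cong: if_cong)
  then show ?case by (simp add: dirderiv_coord polyfun_coord)
qed (simp_all add: dirderiv_add sum.distrib ring_distribs)

lemma dirderiv_commute:
  assumes "polyfun P"
  shows "dirderiv v (dirderiv w P) = dirderiv w (dirderiv v P)"
  using assms
proof (induction rule: polyfun.induct)
  case (polyfun_const c)
  have "dirderiv u (\<lambda>_. c) = (\<lambda>_. 0)" for u :: "real ^ 'n" by (intro ext) simp
  then show ?case by (intro ext) simp
next
  case (polyfun_coord P i)
  have "dirderiv u (\<lambda>x. of_real (x $ i) * P x) = (\<lambda>x. of_real (x $ i) * dirderiv u P x + of_real (u $ i) * P x)" for u
    by (intro ext dirderiv_coord polyfun_coord)
  then show ?case
    by (intro ext)
       (simp add: dirderiv_add dirderiv_coord dirderiv_cmult polyfun_cmult polyfun_dirderiv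
         polyfun.polyfun_coord polyfun_coord)
next
  case (polyfun_add P Q)
  have "dirderiv u (\<lambda>x. P x + Q x) = (\<lambda>x. dirderiv u P x + dirderiv u Q x)" for u
    by (intro ext dirderiv_add polyfun_add)
  then show ?case
    by (intro ext) (simp add: dirderiv_add polyfun_dirderiv polyfun_add)
qed

lemma laplacian_eq: "laplacian P x = (\<Sum>i\<in>UNIV. dirderiv (axis i 1) (dirderiv (axis i 1) P) x)"
  by (simp add: laplacian_def partial_deriv_eq)

text \<open>This is why directional derivatives of harmonic polynomials are harmonic, which lowers
  the degree in the moment recursion.\<close>

lemma laplacian_dirderiv:
  assumes "polyfun P"
  shows "laplacian (dirderiv v P) x = dirderiv v (laplacian P) x"
proof -
  have "laplacian P = (\<lambda>x. \<Sum>i\<in>UNIV. dirderiv (axis i 1) (dirderiv (axis i 1) P) x)"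
    by (intro ext laplacian_eq)
  then have "dirderiv v (laplacian P) x = (\<Sum>i\<in>UNIV. dirderiv v (dirderiv (axis i 1) (dirderiv (axis i 1) P)) x)"
    using assms by (simp add: dirderiv_sum polyfun_dirderiv)
  also have "\<dots> = (\<Sum>i\<in>UNIV. dirderiv (axis i 1) (dirderiv (axis i 1) (dirderiv v P)) x)"
    using assms by (simp add: dirderiv_commute[of _ v] polyfun_dirderiv)
  finally show ?thesis by (simp add: laplacian_eq)
qed

section \<open>Gaussian integrals\<close>

text \<open>Even and odd moments have closed forms of different shape; the Gamma function covers
  both, so the radial factor can later be divided out without regard to parity.\<close>

lemma gaussian_moment_pos:
  "has_bochner_integral lborel (\<lambda>x::real. indicator {0..} x *\<^sub>R (exp (- x\<^sup>2) * x ^ n)) (Gamma ((real n + 1) / 2) / 2)"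
proof -
  have even: "Gamma ((real (2 * k) + 1) / 2) / 2 = (sqrt pi / 2) * (fact (2 * k) / (2 ^ (2 * k) * fact k))" for k
  proof (induction k)
    case (Suc k)
    have "Gamma ((real (2 * Suc k) + 1) / 2) = Gamma ((real (2 * k) + 1) / 2 + 1)"
      by (simp add: field_simps)
    also have "\<dots> = (real (2 * k) + 1) / 2 * Gamma ((real (2 * k) + 1) / 2)"
      by (intro Gamma_plus1) (auto simp: field_simps elim!: nonpos_Ints_cases)
    finally have "Gamma ((real (2 * Suc k) + 1) / 2) / 2 =
        (real (2 * k) + 1) / 2 * (Gamma ((real (2 * k) + 1) / 2) / 2)"
      by simp
    also note Suc.IH
    also have "(real (2 * k) + 1) / 2 * (sqrt pi / 2 * (fact (2 * k) / (2 ^ (2 * k) * fact k)))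
        = sqrt pi / 2 * (fact (2 * Suc k) / (2 ^ (2 * Suc k) * fact (Suc k)))"
      by (simp add: divide_simps) (simp add: algebra_simps)
    finally show ?case .
  qed (simp add: Gamma_one_half_real)
  have odd: "Gamma ((real (2 * k + 1) + 1) / 2) / 2 = fact k / 2" for k
    using Gamma_fact[of k, where ?'a = real] by (simp add: add_divide_distrib add.commute)
  show ?thesis
  proof (cases "even n")
    case True
    then obtain k where "n = 2 * k" by blast
    then show ?thesis using gaussian_moment_even_pos[of k] by (simp only: even)
  next
    case False
    then obtain k where "n = 2 * k + 1" by (blast elim: oddE)
    then show ?thesis using gaussian_moment_odd_pos[of k] by (simp only: odd)
  qed
qed

lemma integral_radial_gaussian:
  assumes "d \<ge> 1"
  shows "integrable (radial_measure d) (\<lambda>r. exp (- r\<^sup>2) * r ^ n)"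
    and "(\<integral>r. exp (- r\<^sup>2) * r ^ n \<partial>radial_measure d) = Gamma ((real n + real d) / 2) / 2"
proof -
  have "has_bochner_integral lborel
      (\<lambda>x::real. indicator {0..} x *\<^sub>R (exp (- x\<^sup>2) * x ^ (n + (d - 1)))) (Gamma ((real n + real d) / 2) / 2)"
    using gaussian_moment_pos[of "n + (d - 1)"] assms by (simp add: of_nat_diff)
  then have "has_bochner_integral lborel
      (\<lambda>r. (r ^ (d - 1) * indicator {0<..} r) *\<^sub>R (exp (- r\<^sup>2) * r ^ n)) (Gamma ((real n + real d) / 2) / 2)"
    by (rule has_bochner_integral_cong_AE[THEN iffD1, rotated 3])
       (auto intro!: AE_I[of _ _ "{0}"] simp: power_add split: split_indicator)
  then have "has_bochner_integral (density lborel (\<lambda>r. ennreal (r ^ (d - 1) * indicator {0<..} r)))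
      (\<lambda>r. exp (- r\<^sup>2) * r ^ n) (Gamma ((real n + real d) / 2) / 2)"
    by (intro has_bochner_integral_density) (auto split: split_indicator)
  moreover have "radial_measure d = density lborel (\<lambda>r. ennreal (r ^ (d - 1) * indicator {0<..} r))"
    unfolding radial_measure_def by (intro arg_cong[where f="density lborel"] ext) (auto split: split_indicator)
  ultimately have *: "has_bochner_integral (radial_measure d)
      (\<lambda>r. exp (- r\<^sup>2) * r ^ n) (Gamma ((real n + real d) / 2) / 2)" by simp
  show "integrable (radial_measure d) (\<lambda>r. exp (- r\<^sup>2) * r ^ n)"
    "(\<integral>r. exp (- r\<^sup>2) * r ^ n \<partial>radial_measure d) = Gamma ((real n + real d) / 2) / 2"
    using * by (auto simp: has_bochner_integral_iff)
qed

lemma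
  fixes h :: "real ^ 'n \<Rightarrow> complex"
  assumes [measurable]: "h \<in> borel_measurable borel"
  shows integrable_polar_iff: "integrable lborel h \<longleftrightarrow>
      integrable (radial_measure CARD('n) \<Otimes>\<^sub>M sphere_measure) (\<lambda>(r, \<omega>). h (r *\<^sub>R \<omega>))"
    and integral_polar: "(\<integral>x. h x \<partial>lborel) =
      (\<integral>(r, \<omega>). h (r *\<^sub>R \<omega>) \<partial>(radial_measure CARD('n) \<Otimes>\<^sub>M sphere_measure))"
  unfolding polar_coordinates_distr
  by (subst integrable_distr_eq integral_distr; simp add: norm_scaleR_direction)+

definition gauss :: "real ^ 'n \<Rightarrow> real"
  where "gauss y = exp (- (y \<bullet> y))"

lemma gauss_pos: "gauss y > 0"
  by (simp add: gauss_def)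

lemma gauss_continuous: "continuous_on S gauss"
  unfolding gauss_def by (intro continuous_intros)

lemma gauss_measurable [measurable]: "gauss \<in> borel_measurable borel"
  by (intro borel_measurable_continuous_onI gauss_continuous)

lemma gauss_scaleR: "norm \<omega> = 1 \<Longrightarrow> gauss (r *\<^sub>R \<omega>) = exp (- r\<^sup>2)"
  by (simp add: gauss_def power2_eq_square norm_eq_1)

text \<open>In polar coordinates the polynomial growth bound gives a purely radial majorant, whose
  binomial expansion is a finite sum of radial Gaussian moments.\<close>

lemma integrable_polyfun_gauss:
  fixes P :: "real ^ 'n \<Rightarrow> complex"
  assumes "polyfun P"
  shows "integrable lborel (\<lambda>y. P y * gauss y)"
proof -
  note [measurable] = polyfun_measurable[OF assms]
  have d: "CARD('n) \<ge> 1" by (simp add: Suc_leI)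
  interpret R: sigma_finite_measure "radial_measure CARD('n)"
    by (rule sigma_finite_radial_measure[OF d])
  interpret RS: pair_sigma_finite "radial_measure CARD('n)" "sphere_measure :: (real^'n) measure"
    by unfold_locales
  obtain C M where CM: "norm (P x) \<le> C * (1 + norm x) ^ M" for x
    using polyfun_bounded[OF assms] by blast
  have "C \<ge> 0" using order_trans[OF norm_ge_zero CM[of 0]] by simp
  have 1: "integrable (radial_measure CARD('n)) (\<lambda>r. exp (- r\<^sup>2) * (1 + \<bar>r\<bar>) ^ M)"
  proof -
    have "integrable (radial_measure CARD('n)) (\<lambda>r. \<Sum>k\<le>M. real (M choose k) * (exp (- r\<^sup>2) * r ^ k))"
      by (intro Bochner_Integration.integrable_sum integrable_mult_right integral_radial_gaussian(1) d)
    also have "(\<lambda>r. \<Sum>k\<le>M. real (M choose k) * (exp (- r\<^sup>2) * r ^ k)) = (\<lambda>r. exp (- r\<^sup>2) * (1 + r) ^ M)"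
      using binomial_ring[of _ "1 :: real" M] by (intro ext) (simp add: sum_distrib_left mult_ac add.commute)
    finally have "integrable (radial_measure CARD('n)) (\<lambda>r. exp (- r\<^sup>2) * (1 + r) ^ M)" .
    moreover have "AE r in radial_measure CARD('n). r > 0"
      unfolding radial_measure_def by (subst AE_density) (auto split: split_indicator)
    ultimately show ?thesis
      by (subst integrable_cong_AE[where g = "\<lambda>r. exp (- r\<^sup>2) * (1 + r) ^ M"]) auto
  qed
  have "integrable (radial_measure CARD('n) \<Otimes>\<^sub>M (sphere_measure :: (real^'n) measure))
      (\<lambda>(r, \<omega>). C * (exp (- r\<^sup>2) * (1 + \<bar>r\<bar>) ^ M))"
    using integrable_mult_right[OF 1, of C] \<open>C \<ge> 0\<close>
    by (intro RS.Fubini_integrable) (auto simp: abs_mult)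
  then have "integrable (radial_measure CARD('n) \<Otimes>\<^sub>M (sphere_measure :: (real^'n) measure))
      (\<lambda>(r, \<omega>). P (r *\<^sub>R \<omega>) * gauss (r *\<^sub>R \<omega>))"
  proof (rule Bochner_Integration.integrable_bound)
    show "AE z in radial_measure CARD('n) \<Otimes>\<^sub>M sphere_measure.
        norm (case z of (r, \<omega> :: real^'n) \<Rightarrow> P (r *\<^sub>R \<omega>) * gauss (r *\<^sub>R \<omega>))
          \<le> norm (case z of (r, \<omega>) \<Rightarrow> C * (exp (- r\<^sup>2) * (1 + \<bar>r\<bar>) ^ M))"
    proof (rule AE_I2)
      fix z assume "z \<in> space (radial_measure CARD('n) \<Otimes>\<^sub>M (sphere_measure :: (real^'n) measure))"
      then obtain r and \<omega> :: "real^'n" where z: "z = (r, \<omega>)" "norm \<omega> = 1"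
        by (auto simp: space_pair_measure norm_sphere_measure)
      show "norm (case z of (r, \<omega> :: real^'n) \<Rightarrow> P (r *\<^sub>R \<omega>) * gauss (r *\<^sub>R \<omega>))
          \<le> norm (case z of (r, \<omega>) \<Rightarrow> C * (exp (- r\<^sup>2) * (1 + \<bar>r\<bar>) ^ M))"
        using CM[of "r *\<^sub>R \<omega>"] z \<open>C \<ge> 0\<close> by (simp add: norm_mult gauss_scaleR abs_mult)
    qed
  qed measurable
  then show ?thesis
    by (subst integrable_polar_iff) (auto simp: case_prod_unfold)
qed

section \<open>Translation invariance and integration by parts against the Gaussian\<close>

lemma
  fixes f :: "real ^ 'n \<Rightarrow> complex"
  assumes [measurable]: "f \<in> borel_measurable borel"
  shows integrable_translate: "integrable lborel (\<lambda>y. f (y + c)) \<longleftrightarrow> integrable lborel f"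
    and integral_translate: "(\<integral>y. f (y + c) \<partial>lborel) = (\<integral>y. f y \<partial>lborel)"
proof -
  have "integrable (distr lborel borel ((+) c)) f \<longleftrightarrow> integrable lborel (\<lambda>y. f (c + y))"
    by (rule integrable_distr_eq) auto
  then show "integrable lborel (\<lambda>y. f (y + c)) \<longleftrightarrow> integrable lborel f"
    by (simp add: lborel_distr_plus add.commute)
  have "integral\<^sup>L (distr lborel borel ((+) c)) f = (\<integral>y. f (c + y) \<partial>lborel)"
    by (rule integral_distr) auto
  then show "(\<integral>y. f (y + c) \<partial>lborel) = (\<integral>y. f y \<partial>lborel)"
    by (simp add: lborel_distr_plus add.commute)
qed

text \<open>By Fubini and the translation invariance of Lebesgue measure, the integral of the
  derivative equals the integral of the difference \<open>h (y + v) - h y\<close>.\<close>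

lemma integral_directional_derivative_eq_0:
  fixes h h' :: "real ^ 'n \<Rightarrow> complex"
  assumes h: "integrable lborel h" and h': "integrable lborel h'"
    and cont: "continuous_on UNIV h'"
    and deriv: "\<And>y t. ((\<lambda>s. h (y + s *\<^sub>R v)) has_vector_derivative h' (y + t *\<^sub>R v)) (at t)"
  shows "(\<integral>y. h' y \<partial>lborel) = 0"
proof -
  have [measurable]: "h' \<in> borel_measurable borel" "h \<in> borel_measurable borel"
    using h h' by auto
  let ?f = "\<lambda>t y. indicator {0..1::real} t *\<^sub>R h' (y + t *\<^sub>R v)"
  have norm_h': "(\<integral>y. norm (h' (y + c)) \<partial>lborel) = (\<integral>y. norm (h' y) \<partial>lborel)" for c
  proof -
    have "(\<integral>y. complex_of_real (norm (h' (y + c))) \<partial>lborel) = (\<integral>y. complex_of_real (norm (h' y)) \<partial>lborel)"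
      by (rule integral_translate[of "\<lambda>y. complex_of_real (norm (h' y))"]) measurable
    then show ?thesis by (simp only: integral_complex_of_real of_real_eq_iff)
  qed
  have int: "integrable (lborel \<Otimes>\<^sub>M lborel) (case_prod ?f)"
  proof (rule lborel_pair.Fubini_integrable)
    have "(\<lambda>t. \<integral>y. norm (case_prod ?f (t, y)) \<partial>lborel) =
        (\<lambda>t. indicator {0..1} t *\<^sub>R (\<integral>y. norm (h' y) \<partial>lborel))"
      by (intro ext) (simp add: norm_h' split: split_indicator)
    then show "integrable lborel (\<lambda>t. \<integral>y. norm (case_prod ?f (t, y)) \<partial>lborel)"
      by (simp del: case_prod_conv)
    show "AE t in lborel. integrable lborel (\<lambda>y. case_prod ?f (t, y))"
      using h' by (auto simp: integrable_translate)
  qed measurable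
  have "(\<integral>y. h' y \<partial>lborel) = (\<integral>t. indicator {0..1::real} t *\<^sub>R (\<integral>y. h' y \<partial>lborel) \<partial>lborel)"
    by simp
  also have "\<dots> = (\<integral>t. (\<integral>y. ?f t y \<partial>lborel) \<partial>lborel)"
    by (simp add: integral_translate)
  also have "\<dots> = (\<integral>y. (\<integral>t. ?f t y \<partial>lborel) \<partial>lborel)"
    by (rule lborel_pair.Fubini_integral[OF int, symmetric])
  also have "(\<lambda>y. \<integral>t. ?f t y \<partial>lborel) = (\<lambda>y. h (y + v) - h y)"
  proof
    fix y
    have "(\<integral>t. ?f t y \<partial>lborel) = h (y + 1 *\<^sub>R v) - h (y + 0 *\<^sub>R v)"
    proof (rule integral_FTC_Icc)
      show "continuous_on {0..1} (\<lambda>t. h' (y + t *\<^sub>R v))"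
        by (rule continuous_on_compose2[OF cont]) (auto intro!: continuous_intros)
    qed (auto intro: has_vector_derivative_at_within deriv)
    then show "(\<integral>t. ?f t y \<partial>lborel) = h (y + v) - h y" by simp
  qed
  also have "(\<integral>y. h (y + v) - h y \<partial>lborel) = 0"
    using h by (subst Bochner_Integration.integral_diff) (auto simp: integrable_translate integral_translate)
  finally show ?thesis .
qed

text \<open>The derivative of \<open>P * gauss\<close> along \<open>v\<close> has integral 0. The
  factor 2 comes from differentiating \<open>exp (- (y \<bullet> y))\<close>.\<close>

lemma gaussian_integration_by_parts:
  fixes P :: "real ^ 'n \<Rightarrow> complex"
  assumes P: "polyfun P"
  shows "2 * (\<integral>y. of_real (y \<bullet> v) * P y * gauss y \<partial>lborel) = (\<integral>y. dirderiv v P y * gauss y \<partial>lborel)"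
proof -
  have P1: "polyfun (\<lambda>y. of_real (y \<bullet> v) * P y)" by (intro polyfun_mult polyfun_inner P)
  let ?h' = "\<lambda>y. dirderiv v P y * gauss y - 2 * (of_real (y \<bullet> v) * P y * gauss y)"
  have int: "integrable lborel (\<lambda>y. dirderiv v P y * gauss y)"
     "integrable lborel (\<lambda>y. of_real (y \<bullet> v) * P y * gauss y)"
    using integrable_polyfun_gauss[OF polyfun_dirderiv[OF P]] integrable_polyfun_gauss[OF P1] by auto
  have "(\<integral>y. ?h' y \<partial>lborel) = 0"
  proof (rule integral_directional_derivative_eq_0[where h = "\<lambda>y. P y * gauss y"])
    show "integrable lborel (\<lambda>y. P y * gauss y)" by (rule integrable_polyfun_gauss[OF P])
    show "integrable lborel ?h'" using int by auto
    show "continuous_on UNIV ?h'"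
      using polyfun_continuous[OF P] polyfun_continuous[OF polyfun_dirderiv[OF P]] gauss_continuous
      by (auto intro!: continuous_intros)
    fix y t
    have "((\<lambda>s. gauss (y + s *\<^sub>R v)) has_field_derivative
        gauss (y + t *\<^sub>R v) * (- (2 * ((y + t *\<^sub>R v) \<bullet> v)))) (at t)"
      unfolding gauss_def
      by (auto intro!: derivative_eq_intros simp: inner_add_left inner_add_right inner_commute algebra_simps)
    from has_vector_derivative_mult[OF has_vector_derivative_dirderiv_at[OF P] has_vector_derivative_of_real[OF this]]
    show "((\<lambda>s. P (y + s *\<^sub>R v) * gauss (y + s *\<^sub>R v)) has_vector_derivative ?h' (y + t *\<^sub>R v)) (at t)"
      by (rule has_vector_derivative_eq_rhs) (simp add: algebra_simps)
  qed
  then show ?thesis using int by simp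
qed

section \<open>Moments of solid harmonics\<close>

text \<open>Homogeneity is expressed by scaling instead of monomials, as this passes easily to
  derivatives, conjugates and moments. The case \<open>c = 0\<close> is included, so that degree 0
  forces a constant through \<open>0 ^ 0 = 1\<close>.\<close>

definition solid_harmonic :: "nat \<Rightarrow> (real ^ 'n \<Rightarrow> complex) \<Rightarrow> bool"
  where "solid_harmonic k P \<longleftrightarrow>
    polyfun P \<and> (\<forall>c x. P (c *\<^sub>R x) = of_real c ^ k * P x) \<and> (\<forall>x. laplacian P x = 0)"

lemma solid_harmonic_polyfun: "solid_harmonic k P \<Longrightarrow> polyfun P"
  and solid_harmonic_scaleR: "solid_harmonic k P \<Longrightarrow> P (c *\<^sub>R x) = of_real c ^ k * P x"
  and solid_harmonic_laplacian: "solid_harmonic k P \<Longrightarrow> laplacian P x = 0"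
  by (auto simp: solid_harmonic_def)

lemma spherical_harmonic_imp_solid:
  assumes "spherical_harmonic k Y"
  obtains P where "solid_harmonic k P" "\<And>\<omega>. norm \<omega> = 1 \<Longrightarrow> Y \<omega> = P \<omega>"
proof -
  from assms obtain P where P: "homogeneous_polynomial k P" "\<forall>x. laplacian P x = 0"
    "\<And>\<omega>. norm \<omega> = 1 \<Longrightarrow> Y \<omega> = P \<omega>" unfolding spherical_harmonic_def by (auto simp: dist_norm)
  then obtain c where c: "P = (\<lambda>x. \<Sum>\<alpha> | sum \<alpha> UNIV = k. c \<alpha> * (\<Prod>i\<in>UNIV. complex_of_real (x $ i) ^ \<alpha> i))"
    unfolding homogeneous_polynomial_def by blast
  have "polyfun P"
    unfolding c by (intro polyfun_sum polyfun_prod polyfun_cmult polyfun_power polyfun_component)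
  moreover have "P (s *\<^sub>R x) = of_real s ^ k * P x" for s x
    unfolding c sum_distrib_left
    by (intro sum.cong refl) (auto simp: power_mult_distrib prod.distrib mult_ac power_sum)
  ultimately show ?thesis using that P by (auto simp: solid_harmonic_def)
qed

text \<open>Orthogonality is proved below for the bilinear pairing; closure under conjugation turns
  it into orthogonality for the Hermitian one.\<close>

lemma solid_harmonic_cnj:
  assumes "solid_harmonic k P"
  shows "solid_harmonic k (\<lambda>x. cnj (P x))"
proof -
  have P: "polyfun P" using assms by (rule solid_harmonic_polyfun)
  have D: "dirderiv v (\<lambda>x. cnj (Q x)) = (\<lambda>x. cnj (dirderiv v Q x))" if "polyfun Q" for v Q
    unfolding dirderiv_def[of v "\<lambda>x. cnj (Q x)"]
    by (intro ext vector_derivative_at bounded_linear.has_vector_derivative[OF bounded_linear_cnj]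
        has_vector_derivative_dirderiv that)
  have "laplacian (\<lambda>x. cnj (P x)) x = cnj (laplacian P x)" for x
    by (simp add: laplacian_eq D P polyfun_dirderiv)
  with assms show ?thesis by (simp add: solid_harmonic_def polyfun_cnj)
qed

text \<open>Euler's identity: along its own direction \<open>P\<close> is
  \<open>(1 + t) ^ k * P x\<close>, differentiated at \<open>t = 0\<close>.\<close>

lemma dirderiv_self_homogeneous:
  assumes "\<And>c x. P (c *\<^sub>R x) = of_real c ^ k * P x"
  shows "dirderiv x P x = of_nat k * P x"
proof -
  have "(\<lambda>t. P (x + t *\<^sub>R x)) = (\<lambda>t. of_real ((1 + t) ^ k) * P x)"
    using assms[of "1 + _" x] by (intro ext) (simp add: scaleR_left_distrib)
  moreover have "((\<lambda>t. of_real ((1 + t) ^ k) * P x) has_vector_derivative of_real (real k) * P x) (at 0)"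
    by (intro has_vector_derivative_mult_left has_vector_derivative_of_real) (auto intro!: derivative_eq_intros)
  ultimately have "((\<lambda>t. P (x + t *\<^sub>R x)) has_vector_derivative of_real (real k) * P x) (at 0)"
    by simp
  then show ?thesis unfolding dirderiv_def by (subst vector_derivative_at) auto
qed

text \<open>For \<open>c \<noteq> 0\<close>, differentiate the scaling law along
  \<open>c *\<^sub>R v\<close> and cancel one factor \<open>c\<close>. At \<open>c = 0\<close> this
  division fails, and the identity follows by continuity of the polynomial derivative.\<close>

lemma dirderiv_homogeneous:
  assumes P: "polyfun P" and hom: "\<And>c x. P (c *\<^sub>R x) = of_real c ^ Suc k * P x"
  shows "dirderiv v P (c *\<^sub>R x) = of_real c ^ k * dirderiv v P x"
proof -
  have ne: "dirderiv v P (c *\<^sub>R x) = of_real c ^ k * dirderiv v P x" if "c \<noteq> 0" for c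
  proof -
    have "((\<lambda>t. P (c *\<^sub>R x + t *\<^sub>R c *\<^sub>R v)) has_vector_derivative of_real c ^ Suc k * dirderiv v P x) (at 0)"
      using has_vector_derivative_mult_right[OF has_vector_derivative_dirderiv[OF P, of x v], of "of_real c ^ Suc k"]
        hom[of c "x + _ *\<^sub>R v"] by (simp add: scaleR_right_distrib mult.commute)
    then have "dirderiv (c *\<^sub>R v) P (c *\<^sub>R x) = of_real c ^ Suc k * dirderiv v P x"
      by (simp add: dirderiv_def vector_derivative_at)
    moreover have "dirderiv (c *\<^sub>R v) P (c *\<^sub>R x) = of_real c * dirderiv v P (c *\<^sub>R x)"
      by (simp add: dirderiv_eq_sum[OF P] sum_distrib_left mult_ac)
    ultimately show ?thesis using that by simp
  qed
  have cont: "continuous_on UNIV (\<lambda>c. dirderiv v P (c *\<^sub>R x))"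
    by (rule continuous_on_compose2[OF polyfun_continuous[OF polyfun_dirderiv[OF P], of UNIV]])
       (auto intro!: continuous_intros)
  have "((\<lambda>c. dirderiv v P (c *\<^sub>R x) - of_real c ^ k * dirderiv v P x) \<longlongrightarrow>
      dirderiv v P (0 *\<^sub>R x) - of_real 0 ^ k * dirderiv v P x) (at 0)"
    using cont[unfolded continuous_on_def, rule_format, of 0] by (intro tendsto_intros) auto
  moreover have "((\<lambda>c. dirderiv v P (c *\<^sub>R x) - of_real c ^ k * dirderiv v P x) \<longlongrightarrow> 0) (at (0::real))"
    by (rule tendsto_eventually) (auto simp: eventually_at_filter ne)
  ultimately have "dirderiv v P (0 *\<^sub>R x) - of_real 0 ^ k * dirderiv v P x = 0"
    by (rule tendsto_unique[rotated]) simp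
  with ne show ?thesis by (cases "c = 0") auto
qed

lemma solid_harmonic_dirderiv:
  assumes "solid_harmonic (Suc k) P"
  shows "solid_harmonic k (dirderiv v P)"
proof -
  note P = solid_harmonic_polyfun[OF assms]
  have "laplacian P = (\<lambda>_. 0)" using solid_harmonic_laplacian[OF assms] by blast
  then show ?thesis
    using solid_harmonic_scaleR[OF assms]
    by (auto simp: solid_harmonic_def polyfun_dirderiv P laplacian_dirderiv dirderiv_homogeneous)
qed

lemma solid_harmonic_0:
  assumes "solid_harmonic 0 P" shows "P = (\<lambda>_. P 0)"
proof
  show "P x = P 0" for x using solid_harmonic_scaleR[OF assms, of 0 x] by simp
qed

text \<open>\<open>harmonic_moment m k\<close> is the factor in the Gaussian moment \<open>(y \<bullet> \<omega>) ^ m\<close> against a solid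
  harmonic of degree \<open>k\<close>; the recursion is one integration by parts in the direction \<open>\<omega>\<close>.\<close>

fun harmonic_moment :: "nat \<Rightarrow> nat \<Rightarrow> real" where
  "harmonic_moment 0 k = (if k = 0 then 1 else 0)"
| "harmonic_moment (Suc m) k = (m * harmonic_moment (m - 1) k + k * harmonic_moment m (k - 1)) / 2"

text \<open>The value is \<open>pi powr (d / 2)\<close>, but it stays symbolic: only its positivity
  is used.\<close>

definition gauss_mass :: "'n::finite itself \<Rightarrow> real"
  where "gauss_mass _ = (\<integral>y. gauss (y :: real ^ 'n) \<partial>lborel)"

text \<open>Euler's identity writes \<open>k * P\<close> as the sum of the products of
  \<open>y $ i\<close> with the partial derivatives of \<open>P\<close>. Integrating each product by
  parts leaves half the integral of the Laplacian, which is 0.\<close>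

lemma integral_solid_harmonic_gauss:
  fixes P :: "real ^ 'n \<Rightarrow> complex"
  assumes P: "solid_harmonic k P" and k: "k > 0"
  shows "(\<integral>y. P y * gauss y \<partial>lborel) = 0"
proof -
  note pf = solid_harmonic_polyfun[OF P]
  have pf': "polyfun (partial_deriv i P)" for i
    unfolding partial_deriv_eq by (rule polyfun_dirderiv[OF pf])
  have "2 * (of_nat k * (\<integral>y. P y * gauss y \<partial>lborel)) = 2 * (\<integral>y. dirderiv y P y * gauss y \<partial>lborel)"
    using dirderiv_self_homogeneous[OF solid_harmonic_scaleR[OF P]] by (simp add: mult.assoc)
  also have "\<dots> = 2 * (\<integral>y. (\<Sum>i\<in>UNIV. of_real (y \<bullet> axis i 1) * partial_deriv i P y * gauss y) \<partial>lborel)"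
    by (simp add: dirderiv_eq_sum[OF pf] sum_distrib_right inner_axis)
  also have "\<dots> = (\<Sum>i\<in>UNIV. 2 * (\<integral>y. of_real (y \<bullet> axis i 1) * partial_deriv i P y * gauss y \<partial>lborel))"
    by (subst Bochner_Integration.integral_sum)
       (auto simp: sum_distrib_left intro!: integrable_polyfun_gauss polyfun_mult polyfun_inner pf')
  also have "\<dots> = (\<Sum>i\<in>UNIV. \<integral>y. partial_deriv i (partial_deriv i P) y * gauss y \<partial>lborel)"
    by (subst gaussian_integration_by_parts[OF pf']) (simp add: partial_deriv_eq)
  also have "\<dots> = (\<integral>y. laplacian P y * gauss y \<partial>lborel)"
    unfolding laplacian_def sum_distrib_right
    by (intro Bochner_Integration.integral_sum[symmetric] integrable_polyfun_gauss)
       (simp add: partial_deriv_eq polyfun_dirderiv pf)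
  also have "\<dots> = 0" using solid_harmonic_laplacian[OF P] by simp
  finally show ?thesis using k by simp
qed

text \<open>Integrating one factor \<open>y \<bullet> \<omega>\<close> by parts, the derivative
  either lowers the remaining power, with \<open>\<omega> \<bullet> \<omega> = 1\<close>, or falls
  on \<open>P\<close>. In the second case it produces a solid harmonic of degree
  \<open>k - 1\<close> whose value at \<omega> is again \<open>k * P \<omega>\<close> by Euler's
  identity, so the result stays proportional to \<open>P \<omega>\<close>. The induction must
  therefore range over all \<open>k\<close> and \<open>P\<close>.\<close>

lemma gaussian_moment_solid_harmonic:
  fixes P :: "real ^ 'n \<Rightarrow> complex" and \<omega> :: "real ^ 'n"
  assumes P: "solid_harmonic k P" and \<omega>: "norm \<omega> = 1"
  shows "(\<integral>y. of_real (y \<bullet> \<omega>) ^ m * P y * gauss y \<partial>lborel) =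
    gauss_mass TYPE('n) * harmonic_moment m k * P \<omega>"
  using P
proof (induction m arbitrary: k P rule: less_induct)
  case (less m)
  note pf = solid_harmonic_polyfun[OF less.prems]
  show ?case
  proof (cases m)
    case 0
    show ?thesis
    proof (cases "k = 0")
      case True
      have "P = (\<lambda>_. P 0)" using solid_harmonic_0 less.prems True by blast
      then have eq: "P y = P \<omega>" for y by metis
      have "(\<lambda>y. P y * gauss y) = (\<lambda>y. P \<omega> * complex_of_real (gauss y))"
        by (rule ext) (subst eq, rule refl)
      then show ?thesis using 0 True
        by (simp add: gauss_mass_def integral_complex_of_real mult.commute)
    next
      case False
      then show ?thesis using 0 integral_solid_harmonic_gauss[OF less.prems] by simp
    qed
  next
    case (Suc n)
    let ?Q = "\<lambda>y. of_real (y \<bullet> \<omega>) ^ n * P y"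
    have pfQ: "polyfun ?Q" by (intro polyfun_mult polyfun_power polyfun_inner pf)
    have D: "dirderiv \<omega> ?Q y =
        of_nat n * (of_real (y \<bullet> \<omega>) ^ (n - 1) * P y) + of_real (y \<bullet> \<omega>) ^ n * dirderiv \<omega> P y" for y
      using \<omega> by (simp add: dirderiv_mult polyfun_power polyfun_inner pf dirderiv_power dirderiv_inner norm_eq_1)
    \<comment> \<open>For \<open>n = 0\<close> the index \<open>n - 1\<close> is truncated, which is
      harmless because the factor \<open>of_nat n\<close> vanishes.\<close>
    have IH1: "of_nat n * (\<integral>y. of_real (y \<bullet> \<omega>) ^ (n - 1) * P y * gauss y \<partial>lborel) =
        of_nat n * (gauss_mass TYPE('n) * harmonic_moment (n - 1) k * P \<omega>)"
      using less.IH[of "n - 1", OF _ less.prems] Suc by (cases n) auto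
    have IH2: "(\<integral>y. of_real (y \<bullet> \<omega>) ^ n * dirderiv \<omega> P y * gauss y \<partial>lborel) =
        gauss_mass TYPE('n) * (k * harmonic_moment n (k - 1)) * P \<omega>"
    proof (cases k)
      case 0
      then have "P = (\<lambda>_. P 0)" using solid_harmonic_0 less.prems by blast
      then have "dirderiv \<omega> P y = 0" for y using dirderiv_const[of \<omega> "P 0" y] by metis
      then show ?thesis using 0 by simp
    next
      case (Suc k')
      have "(\<integral>y. of_real (y \<bullet> \<omega>) ^ n * dirderiv \<omega> P y * gauss y \<partial>lborel) =
          gauss_mass TYPE('n) * harmonic_moment n k' * dirderiv \<omega> P \<omega>"
        using less.prems Suc \<open>m = Suc n\<close> by (intro less.IH solid_harmonic_dirderiv) auto
      also have "dirderiv \<omega> P \<omega> = of_nat k * P \<omega>"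
        by (rule dirderiv_self_homogeneous[OF solid_harmonic_scaleR[OF less.prems]])
      finally show ?thesis using Suc by (simp add: mult_ac)
    qed
    have "2 * (\<integral>y. of_real (y \<bullet> \<omega>) ^ m * P y * gauss y \<partial>lborel) =
        2 * (\<integral>y. of_real (y \<bullet> \<omega>) * ?Q y * gauss y \<partial>lborel)"
      by (simp add: Suc mult.assoc)
    also have "\<dots> = (\<integral>y. of_nat n * (of_real (y \<bullet> \<omega>) ^ (n - 1) * P y * gauss y)
        + of_real (y \<bullet> \<omega>) ^ n * dirderiv \<omega> P y * gauss y \<partial>lborel)"
      unfolding gaussian_integration_by_parts[OF pfQ] D by (simp add: algebra_simps)
    also have "\<dots> = of_nat n * (\<integral>y. of_real (y \<bullet> \<omega>) ^ (n - 1) * P y * gauss y \<partial>lborel)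
        + (\<integral>y. of_real (y \<bullet> \<omega>) ^ n * dirderiv \<omega> P y * gauss y \<partial>lborel)"
      by (subst Bochner_Integration.integral_add)
         (auto intro!: integrable_mult_right integrable_polyfun_gauss polyfun_mult polyfun_power polyfun_inner
            polyfun_dirderiv pf)
    also have "\<dots> = 2 * (gauss_mass TYPE('n) * harmonic_moment m k * P \<omega>)"
      unfolding IH1 IH2 by (simp add: Suc algebra_simps)
    finally show ?thesis by simp
  qed
qed

text \<open>Vanishing for \<open>m < k\<close> is what separates the degrees; the parity condition
  removes every second term from the series of an extension.\<close>

lemma harmonic_moment_eq_0: "m < k \<or> odd (m + k) \<Longrightarrow> harmonic_moment m k = 0"
proof (induction m k rule: harmonic_moment.induct)
  case (2 m k)
  have "real m * harmonic_moment (m - 1) k = 0"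
    using 2 by (cases m) auto
  moreover have "real k * harmonic_moment m (k - 1) = 0"
    using 2 by (cases k) auto
  ultimately show ?case by (simp only: harmonic_moment.simps add_0 div_0)
qed (auto intro: odd_pos)

text \<open>The two summands of the recursion are \<open>4 * j\<close> and \<open>2 * k\<close>
  times the same fraction; the weights add up to twice \<open>k + 2 * j\<close>, which advances the
  factorial by one step.\<close>

lemma harmonic_moment_closed_form:
  "harmonic_moment (k + 2 * j) k = fact (k + 2 * j) / (2 ^ (k + 2 * j) * fact j)"
proof (induction "k + 2 * j" arbitrary: k j rule: less_induct)
  case less
  show ?case
  proof (cases "k + 2 * j")
    case 0
    then show ?thesis by simp
  next
    case (Suc m)
    have a: "real m * harmonic_moment (m - 1) k = 4 * real j * (fact m / (2 ^ Suc m * fact j))"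
    proof (cases j)
      case 0
      then have "m - 1 < k" using Suc by (cases k) auto
      then show ?thesis using 0 harmonic_moment_eq_0[of "m - 1" k] by simp
    next
      case (Suc i)
      with \<open>k + 2 * j = Suc m\<close> have m: "m = Suc (k + 2 * i)" by simp
      have "harmonic_moment (m - 1) k = fact (m - 1) / (2 ^ (m - 1) * fact i)"
        using less[of k i] m Suc by simp
      moreover have "fact m = real m * fact (m - 1)" "(2::real) ^ Suc m = 4 * 2 ^ (m - 1)"
        "(fact j :: real) = real j * fact i" "real j > 0" using m Suc by simp_all
      ultimately show ?thesis by (simp only:) (simp add: field_simps)
    qed
    have b: "real k * harmonic_moment m (k - 1) = 2 * real k * (fact m / (2 ^ Suc m * fact j))"
    proof (cases k)
      case (Suc i)
      with \<open>k + 2 * j = Suc m\<close> have m: "m = i + 2 * j" by simp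
      then have "harmonic_moment m (k - 1) = fact m / (2 ^ m * fact j)"
        using less[of i j] Suc by simp
      then show ?thesis by (simp only:) (simp add: field_simps)
    qed simp
    have "harmonic_moment (k + 2 * j) k = (4 * real j + 2 * real k) * (fact m / (2 ^ Suc m * fact j)) / 2"
      unfolding Suc harmonic_moment.simps a b distrib_right ..
    also have "4 * real j + 2 * real k = 2 * real (Suc m)" using arg_cong[OF Suc, of real] by simp
    finally show ?thesis unfolding Suc by (simp del: of_nat_Suc power_Suc)
  qed
qed

section \<open>From Gaussian moments to moments on the sphere\<close>

lemma integrable_sphere_continuous:
  fixes f :: "real ^ 'n \<Rightarrow> complex"
  assumes "continuous_on (sphere 0 1) f" and m: "f \<in> borel_measurable sphere_measure"
  shows "integrable sphere_measure f"
proof -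
  have "compact (f ` sphere 0 1)" using assms(1) by (rule compact_continuous_image) auto
  then obtain B where "norm y \<le> B" if "y \<in> f ` sphere 0 1" for y
    using compact_imp_bounded bounded_iff by metis
  then have "norm (f x) \<le> B" if "x \<in> sphere 0 1" for x using that by blast
  then show ?thesis
    using m by (intro sphere.integrable_const_bound[where B = B]) (auto simp: space_sphere_measure)
qed

lemma polyfun_integrable_sphere: "polyfun P \<Longrightarrow> integrable sphere_measure P"
  by (intro integrable_sphere_continuous polyfun_continuous borel_measurable_sphere_measure polyfun_measurable)

text \<open>In polar coordinates the integrand is \<open>exp (- r\<^sup>2) * r ^ k\<close> times the
  restriction of \<open>P\<close> to the sphere, so the radial integral is a factor that does not
  see \<open>P\<close> beyond its degree.\<close>

lemma integral_homogeneous_gauss: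
  fixes P :: "real ^ 'n \<Rightarrow> complex"
  assumes P: "polyfun P" and hom: "\<And>c x. P (c *\<^sub>R x) = of_real c ^ k * P x"
  shows "(\<integral>y. P y * gauss y \<partial>lborel) =
    of_real (Gamma ((real k + real CARD('n)) / 2) / 2) * (\<integral>\<omega>. P \<omega> \<partial>sphere_measure)"
proof -
  note [measurable] = polyfun_measurable[OF P]
  have d: "CARD('n) \<ge> 1" by (simp add: Suc_leI)
  interpret R: sigma_finite_measure "radial_measure CARD('n)"
    by (rule sigma_finite_radial_measure[OF d])
  interpret RS: pair_sigma_finite "radial_measure CARD('n)" "sphere_measure :: (real^'n) measure"
    by unfold_locales
  have int: "integrable (radial_measure CARD('n) \<Otimes>\<^sub>M sphere_measure) (\<lambda>(r, \<omega>). P (r *\<^sub>R \<omega>) * gauss (r *\<^sub>R \<omega>))"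
    using integrable_polyfun_gauss[OF P] by (subst (asm) integrable_polar_iff) auto
  have "(\<integral>y. P y * gauss y \<partial>lborel) =
      (\<integral>r. (\<integral>\<omega>. P (r *\<^sub>R \<omega>) * gauss (r *\<^sub>R \<omega>) \<partial>sphere_measure) \<partial>radial_measure CARD('n))"
    using RS.integral_fst'[OF int] by (subst integral_polar) auto
  also have "\<dots> = (\<integral>r. of_real (exp (- r\<^sup>2) * r ^ k) * (\<integral>\<omega>. P \<omega> \<partial>sphere_measure) \<partial>radial_measure CARD('n))"
  proof (rule Bochner_Integration.integral_cong[OF refl])
    fix r
    have "(\<integral>\<omega>. P (r *\<^sub>R \<omega>) * gauss (r *\<^sub>R \<omega>) \<partial>sphere_measure) =
        (\<integral>\<omega>. of_real (exp (- r\<^sup>2) * r ^ k) * P \<omega> \<partial>sphere_measure)"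
      by (rule Bochner_Integration.integral_cong[OF refl]) (simp add: hom gauss_scaleR norm_sphere_measure)
    then show "(\<integral>\<omega>. P (r *\<^sub>R \<omega>) * gauss (r *\<^sub>R \<omega>) \<partial>sphere_measure) =
        of_real (exp (- r\<^sup>2) * r ^ k) * (\<integral>\<omega>. P \<omega> \<partial>sphere_measure)" by simp
  qed
  also have "\<dots> = of_real (\<integral>r. exp (- r\<^sup>2) * r ^ k \<partial>radial_measure CARD('n)) * (\<integral>\<omega>. P \<omega> \<partial>sphere_measure)"
    by (subst integral_mult_left_zero) (simp only: integral_complex_of_real)
  also have "(\<integral>r. exp (- r\<^sup>2) * r ^ k \<partial>radial_measure CARD('n)) = Gamma ((real k + real CARD('n)) / 2) / 2"
    by (rule integral_radial_gaussian(2)[OF d])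
  finally show ?thesis .
qed

text \<open>The eigenvalue of the integral operator with kernel
  \<open>(\<xi> \<bullet> \<omega>) ^ m\<close> on harmonics of degree \<open>k\<close>: the
  Gaussian moment divided by the radial factor of degree \<open>m + k\<close>.\<close>

definition sphere_moment :: "'n::finite itself \<Rightarrow> nat \<Rightarrow> nat \<Rightarrow> real"
  where "sphere_moment T m k =
    2 * gauss_mass T * harmonic_moment m k / Gamma ((real (m + k) + real CARD('n)) / 2)"

text \<open>The Funk-Hecke formula for a power kernel, obtained by evaluating the Gaussian integral
  of \<open>(y \<bullet> \<omega>) ^ m * P y\<close> both by the moment recursion and in polar
  coordinates.\<close>

lemma sphere_moment_solid_harmonic:
  fixes P :: "real ^ 'n \<Rightarrow> complex" and \<omega> :: "real ^ 'n"
  assumes P: "solid_harmonic k P" and \<omega>: "norm \<omega> = 1"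
  shows "(\<integral>\<xi>. of_real (\<xi> \<bullet> \<omega>) ^ m * P \<xi> \<partial>sphere_measure) = sphere_moment TYPE('n) m k * P \<omega>"
proof -
  note pf = solid_harmonic_polyfun[OF P]
  have "(\<integral>y. (of_real (y \<bullet> \<omega>) ^ m * P y) * gauss y \<partial>lborel) =
    of_real (Gamma ((real (m + k) + real CARD('n)) / 2) / 2) * (\<integral>\<xi>. of_real (\<xi> \<bullet> \<omega>) ^ m * P \<xi> \<partial>sphere_measure)"
  proof (rule integral_homogeneous_gauss)
    show "polyfun (\<lambda>y. of_real (y \<bullet> \<omega>) ^ m * P y)"
      by (intro polyfun_mult polyfun_power polyfun_inner pf)
    show "of_real ((c *\<^sub>R x) \<bullet> \<omega>) ^ m * P (c *\<^sub>R x) = of_real c ^ (m + k) * (of_real (x \<bullet> \<omega>) ^ m * P x)" for c x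
      by (simp add: solid_harmonic_scaleR[OF P] power_mult_distrib power_add)
  qed
  then have "of_real (Gamma ((real (m + k) + real CARD('n)) / 2) / 2) * (\<integral>\<xi>. of_real (\<xi> \<bullet> \<omega>) ^ m * P \<xi> \<partial>sphere_measure)
      = gauss_mass TYPE('n) * harmonic_moment m k * P \<omega>"
    by (simp only: gaussian_moment_solid_harmonic[OF P \<omega>])
  moreover have "Gamma ((real (m + k) + real CARD('n)) / 2) > 0"
    by (intro Gamma_real_pos) (simp add: add_nonneg_pos)
  ultimately show ?thesis
    by (simp add: sphere_moment_def field_simps)
qed

lemma gauss_mass_pos: "gauss_mass TYPE('n::finite) > 0"
proof -
  have "integrable lborel (\<lambda>y::real^'n. complex_of_real (gauss y))"
    using integrable_polyfun_gauss[OF polyfun_const[of 1]] by simp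
  then have "integrable lborel (gauss :: real^'n \<Rightarrow> real)"
    by (simp only: complex_of_real_integrable_eq)
  moreover have "\<not> (AE y in lborel. gauss (y :: real^'n) = 0)"
  proof -
    have "gauss y \<noteq> 0" for y :: "real ^ 'n" using gauss_pos[of y] by simp
    then show ?thesis by (simp add: eventually_False ae_filter_eq_bot_iff)
  qed
  ultimately have "(\<integral>y. gauss (y :: real^'n) \<partial>lborel) \<noteq> 0"
    by (subst integral_nonneg_eq_0_iff_AE) (auto intro!: AE_I2 less_imp_le[OF gauss_pos])
  moreover have "(\<integral>y. gauss (y :: real^'n) \<partial>lborel) \<ge> 0"
    by (intro integral_nonneg_AE AE_I2 less_imp_le[OF gauss_pos])
  ultimately show ?thesis by (simp add: gauss_mass_def)
qed

lemma sphere_moment_eq_0: "m < k \<or> odd (m + k) \<Longrightarrow> sphere_moment T m k = 0"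
  by (simp add: sphere_moment_def harmonic_moment_eq_0)

text \<open>The diagonal eigenvalue is the one that gets divided by, in the orthogonality proof and
  in the leading zonal coefficient.\<close>

lemma sphere_moment_self_pos: "sphere_moment TYPE('n::finite) k k > 0"
proof -
  have "Gamma ((real (k + k) + real CARD('n)) / 2) > 0"
    by (intro Gamma_real_pos) (simp add: add_nonneg_pos)
  then show ?thesis
    using harmonic_moment_closed_form[of k 0] gauss_mass_pos[where 'n='n] by (simp add: sphere_moment_def)
qed

section \<open>The extension of a solid harmonic\<close>

lemma extension_measurable_integrand [measurable]:
  "(\<lambda>\<xi>. exp (- \<i> * complex_of_real (x \<bullet> \<xi>))) \<in> borel_measurable sphere_measure"
  by (intro borel_measurable_sphere_measure borel_measurable_continuous_onI continuous_intros)

text \<open>The tail of the complex series is dominated term by term by the real one. With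
  \<open>s = norm x\<close> the bound is uniform over all \<xi> on the sphere.\<close>

lemma norm_exp_minus_partial_sum_le:
  fixes z :: complex
  assumes "norm z \<le> s"
  shows "norm (exp z - (\<Sum>m<N. z ^ m / fact m)) \<le> exp s - (\<Sum>m<N. s ^ m / fact m)"
proof -
  have z: "summable (\<lambda>m. z ^ m / fact m)" and s: "summable (\<lambda>m. s ^ m / fact m)"
    using summable_exp[of z] summable_exp[of s] by (simp_all add: divide_inverse mult.commute)
  have ez: "exp z = (\<Sum>m. z ^ m / fact m)" and es: "exp s = (\<Sum>m. s ^ m / fact m)"
    by (simp_all add: exp_def scaleR_conv_of_real divide_inverse mult.commute)
  have "norm (exp z - (\<Sum>m<N. z ^ m / fact m)) = norm (\<Sum>m. z ^ (m + N) / fact (m + N))"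
    unfolding ez by (subst suminf_minus_initial_segment[OF z]) simp
  also have "\<dots> \<le> (\<Sum>m. s ^ (m + N) / fact (m + N))"
    using assms s by (intro norm_suminf_le)
      (auto simp: norm_divide norm_power summable_iff_shift[of "\<lambda>m. s ^ m / fact m"] intro!: divide_right_mono power_mono)
  also have "\<dots> = exp s - (\<Sum>m<N. s ^ m / fact m)"
    unfolding es by (subst suminf_minus_initial_segment[OF s]) simp
  finally show ?thesis .
qed

lemma exp_minus_partial_sum_tendsto_0:
  "(\<lambda>N. exp s - (\<Sum>m<N. s ^ m / fact m)) \<longlonglongrightarrow> (0 :: real)"
proof -
  have "(\<lambda>m. s ^ m / fact m) sums exp s"
    using exp_converges[of s] by (simp add: divide_inverse mult.commute)
  then have "(\<lambda>N. exp s - (\<Sum>m<N. s ^ m / fact m)) \<longlonglongrightarrow> exp s - exp s"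
    unfolding sums_def by (intro tendsto_intros)
  then show ?thesis by simp
qed

lemma integrable_inner_power:
  assumes "integrable sphere_measure f"
  shows "integrable sphere_measure (\<lambda>\<xi>. of_real (\<xi> \<bullet> x) ^ m * f \<xi> :: complex)"
proof (rule Bochner_Integration.integrable_bound[OF integrable_mult_right[OF assms, of "of_real (norm x ^ m)"]])
  show "(\<lambda>\<xi>. of_real (\<xi> \<bullet> x) ^ m * f \<xi>) \<in> borel_measurable sphere_measure"
    by (intro borel_measurable_times borel_measurable_integrable[OF assms]
        borel_measurable_sphere_measure[OF polyfun_measurable[OF polyfun_power[OF polyfun_inner]]])
  show "AE \<xi> in sphere_measure. norm (of_real (\<xi> \<bullet> x) ^ m * f \<xi>) \<le> norm (of_real (norm x ^ m) * f \<xi>)"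
  proof (rule AE_I2)
    fix \<xi> :: "real ^ 'a" assume "\<xi> \<in> space sphere_measure"
    then have "\<bar>\<xi> \<bullet> x\<bar> \<le> norm x" using Cauchy_Schwarz_ineq2[of \<xi> x] by (simp add: norm_sphere_measure)
    then show "norm (of_real (\<xi> \<bullet> x) ^ m * f \<xi>) \<le> norm (of_real (norm x ^ m) * f \<xi>)"
      by (auto simp: norm_mult norm_power intro!: mult_right_mono power_mono)
  qed
qed

text \<open>The explicit error term matters: it shows that a function whose first \<open>N\<close>
  moments vanish has a small extension, with a bound depending on its first-power norm only.\<close>

lemma extension_partial_sum:
  fixes f :: "real ^ 'n \<Rightarrow> complex"
  assumes f: "integrable sphere_measure f"
  shows "norm (extension f x - (\<Sum>m<N. (- \<i>) ^ m / fact m * (\<integral>\<xi>. of_real (\<xi> \<bullet> x) ^ m * f \<xi> \<partial>sphere_measure)))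
    \<le> (exp (norm x) - (\<Sum>m<N. norm x ^ m / fact m)) * (\<integral>\<xi>. norm (f \<xi>) \<partial>sphere_measure)"
proof -
  have [measurable]: "f \<in> borel_measurable sphere_measure" using f by auto
  let ?E = "\<lambda>\<xi>. exp (- \<i> * complex_of_real (x \<bullet> \<xi>))"
  let ?S = "\<lambda>\<xi>. \<Sum>m<N. (- \<i> * complex_of_real (x \<bullet> \<xi>)) ^ m / fact m"
  have iE: "integrable sphere_measure (\<lambda>\<xi>. ?E \<xi> * f \<xi>)"
    by (rule Bochner_Integration.integrable_bound[OF f]) (auto simp: norm_mult)
  have Seq: "?S \<xi> * f \<xi> = (\<Sum>m<N. (- \<i>) ^ m / fact m * (of_real (\<xi> \<bullet> x) ^ m * f \<xi>))" for \<xi>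
    by (simp only: sum_distrib_right power_mult_distrib inner_commute[of x] times_divide_eq_left
        times_divide_eq_right mult.assoc)
  have iS: "integrable sphere_measure (\<lambda>\<xi>. ?S \<xi> * f \<xi>)"
    unfolding Seq by (intro Bochner_Integration.integrable_sum integrable_mult_right integrable_inner_power f)
  have "(\<Sum>m<N. (- \<i>) ^ m / fact m * (\<integral>\<xi>. of_real (\<xi> \<bullet> x) ^ m * f \<xi> \<partial>sphere_measure))
      = (\<integral>\<xi>. ?S \<xi> * f \<xi> \<partial>sphere_measure)"
    unfolding Seq by (subst Bochner_Integration.integral_sum)
      (auto intro!: integrable_mult_right integrable_inner_power f simp del: divide_complex_def)
  then have "extension f x - (\<Sum>m<N. (- \<i>) ^ m / fact m * (\<integral>\<xi>. of_real (\<xi> \<bullet> x) ^ m * f \<xi> \<partial>sphere_measure))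
      = (\<integral>\<xi>. (?E \<xi> - ?S \<xi>) * f \<xi> \<partial>sphere_measure)"
    using iE iS by (simp add: extension_def left_diff_distrib)
  also have "norm \<dots> \<le> (\<integral>\<xi>. (exp (norm x) - (\<Sum>m<N. norm x ^ m / fact m)) * norm (f \<xi>) \<partial>sphere_measure)"
  proof (rule Bochner_Integration.integral_norm_bound_integral)
    show "integrable sphere_measure (\<lambda>\<xi>. (?E \<xi> - ?S \<xi>) * f \<xi>)"
      using iE iS by (simp add: left_diff_distrib)
    show "integrable sphere_measure (\<lambda>\<xi>. (exp (norm x) - (\<Sum>m<N. norm x ^ m / fact m)) * norm (f \<xi>))"
      using f by simp
    fix \<xi> :: "real ^ 'n" assume "\<xi> \<in> space sphere_measure"
    then have "norm (- \<i> * complex_of_real (x \<bullet> \<xi>)) \<le> norm x"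
      using Cauchy_Schwarz_ineq2[of x \<xi>] by (simp add: norm_sphere_measure norm_mult)
    from norm_exp_minus_partial_sum_le[OF this]
    show "norm ((?E \<xi> - ?S \<xi>) * f \<xi>) \<le> (exp (norm x) - (\<Sum>m<N. norm x ^ m / fact m)) * norm (f \<xi>)"
      by (simp only: norm_mult mult_right_mono norm_ge_zero)
  qed
  finally show ?thesis by simp
qed

lemma extension_sums:
  fixes f :: "real ^ 'n \<Rightarrow> complex"
  assumes f: "integrable sphere_measure f"
  shows "(\<lambda>m. (- \<i>) ^ m / fact m * (\<integral>\<xi>. of_real (\<xi> \<bullet> x) ^ m * f \<xi> \<partial>sphere_measure)) sums extension f x"
proof -
  let ?s = "\<lambda>N. \<Sum>m<N. (- \<i>) ^ m / fact m * (\<integral>\<xi>. of_real (\<xi> \<bullet> x) ^ m * f \<xi> \<partial>sphere_measure)"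
  have "(\<lambda>N. (exp (norm x) - (\<Sum>m<N. norm x ^ m / fact m)) * (\<integral>\<xi>. norm (f \<xi>) \<partial>sphere_measure)) \<longlonglongrightarrow> 0"
    by (rule tendsto_mult_left_zero[OF exp_minus_partial_sum_tendsto_0])
  then have "(\<lambda>N. extension f x - ?s N) \<longlonglongrightarrow> 0"
    by (rule Lim_null_comparison[rotated]) (intro always_eventually allI extension_partial_sum[OF f])
  from tendsto_diff[OF tendsto_const[of "extension f x"] this] show ?thesis
    by (simp add: sums_def)
qed

text \<open>Up to the factor \<open>2 powr (1 - d / 2)\<close> this is the Bessel profile, but with the correct
  value at \<open>r = 0\<close>.\<close>

definition bessel_series :: "nat \<Rightarrow> nat \<Rightarrow> real \<Rightarrow> real"
  where "bessel_series d k r =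
    (\<Sum>j. (-1) ^ j * rGamma (real j + real k + real d / 2) / fact j * (r / 2) ^ (2 * j + k))"

text \<open>By \<open>rGamma x = x * rGamma (x + 1)\<close> the values decrease along
  \<open>x + j\<close> once \<open>x \<ge> 1\<close>. Applied to \<open>x = k + d / 2\<close>, with
  \<open>d \<ge> 2\<close>, this dominates the Bessel coefficients by those of the exponential
  series.\<close>

lemma rGamma_add_nat_le:
  fixes x :: real
  assumes "x \<ge> 1"
  shows "0 \<le> rGamma (real j + x)" "rGamma (real j + x) \<le> rGamma x"
proof -
  have pos: "rGamma (real i + x) > 0" for i
    using assms by (simp add: rGamma_inverse_Gamma Gamma_real_pos)
  show "0 \<le> rGamma (real j + x)" using pos by (rule less_imp_le)
  show "rGamma (real j + x) \<le> rGamma x"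
  proof (induction j)
    case (Suc j)
    have "rGamma (real (Suc j) + x) = 1 * rGamma (real j + x + 1)" by (simp add: add_ac)
    also have "\<dots> \<le> (real j + x) * rGamma (real j + x + 1)"
      using pos[of "Suc j"] assms by (intro mult_right_mono) (auto simp: add_ac)
    also have "\<dots> = rGamma (real j + x)" by (rule rGamma_plus1)
    finally show ?case using Suc by simp
  qed simp
qed

lemma summable_bessel_powser:
  assumes "d \<ge> 2"
  shows "summable (\<lambda>j. ((-1) ^ j * rGamma (real j + real k + real d / 2) / fact j) * (z::real) ^ j)"
proof (rule summable_comparison_test[OF exI[of _ 0]])
  let ?x = "real k + real d / 2"
  have x: "?x \<ge> 1" using assms by simp
  have "summable (\<lambda>j. rGamma ?x * (\<bar>z\<bar> ^ j / fact j))"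
    using summable_exp[of "\<bar>z\<bar>"] by (intro summable_mult) (simp add: divide_inverse mult.commute)
  then show "summable (\<lambda>j. rGamma ?x * (\<bar>z\<bar> ^ j / fact j))" .
  show "\<forall>j\<ge>0. norm (((-1) ^ j * rGamma (real j + real k + real d / 2) / fact j) * z ^ j)
      \<le> rGamma ?x * (\<bar>z\<bar> ^ j / fact j)"
  proof (intro allI impI)
    fix j :: nat
    have "norm (((-1) ^ j * rGamma (real j + real k + real d / 2) / fact j) * z ^ j)
        = \<bar>rGamma (real j + ?x)\<bar> * (\<bar>z\<bar> ^ j / fact j)"
      by (simp add: abs_mult power_abs add.assoc)
    also have "\<dots> \<le> rGamma ?x * (\<bar>z\<bar> ^ j / fact j)"
      using rGamma_add_nat_le[OF x, of j] by (intro mult_right_mono) auto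
    finally show "norm (((-1) ^ j * rGamma (real j + real k + real d / 2) / fact j) * z ^ j)
      \<le> rGamma ?x * (\<bar>z\<bar> ^ j / fact j)" .
  qed
qed

lemma power_double_add: "x ^ (2 * j + k) = x ^ k * (x\<^sup>2) ^ j" for x :: "'a :: comm_monoid_mult"
  unfolding power_add power_mult by (rule mult.commute)

lemma bessel_series_eq:
  assumes "d \<ge> 2"
  shows "bessel_series d k r = (r / 2) ^ k *
    (\<Sum>j. ((-1) ^ j * rGamma (real j + real k + real d / 2) / fact j) * ((r / 2)\<^sup>2) ^ j)"
  unfolding bessel_series_def
  by (subst suminf_mult[OF summable_bessel_powser[OF assms], symmetric])
     (simp only: power_double_add, simp only: mult_ac)

lemma summable_bessel_series:
  assumes "d \<ge> 2"
  shows "summable (\<lambda>j. (-1) ^ j * rGamma (real j + real k + real d / 2) / fact j * (r / 2) ^ (2 * j + k))"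
  using summable_mult[OF summable_bessel_powser[OF assms, of k "(r / 2)\<^sup>2"], of "(r / 2) ^ k"]
  by (simp only: power_double_add, simp only: mult_ac)

lemma bessel_series_continuous:
  assumes "d \<ge> 2"
  shows "continuous_on UNIV (bessel_series d k)"
proof -
  let ?g = "\<lambda>z::real. \<Sum>j. ((-1) ^ j * rGamma (real j + real k + real d / 2) / fact j) * z ^ j"
  have g: "continuous_on UNIV ?g"
    by (intro continuous_at_imp_continuous_on ballI isCont_powser_converges_everywhere
        summable_bessel_powser[OF assms])
  have "continuous_on UNIV (\<lambda>r. (r / 2) ^ k * ?g ((r / 2)\<^sup>2))"
    by (intro continuous_intros continuous_on_compose2[OF g]) auto
  moreover have "bessel_series d k = (\<lambda>r. (r / 2) ^ k * ?g ((r / 2)\<^sup>2))"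
    by (rule ext) (rule bessel_series_eq[OF assms])
  ultimately show ?thesis by simp
qed

text \<open>The Bessel series contains the common factor \<open>(r / 2) powr (d / 2 - 1)\<close>;
  the power of \<open>r\<close> in the profile cancels it except for the power of 2.\<close>

lemma bessel_profile_eq_series:
  assumes d: "d \<ge> 2" and r: "r > 0"
  shows "bessel_profile d k r = 2 powr (1 - real d / 2) * bessel_series d k r"
proof -
  have "(-1) ^ m * rGamma (real m + (real d / 2 - 1 + real k) + 1) / fact m * (r / 2) powr (2 * real m + (real d / 2 - 1 + real k))
      = (r / 2) powr (real d / 2 - 1) * ((-1) ^ m * rGamma (real m + real k + real d / 2) / fact m * (r / 2) ^ (2 * m + k))" for m
  proof -
    have "(r / 2) powr (2 * real m + (real d / 2 - 1 + real k)) = (r / 2) powr (real (2 * m + k) + (real d / 2 - 1))"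
      by (simp add: algebra_simps)
    also have "\<dots> = (r / 2) ^ (2 * m + k) * (r / 2) powr (real d / 2 - 1)"
      using r by (simp only: powr_add powr_realpow half_gt_zero)
    finally show ?thesis by (simp add: algebra_simps)
  qed
  then have "bessel_J (real d / 2 - 1 + real k) r = (r / 2) powr (real d / 2 - 1) * bessel_series d k r"
    unfolding bessel_J_def bessel_series_def
    by (simp only: suminf_mult[OF summable_bessel_series[OF d]])
  moreover have "(r / 2) powr (real d / 2 - 1) * r powr (- (real d / 2) + 1) = 2 powr (1 - real d / 2)"
  proof -
    define a where "a = real d / 2 - 1"
    have "(r / 2) powr a * r powr - a = 2 powr - a"
      using r by (simp add: powr_divide powr_minus field_simps)
    then show ?thesis by (simp add: a_def)
  qed
  ultimately show ?thesis by (simp add: bessel_profile_def mult_ac)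
qed

lemma bessel_profile0_eq_series:
  assumes d: "d \<ge> 2" and r: "r \<ge> 0"
  shows "bessel_profile0 d k r = 2 powr (1 - real d / 2) * bessel_series d k r"
proof (cases "r = 0")
  case True
  have "((\<lambda>r. 2 powr (1 - real d / 2) * bessel_series d k r) \<longlongrightarrow> 2 powr (1 - real d / 2) * bessel_series d k 0) (at_right 0)"
    using bessel_series_continuous[OF d, of k] unfolding continuous_on_def
    by (intro tendsto_intros) (auto intro: tendsto_within_subset)
  then have "(bessel_profile d k \<longlongrightarrow> 2 powr (1 - real d / 2) * bessel_series d k 0) (at_right 0)"
    by (rule Lim_transform_eventually) (auto simp: eventually_at_filter bessel_profile_eq_series[OF d])
  with True show ?thesis by (simp add: bessel_profile0_def tendsto_Lim)
qed (use assms in \<open>simp add: bessel_profile0_def bessel_profile_eq_series\<close>)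

text \<open>Only the terms \<open>m = k + 2 * j\<close> of the exponential series survive. Their
  factor \<open>fact m\<close> in the moment cancels that of the exponential, the phase becomes
  \<open>(- \<i>) ^ k * (-1) ^ j\<close>, and the remaining factorial, Gamma value and power of 2
  are those of the Bessel series.\<close>

lemma extension_solid_harmonic_series:
  fixes P :: "real ^ 'n \<Rightarrow> complex" and \<omega> :: "real ^ 'n"
  assumes d: "CARD('n) \<ge> 2" and P: "solid_harmonic k P" and \<omega>: "norm \<omega> = 1"
  shows "extension P (r *\<^sub>R \<omega>) = (- \<i>) ^ k * of_real (2 * gauss_mass TYPE('n) * bessel_series CARD('n) k r) * P \<omega>"
proof -
  let ?t = "\<lambda>m. (- \<i>) ^ m / fact m * (\<integral>\<xi>. of_real (\<xi> \<bullet> (r *\<^sub>R \<omega>)) ^ m * P \<xi> \<partial>sphere_measure)"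
  have t: "?t m = (- \<i>) ^ m / fact m * of_real (r ^ m * sphere_moment TYPE('n) m k) * P \<omega>" for m
  proof -
    have "(\<integral>\<xi>. of_real (\<xi> \<bullet> (r *\<^sub>R \<omega>)) ^ m * P \<xi> \<partial>sphere_measure) =
        (\<integral>\<xi>. of_real r ^ m * (of_real (\<xi> \<bullet> \<omega>) ^ m * P \<xi>) \<partial>sphere_measure)"
      by (simp add: power_mult_distrib mult.assoc)
    then show ?thesis by (simp add: sphere_moment_solid_harmonic[OF P \<omega>])
  qed
  have "(\<lambda>j. ?t (k + 2 * j)) sums extension P (r *\<^sub>R \<omega>)"
  proof (subst sums_mono_reindex)
    show "strict_mono (\<lambda>j. k + 2 * j)" by (auto intro!: strict_monoI)
    fix m assume "m \<notin> range (\<lambda>j. k + 2 * j)"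
    moreover have "m \<in> range (\<lambda>j. k + 2 * j)" if "k \<le> m" "even (m + k)"
      using that by (intro image_eqI[of _ _ "(m - k) div 2"]) auto
    ultimately have "m < k \<or> odd (m + k)" by (cases "k \<le> m") auto
    then show "?t m = 0" unfolding t by (simp add: sphere_moment_eq_0)
  next
    show "?t sums extension P (r *\<^sub>R \<omega>)"
      by (rule extension_sums[OF polyfun_integrable_sphere[OF solid_harmonic_polyfun[OF P]]])
  qed
  moreover have "?t (k + 2 * j) = (- \<i>) ^ k * of_real (2 * gauss_mass TYPE('n)) * P \<omega> *
      of_real ((-1) ^ j * rGamma (real j + real k + real CARD('n) / 2) / fact j * (r / 2) ^ (2 * j + k))" for j
  proof -
    have "(real (k + 2 * j + k) + real CARD('n)) / 2 = real j + real k + real CARD('n) / 2"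
      by (simp add: field_simps)
    then have g: "Gamma ((real (k + 2 * j + k) + real CARD('n)) / 2) = Gamma (real j + real k + real CARD('n) / 2)"
      by (rule arg_cong)
    have pw: "(r / 2) ^ (2 * j + k) = r ^ (k + 2 * j) / 2 ^ (k + 2 * j)"
      by (simp add: power_divide add.commute)
    have 1: "r ^ (k + 2 * j) * sphere_moment TYPE('n) (k + 2 * j) k =
        fact (k + 2 * j) * (2 * gauss_mass TYPE('n) * rGamma (real j + real k + real CARD('n) / 2) / fact j * (r / 2) ^ (2 * j + k))"
    proof -
      have "R * (2 * M * (F / (p * f)) / G) = F * (2 * M * inverse G / f * (R / p))" for R M F p f G :: real
        by (simp add: divide_inverse mult_ac)
      then show ?thesis
        unfolding sphere_moment_def harmonic_moment_closed_form rGamma_inverse_Gamma g pw .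
    qed
    have 2: "(- \<i>) ^ (k + 2 * j) = (- \<i>) ^ k * of_real ((-1) ^ j)"
      by (simp add: power_add power_mult)
    have "A * of_real s / fact n * of_real (fact n * (M * R / J * W)) * z = A * of_real M * z * of_real (s * R / J * W)"
      for A z :: complex and s M R J W :: real and n
      by simp
    then show ?thesis unfolding t unfolding 1 2 .
  qed
  moreover have "(\<lambda>j. (- \<i>) ^ k * of_real (2 * gauss_mass TYPE('n)) * P \<omega> *
      of_real ((-1) ^ j * rGamma (real j + real k + real CARD('n) / 2) / fact j * (r / 2) ^ (2 * j + k)))
    sums ((- \<i>) ^ k * of_real (2 * gauss_mass TYPE('n)) * P \<omega> * of_real (bessel_series CARD('n) k r))"
    unfolding bessel_series_def by (intro sums_mult sums_of_real summable_sums summable_bessel_series[OF d])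
  ultimately have "extension P (r *\<^sub>R \<omega>) = (- \<i>) ^ k * of_real (2 * gauss_mass TYPE('n)) * P \<omega> * of_real (bessel_series CARD('n) k r)"
    by (metis (no_types, lifting) sums_cong sums_unique2)
  then show ?thesis by (simp add: mult_ac)
qed

section \<open>Projections onto the spherical harmonics\<close>

lemma integrable_sphere_pair_kernel:
  fixes f h :: "real ^ 'n \<Rightarrow> complex"
  assumes f: "integrable sphere_measure f" and h: "integrable sphere_measure h"
  shows "integrable (sphere_measure \<Otimes>\<^sub>M sphere_measure) (\<lambda>(\<xi>, \<omega>). of_real (\<xi> \<bullet> \<omega>) ^ m * f \<xi> * h \<omega>)"
proof (rule Bochner_Integration.integrable_bound)
  have [measurable]: "f \<in> borel_measurable sphere_measure" "h \<in> borel_measurable sphere_measure"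
    using f h by auto
  show "integrable (sphere_measure \<Otimes>\<^sub>M sphere_measure) (\<lambda>(\<xi>, \<omega>). f \<xi> * h \<omega>)"
    using f h by (intro sphere_pair.Fubini_integrable) (auto simp: norm_mult)
  have "(\<lambda>x. x) \<in> sphere_measure \<rightarrow>\<^sub>M (borel :: (real^'n) measure)" by (rule measurable_sphere_measure_id)
  then show "(\<lambda>(\<xi>, \<omega>). of_real (\<xi> \<bullet> \<omega>) ^ m * f \<xi> * h \<omega>) \<in> borel_measurable (sphere_measure \<Otimes>\<^sub>M sphere_measure)"
    by measurable
  show "AE z in (sphere_measure :: (real^'n) measure) \<Otimes>\<^sub>M (sphere_measure :: (real^'n) measure).
      norm (case z of (\<xi>, \<omega>) \<Rightarrow> of_real (\<xi> \<bullet> \<omega>) ^ m * f \<xi> * h \<omega>) \<le> norm (case z of (\<xi>, \<omega>) \<Rightarrow> f \<xi> * h \<omega>)"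
  proof (rule AE_I2)
    fix z assume "z \<in> space ((sphere_measure :: (real^'n) measure) \<Otimes>\<^sub>M (sphere_measure :: (real^'n) measure))"
    then obtain \<xi> \<omega> :: "real^'n" where z: "z = (\<xi>, \<omega>)" "norm \<xi> = 1" "norm \<omega> = 1"
      by (auto simp: space_pair_measure norm_sphere_measure)
    then have "\<bar>\<xi> \<bullet> \<omega>\<bar> \<le> 1" using Cauchy_Schwarz_ineq2[of \<xi> \<omega>] by simp
    then have "\<bar>\<xi> \<bullet> \<omega>\<bar> ^ m \<le> 1" by (simp add: power_le_one)
    then show "norm (case z of (\<xi>, \<omega>) \<Rightarrow> of_real (\<xi> \<bullet> \<omega>) ^ m * f \<xi> * h \<omega>) \<le> norm (case z of (\<xi>, \<omega>) \<Rightarrow> f \<xi> * h \<omega>)"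
      using z by (simp add: norm_mult norm_power mult.assoc mult_left_le_one_le)
  qed
qed

definition moment :: "nat \<Rightarrow> (real ^ 'n \<Rightarrow> complex) \<Rightarrow> real ^ 'n \<Rightarrow> complex"
  where "moment n f x = (\<integral>\<xi>. of_real (\<xi> \<bullet> x) ^ n * f \<xi> \<partial>sphere_measure)"

text \<open>Fubini and the symmetry of the kernel; the pairing is bilinear, without
  conjugation.\<close>

lemma moment_selfadjoint:
  fixes f h :: "real ^ 'n \<Rightarrow> complex"
  assumes f: "integrable sphere_measure f" and h: "integrable sphere_measure h"
  shows "(\<integral>\<omega>. moment m f \<omega> * h \<omega> \<partial>sphere_measure) = (\<integral>\<xi>. f \<xi> * moment m h \<xi> \<partial>sphere_measure)"
proof -
  have "(\<integral>\<omega>. moment m f \<omega> * h \<omega> \<partial>sphere_measure) =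
      (\<integral>\<omega>. (\<integral>\<xi>. of_real (\<xi> \<bullet> \<omega>) ^ m * f \<xi> * h \<omega> \<partial>sphere_measure) \<partial>sphere_measure)"
    by (simp add: moment_def)
  also have "\<dots> = (\<integral>\<xi>. (\<integral>\<omega>. of_real (\<xi> \<bullet> \<omega>) ^ m * f \<xi> * h \<omega> \<partial>sphere_measure) \<partial>sphere_measure)"
    by (rule sphere_pair.Fubini_integral[OF integrable_sphere_pair_kernel[OF f h]])
  also have "\<dots> = (\<integral>\<xi>. f \<xi> * moment m h \<xi> \<partial>sphere_measure)"
    unfolding moment_def by (simp add: inner_commute mult.assoc mult.left_commute flip: integral_mult_right_zero)
  finally show ?thesis .
qed

text \<open>The selfadjoint operator \<open>moment k\<close> multiplies \<open>P\<close> by a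
  nonzero scalar and annihilates \<open>Q\<close>, because \<open>k < l\<close>.\<close>

lemma solid_harmonics_orthogonal_aux:
  fixes P Q :: "real ^ 'n \<Rightarrow> complex"
  assumes P: "solid_harmonic k P" and Q: "solid_harmonic l Q" and "k < l"
  shows "(\<integral>\<omega>. P \<omega> * Q \<omega> \<partial>sphere_measure) = 0"
proof -
  note int = polyfun_integrable_sphere[OF solid_harmonic_polyfun]
  have mom: "moment m R \<omega> = sphere_moment TYPE('n) m i * R \<omega>"
    if "solid_harmonic i R" "\<omega> \<in> space sphere_measure" for m i and R :: "real ^ 'n \<Rightarrow> complex" and \<omega>
    unfolding moment_def using that by (intro sphere_moment_solid_harmonic) (auto simp: norm_sphere_measure)
  have "sphere_moment TYPE('n) k k * (\<integral>\<omega>. P \<omega> * Q \<omega> \<partial>sphere_measure) = (\<integral>\<omega>. moment k P \<omega> * Q \<omega> \<partial>sphere_measure)"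
    by (simp add: mom[OF P] mult.assoc cong: Bochner_Integration.integral_cong)
  also have "\<dots> = (\<integral>\<omega>. P \<omega> * moment k Q \<omega> \<partial>sphere_measure)"
    by (rule moment_selfadjoint[OF int[OF P] int[OF Q]])
  also have "\<dots> = 0"
    using sphere_moment_eq_0[of k l "TYPE('n)"] \<open>k < l\<close>
    by (simp add: mom[OF Q] cong: Bochner_Integration.integral_cong)
  finally show ?thesis using sphere_moment_self_pos[of k, where 'n='n] by simp
qed

lemma solid_harmonics_orthogonal:
  fixes P Q :: "real ^ 'n \<Rightarrow> complex"
  assumes P: "solid_harmonic k P" and Q: "solid_harmonic l Q" and "k \<noteq> l"
  shows "(\<integral>\<omega>. P \<omega> * Q \<omega> \<partial>sphere_measure) = 0"
proof (cases "k < l")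
  case False
  then have "(\<integral>\<omega>. Q \<omega> * P \<omega> \<partial>sphere_measure) = 0"
    using \<open>k \<noteq> l\<close> by (intro solid_harmonics_orthogonal_aux[OF Q P]) auto
  then show ?thesis by (simp add: mult.commute)
qed (rule solid_harmonics_orthogonal_aux[OF P Q])

lemma integral_norm_sum_solid_harmonics:
  fixes P :: "nat \<Rightarrow> real ^ 'n \<Rightarrow> complex"
  assumes P: "\<And>k. solid_harmonic k (P k)"
  shows "(\<integral>\<omega>. (norm (\<Sum>k<N. c k * P k \<omega>))\<^sup>2 \<partial>sphere_measure) =
    (\<Sum>k<N. (norm (c k))\<^sup>2 * (\<integral>\<omega>. (norm (P k \<omega>))\<^sup>2 \<partial>sphere_measure))"
proof -
  have pf: "polyfun (P k)" "polyfun (\<lambda>x. cnj (P k x))" for k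
    using P by (auto intro: solid_harmonic_polyfun polyfun_cnj)
  have "complex_of_real (\<integral>\<omega>. (norm (\<Sum>k<N. c k * P k \<omega>))\<^sup>2 \<partial>sphere_measure) =
      (\<integral>\<omega>. (\<Sum>k<N. c k * P k \<omega>) * cnj (\<Sum>k<N. c k * P k \<omega>) \<partial>sphere_measure)"
    by (simp only: complex_norm_square[symmetric] integral_complex_of_real)
  also have "\<dots> = (\<integral>\<omega>. (\<Sum>k<N. \<Sum>l<N. c k * cnj (c l) * (P k \<omega> * cnj (P l \<omega>))) \<partial>sphere_measure)"
    by (simp add: sum_product mult_ac)
  also have "\<dots> = (\<Sum>k<N. \<Sum>l<N. c k * cnj (c l) * (\<integral>\<omega>. P k \<omega> * cnj (P l \<omega>) \<partial>sphere_measure))"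
    by (simp add: Bochner_Integration.integral_sum polyfun_integrable_sphere polyfun_mult pf
        Bochner_Integration.integrable_sum)
  also have "\<dots> = (\<Sum>k<N. \<Sum>l<N. if l = k then c k * cnj (c k) * (\<integral>\<omega>. P k \<omega> * cnj (P k \<omega>) \<partial>sphere_measure) else 0)"
    using solid_harmonics_orthogonal[OF P solid_harmonic_cnj[OF P]] by (intro sum.cong) auto
  also have "\<dots> = (\<Sum>k<N. c k * cnj (c k) * (\<integral>\<omega>. P k \<omega> * cnj (P k \<omega>) \<partial>sphere_measure))"
    by simp
  also have "\<dots> = complex_of_real (\<Sum>k<N. (norm (c k))\<^sup>2 * (\<integral>\<omega>. (norm (P k \<omega>))\<^sup>2 \<partial>sphere_measure))"
    by (simp only: complex_norm_square integral_complex_of_real[symmetric] of_real_sum of_real_mult)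
  finally show ?thesis by (simp only: of_real_eq_iff)
qed

section \<open>Moments as polynomials and their Laplacians\<close>

lemma integrable_inner_mult:
  "integrable sphere_measure f \<Longrightarrow> integrable sphere_measure (\<lambda>\<xi>. of_real (\<xi> \<bullet> x) * f \<xi> :: complex)"
  using integrable_inner_power[of f x 1] by simp

lemma integrable_component_mult:
  "integrable sphere_measure f \<Longrightarrow> integrable sphere_measure (\<lambda>\<xi>. of_real (\<xi> $ i) * f \<xi> :: complex)"
  using integrable_inner_mult[of f "axis i 1"] by (simp add: inner_axis)

lemma moment_0: "moment 0 f x = (\<integral>\<xi>. f \<xi> \<partial>sphere_measure)"
  by (simp add: moment_def)

lemma moment_sum:
  assumes "\<And>i. i \<in> I \<Longrightarrow> integrable sphere_measure (f i)"
  shows "moment n (\<lambda>\<xi>. \<Sum>i\<in>I. c i * f i \<xi>) x = (\<Sum>i\<in>I. c i * moment n (f i) x)"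
proof -
  have "moment n (\<lambda>\<xi>. \<Sum>i\<in>I. c i * f i \<xi>) x =
      (\<integral>\<xi>. (\<Sum>i\<in>I. c i * (of_real (\<xi> \<bullet> x) ^ n * f i \<xi>)) \<partial>sphere_measure)"
    unfolding moment_def by (simp add: sum_distrib_left mult.left_commute)
  also have "\<dots> = (\<Sum>i\<in>I. c i * moment n (f i) x)"
    unfolding moment_def
    by (subst Bochner_Integration.integral_sum) (auto intro!: integrable_mult_right integrable_inner_power assms)
  finally show ?thesis .
qed

lemma moment_inner_mult:
  assumes f: "integrable sphere_measure f"
  shows "moment n (\<lambda>\<xi>. of_real (\<xi> \<bullet> v) * f \<xi>) x =
    (\<Sum>i\<in>UNIV. of_real (v $ i) * moment n (\<lambda>\<xi>. of_real (\<xi> $ i) * f \<xi>) x)"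
proof -
  have "(\<lambda>\<xi>. of_real (\<xi> \<bullet> v) * f \<xi>) = (\<lambda>\<xi>. \<Sum>i\<in>UNIV. of_real (v $ i) * (of_real (\<xi> $ i) * f \<xi>))"
    by (intro ext) (simp add: inner_vec_def sum_distrib_right sum_distrib_left mult_ac)
  then show ?thesis
    by (simp only: moment_sum[OF integrable_component_mult[OF f]])
qed

text \<open>Splitting one factor \<open>\<xi> \<bullet> x\<close> into coordinates takes the
  dependence on \<open>x\<close> out of the integral. Induction on \<open>n\<close> then shows that
  moments are polynomials and differentiates them without exchanging derivative and
  integral.\<close>

lemma moment_Suc:
  assumes "integrable sphere_measure f"
  shows "moment (Suc n) f x = (\<Sum>i\<in>UNIV. of_real (x $ i) * moment n (\<lambda>\<xi>. of_real (\<xi> $ i) * f \<xi>) x)"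
  unfolding moment_inner_mult[OF assms, symmetric] by (simp add: moment_def mult_ac)

lemma polyfun_moment:
  "integrable sphere_measure f \<Longrightarrow> polyfun (moment n f)"
proof (induction n arbitrary: f)
  case 0
  have "moment 0 f = (\<lambda>_. \<integral>\<xi>. f \<xi> \<partial>sphere_measure)" by (intro ext moment_0)
  then show ?case by (simp add: polyfun_const)
next
  case (Suc n)
  have "moment (Suc n) f = (\<lambda>x. \<Sum>i\<in>UNIV. of_real (x $ i) * moment n (\<lambda>\<xi>. of_real (\<xi> $ i) * f \<xi>) x)"
    by (intro ext moment_Suc Suc.prems)
  then show ?case
    by (simp only:) (intro polyfun_sum polyfun_coord Suc.IH integrable_component_mult Suc.prems)
qed

lemma dirderiv_moment:
  "integrable sphere_measure f \<Longrightarrow>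
    dirderiv v (moment n f) x = of_nat n * moment (n - 1) (\<lambda>\<xi>. of_real (\<xi> \<bullet> v) * f \<xi>) x"
proof (induction n arbitrary: f)
  case 0
  have "moment 0 f = (\<lambda>_. \<integral>\<xi>. f \<xi> \<partial>sphere_measure)" by (intro ext moment_0)
  then show ?case by simp
next
  case (Suc n)
  note f = Suc.prems
  let ?fv = "\<lambda>\<xi>. of_real (\<xi> \<bullet> v) * f \<xi>"
  have fv: "integrable sphere_measure ?fv" by (rule integrable_inner_mult[OF f])
  have "moment (Suc n) f = (\<lambda>x. \<Sum>i\<in>UNIV. of_real (x $ i) * moment n (\<lambda>\<xi>. of_real (\<xi> $ i) * f \<xi>) x)"
    by (intro ext moment_Suc f)
  then have "dirderiv v (moment (Suc n) f) x =
      (\<Sum>i\<in>UNIV. of_real (x $ i) * (of_nat n * moment (n - 1) (\<lambda>\<xi>. of_real (\<xi> \<bullet> v) * (of_real (\<xi> $ i) * f \<xi>)) x)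
        + of_real (v $ i) * moment n (\<lambda>\<xi>. of_real (\<xi> $ i) * f \<xi>) x)"
    by (simp add: dirderiv_sum dirderiv_coord polyfun_coord polyfun_moment integrable_component_mult f Suc.IH)
  also have "\<dots> = of_nat n * (\<Sum>i\<in>UNIV. of_real (x $ i) * moment (n - 1) (\<lambda>\<xi>. of_real (\<xi> $ i) * ?fv \<xi>) x)
      + moment n ?fv x"
    unfolding moment_inner_mult[OF f] by (simp add: sum.distrib sum_distrib_left mult_ac)
  also have "\<dots> = of_nat (Suc n) * moment n ?fv x"
    using moment_Suc[OF fv, of "n - 1" x] by (cases n) (simp_all add: distrib_right)
  finally show ?case by simp
qed

lemma moment_scaleR: "moment n f (c *\<^sub>R x) = of_real c ^ n * moment n f x"
proof -
  have "moment n f (c *\<^sub>R x) = (\<integral>\<xi>. of_real c ^ n * (of_real (\<xi> \<bullet> x) ^ n * f \<xi>) \<partial>sphere_measure)"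
    unfolding moment_def by (simp add: power_mult_distrib mult.assoc)
  then show ?thesis by (simp add: moment_def)
qed

text \<open>Differentiating twice along each axis inserts the squares of the coordinates of \<xi>,
  which add up to 1 on the sphere.\<close>

lemma laplacian_moment:
  assumes f: "integrable sphere_measure f"
  shows "laplacian (moment n f) x = of_nat (n * (n - 1)) * moment (n - 2) f x"
proof -
  have D: "dirderiv v (moment n f) = (\<lambda>x. of_nat n * moment (n - 1) (\<lambda>\<xi>. of_real (\<xi> \<bullet> v) * f \<xi>) x)" for v
    by (intro ext dirderiv_moment f)
  have "laplacian (moment n f) x =
      (\<Sum>i\<in>UNIV. of_nat n * (of_nat (n - 1) * moment (n - 1 - 1) (\<lambda>\<xi>. of_real (\<xi> $ i) * (of_real (\<xi> $ i) * f \<xi>)) x))"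
    unfolding laplacian_eq D
    by (intro sum.cong refl)
       (simp add: dirderiv_cmult dirderiv_moment polyfun_moment integrable_component_mult f inner_axis)
  also have "\<dots> = of_nat (n * (n - 1)) *
      moment (n - 2) (\<lambda>\<xi>. \<Sum>i\<in>UNIV. 1 * (of_real (\<xi> $ i) * (of_real (\<xi> $ i) * f \<xi>))) x"
    by (subst moment_sum) (auto intro!: integrable_component_mult f simp: sum_distrib_left mult.assoc numeral_2_eq_2)
  also have "moment (n - 2) (\<lambda>\<xi>. \<Sum>i\<in>UNIV. 1 * (of_real (\<xi> $ i) * (of_real (\<xi> $ i) * f \<xi>))) x = moment (n - 2) f x"
    unfolding moment_def
  proof (rule Bochner_Integration.integral_cong[OF refl])
    fix \<xi> :: "real ^ 'a" assume "\<xi> \<in> space sphere_measure"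
    then have "\<xi> \<bullet> \<xi> = 1" by (simp add: norm_sphere_measure norm_eq_1[symmetric])
    then have "(\<Sum>i\<in>UNIV. 1 * (of_real (\<xi> $ i) * (of_real (\<xi> $ i) * f \<xi>))) = f \<xi>"
      by (simp add: inner_vec_def mult.assoc[symmetric] flip: sum_distrib_right of_real_mult of_real_sum)
    then show "of_real (\<xi> \<bullet> x) ^ (n - 2) * (\<Sum>i\<in>UNIV. 1 * (of_real (\<xi> $ i) * (of_real (\<xi> $ i) * f \<xi>))) =
        of_real (\<xi> \<bullet> x) ^ (n - 2) * f \<xi>" by simp
  qed
  finally show ?thesis .
qed

lemma laplacian_mult:
  assumes P: "polyfun P" and Q: "polyfun Q"
  shows "laplacian (\<lambda>x. P x * Q x) x = P x * laplacian Q x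
    + 2 * (\<Sum>i\<in>UNIV. partial_deriv i P x * partial_deriv i Q x) + laplacian P x * Q x"
proof -
  have D: "dirderiv v (\<lambda>x. P x * Q x) = (\<lambda>x. P x * dirderiv v Q x + dirderiv v P x * Q x)" for v
    by (intro ext dirderiv_mult P Q)
  have "dirderiv v (dirderiv v (\<lambda>x. P x * Q x)) x =
      P x * dirderiv v (dirderiv v Q) x + 2 * (dirderiv v P x * dirderiv v Q x) + dirderiv v (dirderiv v P) x * Q x" for v
    unfolding D by (simp add: dirderiv_add dirderiv_mult polyfun_mult polyfun_dirderiv P Q)
  then show ?thesis
    by (simp add: laplacian_eq partial_deriv_eq sum.distrib sum_distrib_left sum_distrib_right mult_ac)
qed

text \<open>The Laplacian of \<open>x \<bullet> x\<close> is \<open>2 * d\<close>, and the mixed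
  gradient term is 4 times the derivative of \<open>R\<close> along \<open>x\<close>, that is
  \<open>4 * n * R x\<close> by Euler's identity.\<close>

lemma laplacian_inner_self_mult:
  fixes R :: "real ^ 'n \<Rightarrow> complex"
  assumes R: "polyfun R" and hom: "\<And>c x. R (c *\<^sub>R x) = of_real c ^ n * R x"
  shows "laplacian (\<lambda>x. of_real (x \<bullet> x) * R x) x =
    of_nat (2 * CARD('n) + 4 * n) * R x + of_real (x \<bullet> x) * laplacian R x"
proof -
  let ?q = "\<lambda>x :: real ^ 'n. complex_of_real (x \<bullet> x)"
  have D: "dirderiv v ?q = (\<lambda>x. of_real (2 * (x \<bullet> v)))" for v
    by (intro ext dirderiv_inner_self)
  have "dirderiv v (\<lambda>x. of_real (2 * (x \<bullet> v))) x = of_real (2 * (v \<bullet> v))" for v x :: "real ^ 'n"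
    using dirderiv_inner[of v "2 *\<^sub>R v" x] by (simp only: inner_scaleR_right)
  then have lap: "laplacian ?q x = of_nat (2 * CARD('n))"
    unfolding laplacian_eq D by (simp add: inner_axis_axis)
  have grad: "(\<Sum>i\<in>UNIV. partial_deriv i ?q x * partial_deriv i R x) = 2 * (of_nat n * R x)"
    using dirderiv_self_homogeneous[OF hom, of x] unfolding dirderiv_eq_sum[OF R]
    by (simp add: partial_deriv_eq D inner_axis mult.assoc flip: sum_distrib_left)
  show ?thesis
    unfolding laplacian_mult[OF polyfun_inner_self R] lap grad by (simp add: algebra_simps)
qed

text \<open>Each factor \<open>x \<bullet> x\<close> raises the degree by 2, so the formula for one
  factor applies in degree \<open>2 * j + n\<close> and its increments sum to a quadratic in
  \<open>j\<close>. The coefficient uses real subtraction, the exponent \<open>j - 1\<close> is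
  truncated; at \<open>j = 0\<close> the coefficient is 0.\<close>

lemma laplacian_inner_self_power_mult:
  fixes R :: "real ^ 'n \<Rightarrow> complex"
  assumes R: "polyfun R" and hom: "\<And>c x. R (c *\<^sub>R x) = of_real c ^ n * R x"
  shows "laplacian (\<lambda>x. of_real (x \<bullet> x) ^ j * R x) x =
    of_real (2 * real j * (2 * (real j - 1) + real CARD('n) + 2 * real n)) * of_real (x \<bullet> x) ^ (j - 1) * R x
      + of_real (x \<bullet> x) ^ j * laplacian R x"
proof (induction j)
  case (Suc j)
  let ?q = "complex_of_real (x \<bullet> x)"
  let ?S = "\<lambda>x. of_real (x \<bullet> x) ^ j * R x"
  have S: "polyfun ?S" by (intro polyfun_mult polyfun_power polyfun_inner_self R)
  have homS: "?S (c *\<^sub>R x) = of_real c ^ (2 * j + n) * ?S x" for c x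
    by (simp add: hom power_add power_mult_distrib power_mult power2_eq_square mult_ac)
  have "laplacian (\<lambda>x. of_real (x \<bullet> x) ^ Suc j * R x) x = laplacian (\<lambda>x. of_real (x \<bullet> x) * ?S x) x"
    by (simp add: mult.assoc)
  also have "\<dots> = of_nat (2 * CARD('n) + 4 * (2 * j + n)) * ?S x + ?q * laplacian ?S x"
    by (rule laplacian_inner_self_mult[OF S homS])
  also have "?q * laplacian ?S x = of_real (2 * real j * (2 * (real j - 1) + real CARD('n) + 2 * real n)) * ?S x
      + ?q ^ Suc j * laplacian R x"
    unfolding Suc.IH by (cases j) (simp_all add: algebra_simps)
  finally show ?case by (simp add: algebra_simps)
qed simp

text \<open>\<open>zonal_coeff T k j\<close> is, for an initial coefficient normalised to make \<open>harmonic_proj k\<close> a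
  projection, the coefficient of \<open>|x|\<^sup>2\<^sup>j (x \<bullet> \<xi>) ^ (k - 2 * j)\<close> in the zonal solid
  harmonic of degree \<open>k\<close>; the recursion says that the Laplacian vanishes.\<close>

fun zonal_coeff :: "'n::finite itself \<Rightarrow> nat \<Rightarrow> nat \<Rightarrow> real" where
  "zonal_coeff T k 0 = 1 / sphere_moment T k k"
| "zonal_coeff T k (Suc j) = - zonal_coeff T k j * real ((k - 2 * j) * (k - 2 * j - 1))
     / (2 * real (Suc j) * (2 * real j + real CARD('n) + 2 * real (k - 2 * Suc j)))"

text \<open>The integral of \<open>f\<close> against a multiple of the Gegenbauer polynomial in
  \<open>\<xi> \<bullet> x\<close>, expanded so that only moments of \<open>f\<close> enter. The
  powers of \<open>x \<bullet> x\<close> make it homogeneous of degree \<open>k\<close> away from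
  the sphere, where harmonicity can be tested.\<close>

definition harmonic_proj :: "nat \<Rightarrow> (real ^ 'n \<Rightarrow> complex) \<Rightarrow> real ^ 'n \<Rightarrow> complex"
  where "harmonic_proj k f x =
    (\<Sum>j\<le>k div 2. of_real (zonal_coeff TYPE('n) k j) * (of_real (x \<bullet> x) ^ j * moment (k - 2 * j) f x))"

lemma zonal_coeff_rec:
  "zonal_coeff TYPE('n::finite) k (Suc j) * (2 * real (Suc j) * (2 * real j + real CARD('n) + 2 * real (k - 2 * Suc j)))
     = - zonal_coeff TYPE('n) k j * real ((k - 2 * j) * (k - 2 * j - 1))"
proof -
  have "2 * real (Suc j) * (2 * real j + real CARD('n) + 2 * real (k - 2 * Suc j)) > 0"
    by (intro mult_pos_pos add_nonneg_pos add_pos_nonneg) auto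
  then have "2 * real (Suc j) * (2 * real j + real CARD('n) + 2 * real (k - 2 * Suc j)) \<noteq> 0"
    by (rule less_imp_neq[symmetric])
  from nonzero_eq_divide_eq[OF this, THEN iffD1, OF zonal_coeff.simps(2)] show ?thesis .
qed

lemma solid_harmonic_proj:
  fixes f :: "real ^ 'n \<Rightarrow> complex"
  assumes f: "integrable sphere_measure f"
  shows "solid_harmonic k (harmonic_proj k f)"
proof -
  let ?z = "zonal_coeff TYPE('n) k"
  let ?T = "\<lambda>j x. of_real (x \<bullet> x) ^ j * moment (k - 2 * j) f x"
  have T: "polyfun (?T j)" for j
    by (intro polyfun_mult polyfun_power polyfun_inner_self polyfun_moment f)
  have eq: "harmonic_proj k f = (\<lambda>x. \<Sum>j\<le>k div 2. of_real (?z j) * ?T j x)"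
    by (intro ext) (simp add: harmonic_proj_def)
  have pf: "polyfun (harmonic_proj k f)"
    unfolding eq by (intro polyfun_sum polyfun_cmult T)
  have hom: "harmonic_proj k f (c *\<^sub>R x) = of_real c ^ k * harmonic_proj k f x" for c x
    unfolding eq sum_distrib_left
  proof (rule sum.cong[OF refl])
    fix j assume "j \<in> {..k div 2}"
    then have "complex_of_real c ^ k = of_real c ^ (2 * j + (k - 2 * j))" by (intro arg_cong[where f="(^) _"]) auto
    also have "\<dots> = (of_real (c * c)) ^ j * of_real c ^ (k - 2 * j)"
      by (simp add: power_add power_mult power2_eq_square)
    finally show "of_real (?z j) * ?T j (c *\<^sub>R x) = of_real c ^ k * (of_real (?z j) * ?T j x)"
      by (simp add: moment_scaleR power_mult_distrib mult_ac)
  qed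
  have "laplacian (harmonic_proj k f) x = 0" for x
  proof -
    let ?q = "complex_of_real (x \<bullet> x)"
    \<comment> \<open>The Laplacian of the \<open>j\<close>-th term splits into \<open>A j\<close>,
      where derivatives fall on the power of \<open>x \<bullet> x\<close>, and \<open>B j\<close>,
      the Laplacian of the moment. The zonal recursion says precisely
      \<open>A (Suc j) = - B j\<close>, so the sum telescopes.\<close>
    define A where "A j = of_real (?z j * (2 * real j * (2 * (real j - 1) + real CARD('n) + 2 * real (k - 2 * j))))
        * (?q ^ (j - 1) * moment (k - 2 * j) f x)" for j
    define B where "B j = of_real (?z j * real ((k - 2 * j) * (k - 2 * j - 1))) * (?q ^ j * moment (k - 2 * j - 2) f x)" for j
    have AB: "A (Suc j) = - B j" for j
    proof -
      have "?z (Suc j) * (2 * real (Suc j) * (2 * (real (Suc j) - 1) + real CARD('n) + 2 * real (k - 2 * Suc j)))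
          = - (?z j * real ((k - 2 * j) * (k - 2 * j - 1)))"
        using zonal_coeff_rec[of k j, where 'n='n] by (simp del: zonal_coeff.simps of_nat_mult)
      moreover have "k - 2 * Suc j = k - 2 * j - 2" by simp
      ultimately show ?thesis unfolding A_def B_def
        by (simp only: of_real_minus mult_minus_left diff_Suc_1)
    qed
    have "laplacian (harmonic_proj k f) x = (\<Sum>j\<le>k div 2. of_real (?z j) * laplacian (?T j) x)"
    proof -
      have D: "dirderiv v (\<lambda>x. \<Sum>j\<in>J. of_real (?z j) * R j x) = (\<lambda>x. \<Sum>j\<in>J. of_real (?z j) * dirderiv v (R j) x)"
        if "\<And>j. polyfun (R j)" for v R and J :: "nat set"
        using that by (intro ext) (simp add: dirderiv_sum dirderiv_cmult polyfun_cmult)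
      show ?thesis
        unfolding eq laplacian_eq D[OF T] D[OF polyfun_dirderiv[OF T]] sum_distrib_left
        by (rule sum.swap)
    qed
    also have "\<dots> = (\<Sum>j\<le>k div 2. A j + B j)"
      by (intro sum.cong refl)
         (simp add: laplacian_inner_self_power_mult[OF polyfun_moment[OF f] moment_scaleR] laplacian_moment[OF f]
           A_def B_def ring_distribs mult_ac)
    also have "\<dots> = (\<Sum>j\<le>k div 2. A j) + (\<Sum>j\<le>k div 2. B j)" by (rule sum.distrib)
    also have "(\<Sum>j\<le>k div 2. A j) = A 0 + (\<Sum>j<k div 2. A (Suc j))"
      by (rule sum.atMost_shift)
    also have "A 0 = 0" by (simp add: A_def)
    also have "(\<Sum>j<k div 2. A (Suc j)) = - (\<Sum>j<k div 2. B j)"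
      by (simp only: AB sum_negf)
    also have "(\<Sum>j\<le>k div 2. B j) = (\<Sum>j<k div 2. B j) + B (k div 2)"
      unfolding lessThan_Suc_atMost[symmetric] by (rule sum.lessThan_Suc)
    also have "B (k div 2) = 0"
    proof -
      \<comment> \<open>The last moment has order 0 or 1, so two derivatives annihilate it and
        nothing is left at the upper end.\<close>
      have "k - 2 * (k div 2) = 0 \<or> k - 2 * (k div 2) - 1 = 0" by presburger
      then have "(k - 2 * (k div 2)) * (k - 2 * (k div 2) - 1) = 0" by (simp only: mult_eq_0_iff)
      then show ?thesis by (simp only: B_def of_nat_0 mult_zero_right of_real_0 mult_zero_left)
    qed
    finally show ?thesis by simp
  qed
  with pf hom show ?thesis by (simp add: solid_harmonic_def)
qed

lemma harmonic_proj_sphere: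
  fixes f :: "real ^ 'n \<Rightarrow> complex"
  shows "norm \<omega> = 1 \<Longrightarrow> harmonic_proj k f \<omega> = (\<Sum>j\<le>k div 2. of_real (zonal_coeff TYPE('n) k j) * moment (k - 2 * j) f \<omega>)"
  by (simp add: harmonic_proj_def norm_eq_1)

text \<open>Moments of order below \<open>k\<close> annihilate \<open>Y\<close>, so only the term
  \<open>j = 0\<close> survives; its coefficient is the reciprocal of the eigenvalue of
  \<open>moment k\<close>.\<close>

lemma harmonic_proj_solid_harmonic_same:
  fixes Y :: "real ^ 'n \<Rightarrow> complex"
  assumes Y: "solid_harmonic k Y" and \<omega>: "norm \<omega> = 1"
  shows "harmonic_proj k Y \<omega> = Y \<omega>"
proof -
  have "harmonic_proj k Y \<omega> = (\<Sum>j\<le>k div 2. of_real (zonal_coeff TYPE('n) k j) * (sphere_moment TYPE('n) (k - 2 * j) k * Y \<omega>))"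
    unfolding harmonic_proj_sphere[OF \<omega>] moment_def sphere_moment_solid_harmonic[OF Y \<omega>] ..
  also have "\<dots> = (\<Sum>j\<le>k div 2. if j = 0 then Y \<omega> else 0)"
  proof (rule sum.cong[OF refl])
    fix j assume "j \<in> {..k div 2}"
    then have "k - 2 * j < k" if "j \<noteq> 0" using that by auto
    then show "of_real (zonal_coeff TYPE('n) k j) * (sphere_moment TYPE('n) (k - 2 * j) k * Y \<omega>) = (if j = 0 then Y \<omega> else 0)"
      using sphere_moment_self_pos[of k, where 'n='n] by (auto simp: sphere_moment_eq_0)
  qed
  finally show ?thesis by simp
qed

lemma harmonic_proj_selfadjoint:
  fixes f h :: "real ^ 'n \<Rightarrow> complex"
  assumes f: "integrable sphere_measure f" and h: "integrable sphere_measure h"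
  shows "(\<integral>\<omega>. harmonic_proj k f \<omega> * h \<omega> \<partial>sphere_measure) = (\<integral>\<omega>. f \<omega> * harmonic_proj k h \<omega> \<partial>sphere_measure)"
proof -
  have mom_bdd: "integrable sphere_measure (\<lambda>\<omega>. moment m f \<omega> * h \<omega>)"
    if f: "integrable sphere_measure f" and h: "integrable sphere_measure h"
    for m and f h :: "real ^ 'n \<Rightarrow> complex"
    using sphere_pair.integrable_snd[OF integrable_sphere_pair_kernel[OF f h, of m]]
    by (simp add: moment_def)
  have "(\<integral>\<omega>. harmonic_proj k f \<omega> * h \<omega> \<partial>sphere_measure) =
      (\<integral>\<omega>. (\<Sum>j\<le>k div 2. of_real (zonal_coeff TYPE('n) k j) * (moment (k - 2 * j) f \<omega> * h \<omega>)) \<partial>sphere_measure)"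
    by (rule Bochner_Integration.integral_cong)
       (auto simp: harmonic_proj_sphere norm_sphere_measure sum_distrib_right mult.assoc)
  also have "\<dots> = (\<Sum>j\<le>k div 2. of_real (zonal_coeff TYPE('n) k j) * (\<integral>\<omega>. moment (k - 2 * j) f \<omega> * h \<omega> \<partial>sphere_measure))"
    by (subst Bochner_Integration.integral_sum) (auto intro!: integrable_mult_right mom_bdd f h)
  also have "\<dots> = (\<Sum>j\<le>k div 2. of_real (zonal_coeff TYPE('n) k j) * (\<integral>\<omega>. moment (k - 2 * j) h \<omega> * f \<omega> \<partial>sphere_measure))"
  proof -
    have "(\<integral>\<omega>. moment m f \<omega> * h \<omega> \<partial>sphere_measure) = (\<integral>\<omega>. moment m h \<omega> * f \<omega> \<partial>sphere_measure)" for m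
      using moment_selfadjoint[OF f h, of m] by (simp only: mult.commute)
    then show ?thesis by simp
  qed
  also have "\<dots> = (\<integral>\<omega>. (\<Sum>j\<le>k div 2. of_real (zonal_coeff TYPE('n) k j) * (moment (k - 2 * j) h \<omega> * f \<omega>)) \<partial>sphere_measure)"
    by (subst Bochner_Integration.integral_sum) (auto intro!: integrable_mult_right mom_bdd f h)
  also have "\<dots> = (\<integral>\<omega>. f \<omega> * harmonic_proj k h \<omega> \<partial>sphere_measure)"
    by (rule Bochner_Integration.integral_cong)
       (auto simp: harmonic_proj_sphere norm_sphere_measure sum_distrib_left mult_ac)
  finally show ?thesis .
qed

lemma integral_norm_square_eq_0_iff:
  fixes P :: "real ^ 'n \<Rightarrow> complex"
  assumes "polyfun P"
  shows "(\<integral>\<omega>. P \<omega> * cnj (P \<omega>) \<partial>sphere_measure) = 0 \<longleftrightarrow> (AE \<omega> in sphere_measure. P \<omega> = 0)"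
proof -
  have "integrable sphere_measure (\<lambda>\<omega>. complex_of_real ((norm (P \<omega>))\<^sup>2))"
    using polyfun_integrable_sphere[OF polyfun_mult[OF assms polyfun_cnj[OF assms]]]
    by (simp only: complex_norm_square)
  then have "integrable sphere_measure (\<lambda>\<omega>. (norm (P \<omega>))\<^sup>2)"
    by (simp only: complex_of_real_integrable_eq)
  then have "(\<integral>\<omega>. (norm (P \<omega>))\<^sup>2 \<partial>sphere_measure) = 0 \<longleftrightarrow> (AE \<omega> in sphere_measure. P \<omega> = 0)"
    by (subst integral_nonneg_eq_0_iff_AE) auto
  moreover have "(\<integral>\<omega>. P \<omega> * cnj (P \<omega>) \<partial>sphere_measure) = complex_of_real (\<integral>\<omega>. (norm (P \<omega>))\<^sup>2 \<partial>sphere_measure)"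
    by (simp only: complex_norm_square[symmetric] integral_complex_of_real)
  ultimately show ?thesis by simp
qed

text \<open>On the sphere the projection acts on \<open>Y\<close> as a scalar \<open>c\<close>.
  Pairing with the conjugate of \<open>Y\<close> gives 0 by orthogonality, so \<open>c = 0\<close>
  unless \<open>Y\<close> vanishes almost everywhere, and then all its moments are 0.\<close>

lemma harmonic_proj_solid_harmonic_other:
  fixes Y :: "real ^ 'n \<Rightarrow> complex"
  assumes Y: "solid_harmonic l Y" and "k \<noteq> l" and \<omega>: "norm \<omega> = 1"
  shows "harmonic_proj k Y \<omega> = 0"
proof -
  note pf = solid_harmonic_polyfun[OF Y]
  note int = polyfun_integrable_sphere[OF pf]
  define c where "c = (\<Sum>j\<le>k div 2. zonal_coeff TYPE('n) k j * sphere_moment TYPE('n) (k - 2 * j) l)"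
  have c: "harmonic_proj k Y \<omega> = c * Y \<omega>" if "norm \<omega> = 1" for \<omega>
    unfolding harmonic_proj_sphere[OF that] moment_def sphere_moment_solid_harmonic[OF Y that]
    by (simp add: c_def sum_distrib_right mult.assoc)
  have "c * (\<integral>\<omega>. Y \<omega> * cnj (Y \<omega>) \<partial>sphere_measure) = (\<integral>\<omega>. harmonic_proj k Y \<omega> * cnj (Y \<omega>) \<partial>sphere_measure)"
    by (simp add: c norm_sphere_measure mult.assoc cong: Bochner_Integration.integral_cong)
  also have "\<dots> = 0"
    by (rule solid_harmonics_orthogonal[OF solid_harmonic_proj[OF int] solid_harmonic_cnj[OF Y] \<open>k \<noteq> l\<close>])
  finally consider "c = 0" | "AE \<omega> in sphere_measure. Y \<omega> = 0"
    using integral_norm_square_eq_0_iff[OF pf] by auto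
  then show ?thesis
  proof cases
    case 2
    have "moment m Y \<omega> = 0" for m
      unfolding moment_def by (rule integral_eq_zero_AE) (use 2 in eventually_elim, simp)
    then show ?thesis by (simp add: harmonic_proj_def)
  qed (simp add: c \<omega>)
qed

section \<open>The square mean of an extension over spheres\<close>

lemma polyfun_bounded_sphere:
  assumes "polyfun P"
  obtains B where "\<And>\<omega>. norm \<omega> = 1 \<Longrightarrow> norm (P \<omega>) \<le> B"
proof -
  obtain C M where CM: "\<And>x. norm (P x) \<le> C * (1 + norm x) ^ M"
    using polyfun_bounded[OF assms] by blast
  show ?thesis
    by (rule that[of "C * 2 ^ M"]) (use CM in \<open>metis one_add_one\<close>)
qed

lemma integrable_mult_polyfun:
  fixes f :: "real ^ 'n \<Rightarrow> complex"
  assumes f: "integrable sphere_measure f" and P: "polyfun P"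
  shows "integrable sphere_measure (\<lambda>\<omega>. f \<omega> * P \<omega>)"
proof -
  obtain B where B: "\<And>\<omega>. norm \<omega> = 1 \<Longrightarrow> norm (P \<omega>) \<le> B" using polyfun_bounded_sphere[OF P] by blast
  show ?thesis
  proof (rule Bochner_Integration.integrable_bound[OF integrable_mult_right[OF f, of "of_real B"]])
    show "(\<lambda>\<omega>. f \<omega> * P \<omega>) \<in> borel_measurable sphere_measure"
      by (intro borel_measurable_times borel_measurable_integrable[OF f]
        borel_measurable_sphere_measure[OF polyfun_measurable[OF P]])
    show "AE \<omega> in sphere_measure. norm (f \<omega> * P \<omega>) \<le> norm (of_real B * f \<omega>)"
    proof (rule AE_I2)
      fix \<omega> :: "real ^ 'n" assume "\<omega> \<in> space sphere_measure"
      then have "norm (P \<omega>) \<le> \<bar>B\<bar>" using B[of \<omega>] by (simp add: norm_sphere_measure)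
      then show "norm (f \<omega> * P \<omega>) \<le> norm (of_real B * f \<omega>)"
        by (simp add: norm_mult mult.commute[of _ "norm (P \<omega>)"] mult_right_mono)
    qed
  qed
qed

lemma norm_le_one_add_square: "norm z \<le> 1 + (norm z)\<^sup>2" for z :: complex
  using zero_le_power2[of "norm z - 1"] norm_ge_zero[of z] unfolding power2_diff by (simp del: norm_ge_zero zero_le_power2)

text \<open>The second bound is cruder than Cauchy-Schwarz, but linear in the energy, which suffices
  to bound the remainders of the expansion uniformly.\<close>

lemma square_integrable_imp_integrable:
  fixes f :: "real ^ 'n \<Rightarrow> complex"
  assumes "f \<in> borel_measurable sphere_measure" "integrable sphere_measure (\<lambda>\<omega>. (norm (f \<omega>))\<^sup>2)"
  shows "integrable sphere_measure f"
    and "(\<integral>\<omega>. norm (f \<omega>) \<partial>sphere_measure) \<le>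
      measure sphere_measure (sphere 0 1 :: (real ^ 'n) set) + (\<integral>\<omega>. (norm (f \<omega>))\<^sup>2 \<partial>sphere_measure)"
proof -
  have 1: "integrable (sphere_measure :: (real ^ 'n) measure) (\<lambda>_. 1 :: real)" by simp
  show int: "integrable sphere_measure f"
    by (rule Bochner_Integration.integrable_bound[OF Bochner_Integration.integrable_add[OF 1 assms(2)] assms(1)])
       (auto intro!: norm_le_one_add_square)
  have "(\<integral>\<omega>. norm (f \<omega>) \<partial>sphere_measure) \<le> (\<integral>\<omega>. 1 + (norm (f \<omega>))\<^sup>2 \<partial>sphere_measure)"
    by (intro integral_mono integrable_norm[OF int] Bochner_Integration.integrable_add 1 assms(2) norm_le_one_add_square)
  then show "(\<integral>\<omega>. norm (f \<omega>) \<partial>sphere_measure) \<le>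
      measure sphere_measure (sphere 0 1 :: (real ^ 'n) set) + (\<integral>\<omega>. (norm (f \<omega>))\<^sup>2 \<partial>sphere_measure)"
    using assms(2) by (simp add: space_sphere_measure)
qed

text \<open>Degrees strictly below \<open>N\<close>, to match the first \<open>N\<close> terms of
  the exponential series.\<close>

definition harmonic_sum :: "nat \<Rightarrow> (real ^ 'n \<Rightarrow> complex) \<Rightarrow> real ^ 'n \<Rightarrow> complex"
  where "harmonic_sum N f x = (\<Sum>k<N. harmonic_proj k f x)"

definition harmonic_energy :: "nat \<Rightarrow> (real ^ 'n \<Rightarrow> complex) \<Rightarrow> real"
  where "harmonic_energy k f = (\<integral>\<omega>. (norm (harmonic_proj k f \<omega>))\<^sup>2 \<partial>sphere_measure)"

lemma harmonic_energy_nonneg: "harmonic_energy k f \<ge> 0"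
  by (simp add: harmonic_energy_def)

lemma polyfun_harmonic_proj: "integrable sphere_measure f \<Longrightarrow> polyfun (harmonic_proj k f)"
  by (rule solid_harmonic_polyfun[OF solid_harmonic_proj])

lemma polyfun_harmonic_sum:
  assumes "integrable sphere_measure f"
  shows "polyfun (harmonic_sum N f)"
proof -
  have "harmonic_sum N f = (\<lambda>x. \<Sum>k<N. harmonic_proj k f x)" by (intro ext) (rule harmonic_sum_def)
  then show ?thesis
    by (simp only:) (intro polyfun_sum polyfun_harmonic_proj assms)
qed

text \<open>The conjugate of the projection is a solid harmonic, hence reproduced by
  \<open>harmonic_proj k\<close>, which selfadjointness then moves onto \<open>f\<close>.\<close>

lemma integral_mult_cnj_harmonic_proj:
  fixes f :: "real ^ 'n \<Rightarrow> complex"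
  assumes f: "integrable sphere_measure f"
  shows "(\<integral>\<omega>. f \<omega> * cnj (harmonic_proj k f \<omega>) \<partial>sphere_measure) = harmonic_energy k f"
proof -
  let ?P = "harmonic_proj k f"
  have P: "solid_harmonic k ?P" by (rule solid_harmonic_proj[OF f])
  note cP = solid_harmonic_cnj[OF P]
  have "(\<integral>\<omega>. f \<omega> * cnj (?P \<omega>) \<partial>sphere_measure) =
      (\<integral>\<omega>. f \<omega> * harmonic_proj k (\<lambda>x. cnj (?P x)) \<omega> \<partial>sphere_measure)"
    by (rule Bochner_Integration.integral_cong)
       (auto simp: harmonic_proj_solid_harmonic_same[OF cP] norm_sphere_measure)
  also have "\<dots> = (\<integral>\<omega>. ?P \<omega> * cnj (?P \<omega>) \<partial>sphere_measure)"
    by (rule harmonic_proj_selfadjoint[OF f polyfun_integrable_sphere[OF solid_harmonic_polyfun[OF cP]], symmetric])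
  also have "\<dots> = harmonic_energy k f"
    by (simp only: harmonic_energy_def complex_norm_square[symmetric] integral_complex_of_real)
  finally show ?thesis .
qed

text \<open>The real part of the inner product of \<open>f\<close> with its partial sum and the
  square norm of the partial sum both equal the sum of the energies; they enter with factors -2 and
  1.\<close>

lemma integral_square_diff_harmonic_sum:
  fixes f :: "real ^ 'n \<Rightarrow> complex"
  assumes meas: "f \<in> borel_measurable sphere_measure" and f2: "integrable sphere_measure (\<lambda>\<omega>. (norm (f \<omega>))\<^sup>2)"
  shows "integrable sphere_measure (\<lambda>\<omega>. (norm (f \<omega> - harmonic_sum N f \<omega>))\<^sup>2)" (is ?int)
    and "(\<integral>\<omega>. (norm (f \<omega> - harmonic_sum N f \<omega>))\<^sup>2 \<partial>sphere_measure) =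
      (\<integral>\<omega>. (norm (f \<omega>))\<^sup>2 \<partial>sphere_measure) - (\<Sum>k<N. harmonic_energy k f)" (is ?eq)
proof -
  note f = square_integrable_imp_integrable(1)[OF meas f2]
  let ?F = "harmonic_sum N f"
  have F: "polyfun ?F" by (rule polyfun_harmonic_sum[OF f])
  have sq: "(norm (a - b))\<^sup>2 = (norm a)\<^sup>2 - 2 * Re (a * cnj b) + (norm b)\<^sup>2" for a b :: complex
    by (simp only: cmod_power2) (simp add: power2_eq_square algebra_simps)
  have iF: "integrable sphere_measure (\<lambda>\<omega>. (norm (?F \<omega>))\<^sup>2)"
  proof -
    have "integrable sphere_measure (\<lambda>\<omega>. complex_of_real ((norm (?F \<omega>))\<^sup>2))"
      using polyfun_integrable_sphere[OF polyfun_mult[OF F polyfun_cnj[OF F]]]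
      by (simp only: complex_norm_square)
    then show ?thesis by (simp only: complex_of_real_integrable_eq)
  qed
  have ifF: "integrable sphere_measure (\<lambda>\<omega>. f \<omega> * cnj (?F \<omega>))"
    by (rule integrable_mult_polyfun[OF f polyfun_cnj[OF F]])
  have iRe: "integrable sphere_measure (\<lambda>\<omega>. Re (f \<omega> * cnj (?F \<omega>)))"
    by (rule integrable_Re[OF ifF])
  show ?int unfolding sq by (intro Bochner_Integration.integrable_add Bochner_Integration.integrable_diff f2 integrable_mult_right iRe iF)
  have "(\<integral>\<omega>. f \<omega> * cnj (?F \<omega>) \<partial>sphere_measure) = (\<integral>\<omega>. (\<Sum>k<N. f \<omega> * cnj (harmonic_proj k f \<omega>)) \<partial>sphere_measure)"
    by (simp add: harmonic_sum_def sum_distrib_left)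
  also have "\<dots> = (\<Sum>k<N. complex_of_real (harmonic_energy k f))"
    by (subst Bochner_Integration.integral_sum)
       (auto intro!: integrable_mult_polyfun[OF f] polyfun_cnj polyfun_harmonic_proj f
         simp: integral_mult_cnj_harmonic_proj f)
  finally have "(\<integral>\<omega>. f \<omega> * cnj (?F \<omega>) \<partial>sphere_measure) = complex_of_real (\<Sum>k<N. harmonic_energy k f)" by simp
  then have 1: "(\<integral>\<omega>. Re (f \<omega> * cnj (?F \<omega>)) \<partial>sphere_measure) = (\<Sum>k<N. harmonic_energy k f)"
    by (subst integral_Re[OF ifF]) (simp only: Re_complex_of_real)
  have 2: "(\<integral>\<omega>. (norm (?F \<omega>))\<^sup>2 \<partial>sphere_measure) = (\<Sum>k<N. harmonic_energy k f)"
    using integral_norm_sum_solid_harmonics[of "\<lambda>k. harmonic_proj k f" "\<lambda>_. 1" N, OF solid_harmonic_proj[OF f]]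
    by (simp add: harmonic_sum_def harmonic_energy_def)
  have "(\<integral>\<omega>. (norm (f \<omega> - harmonic_sum N f \<omega>))\<^sup>2 \<partial>sphere_measure) = (\<integral>\<omega>. (norm (f \<omega>))\<^sup>2 \<partial>sphere_measure)
      - 2 * (\<integral>\<omega>. Re (f \<omega> * cnj (?F \<omega>)) \<partial>sphere_measure) + (\<integral>\<omega>. (norm (?F \<omega>))\<^sup>2 \<partial>sphere_measure)"
  proof -
    have "(\<integral>\<omega>. a \<omega> - 2 * b \<omega> + c \<omega> \<partial>sphere_measure) =
        (\<integral>\<omega>. a \<omega> \<partial>sphere_measure) - 2 * (\<integral>\<omega>. b \<omega> \<partial>sphere_measure) + (\<integral>\<omega>. c \<omega> \<partial>sphere_measure)"
      if "integrable sphere_measure a" "integrable sphere_measure b" "integrable sphere_measure c"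
      for a b c :: "real ^ 'n \<Rightarrow> real"
      using that by simp
    from this[OF f2 iRe iF] show ?thesis unfolding sq .
  qed
  then show ?eq unfolding 1 2 by simp
qed

lemma bessel_inequality:
  fixes f :: "real ^ 'n \<Rightarrow> complex"
  assumes "f \<in> borel_measurable sphere_measure" "integrable sphere_measure (\<lambda>\<omega>. (norm (f \<omega>))\<^sup>2)"
  shows "(\<Sum>k<N. harmonic_energy k f) \<le> (\<integral>\<omega>. (norm (f \<omega>))\<^sup>2 \<partial>sphere_measure)"
proof -
  have "0 \<le> (\<integral>\<omega>. (norm (f \<omega> - harmonic_sum N f \<omega>))\<^sup>2 \<partial>sphere_measure)" by simp
  then show ?thesis unfolding integral_square_diff_harmonic_sum(2)[OF assms] by simp
qed

text \<open>This takes the place of completeness. The remainder has zero projections in all degrees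
  below \<open>N\<close>. Its projection of degree \<open>m\<close> is a nonzero multiple of its
  moment of order \<open>m\<close> plus lower moments, so on the sphere the moments vanish one after
  the other; homogeneity covers all other points.\<close>

lemma moment_diff_harmonic_sum:
  fixes f :: "real ^ 'n \<Rightarrow> complex"
  assumes f: "integrable sphere_measure f" and "m < N"
  shows "moment m (\<lambda>\<xi>. f \<xi> - harmonic_sum N f \<xi>) x = 0"
proof -
  let ?g = "\<lambda>\<xi>. f \<xi> - harmonic_sum N f \<xi>"
  have sol: "solid_harmonic l (harmonic_proj l f)" for l by (rule solid_harmonic_proj[OF f])
  have pint: "integrable sphere_measure (harmonic_proj l f)" for l
    by (rule polyfun_integrable_sphere[OF solid_harmonic_polyfun[OF sol]])
  have lin: "moment n ?g x = moment n f x - (\<Sum>l<N. moment n (harmonic_proj l f) x)" for n x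
  proof -
    have "moment n ?g x = moment n f x - moment n (\<lambda>\<xi>. \<Sum>l<N. 1 * harmonic_proj l f \<xi>) x"
      unfolding moment_def right_diff_distrib harmonic_sum_def
      by (subst Bochner_Integration.integral_diff)
         (auto intro!: integrable_inner_power f Bochner_Integration.integrable_sum pint)
    also have "moment n (\<lambda>\<xi>. \<Sum>l<N. 1 * harmonic_proj l f \<xi>) x = (\<Sum>l<N. 1 * moment n (harmonic_proj l f) x)"
      by (rule moment_sum[OF pint])
    finally show ?thesis by simp
  qed
  have proj0: "harmonic_proj k ?g \<omega> = 0" if "k < N" "norm \<omega> = 1" for k \<omega>
  proof -
    have "harmonic_proj k ?g \<omega> = harmonic_proj k f \<omega> - (\<Sum>l<N. harmonic_proj k (harmonic_proj l f) \<omega>)"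
      unfolding harmonic_proj_sphere[OF that(2)] lin right_diff_distrib sum_subtractf sum_distrib_left
      by (subst sum.swap) simp
    also have "(\<Sum>l<N. harmonic_proj k (harmonic_proj l f) \<omega>) = (\<Sum>l<N. if l = k then harmonic_proj k f \<omega> else 0)"
    proof (rule sum.cong[OF refl])
      fix l
      show "harmonic_proj k (harmonic_proj l f) \<omega> = (if l = k then harmonic_proj k f \<omega> else 0)"
        using harmonic_proj_solid_harmonic_same[OF sol that(2), of k]
          harmonic_proj_solid_harmonic_other[OF sol _ that(2), of k l] by auto
    qed
    finally show ?thesis using that(1) by simp
  qed
  have unit: "moment m ?g \<omega> = 0" if "norm \<omega> = 1" for \<omega>
    using \<open>m < N\<close>
  proof (induction m rule: less_induct)
    case (less m)
    have "0 = (\<Sum>j\<le>m div 2. of_real (zonal_coeff TYPE('n) m j) * moment (m - 2 * j) ?g \<omega>)"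
      using proj0[OF less.prems that] harmonic_proj_sphere[OF that, of m ?g] by simp
    also have "\<dots> = (\<Sum>j\<le>m div 2. if j = 0 then of_real (zonal_coeff TYPE('n) m 0) * moment m ?g \<omega> else 0)"
    proof (rule sum.cong[OF refl])
      fix j assume "j \<in> {..m div 2}"
      then have "m - 2 * j < m" if "j \<noteq> 0" using that by auto
      then show "of_real (zonal_coeff TYPE('n) m j) * moment (m - 2 * j) ?g \<omega> =
          (if j = 0 then of_real (zonal_coeff TYPE('n) m 0) * moment m ?g \<omega> else 0)"
        using less by auto
    qed
    finally show ?case using sphere_moment_self_pos[of m, where 'n='n] by simp
  qed
  have "moment m ?g (norm x *\<^sub>R direction x) = of_real (norm x) ^ m * moment m ?g (direction x)"
    by (rule moment_scaleR)
  then show ?thesis by (simp add: unit norm_scaleR_direction)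
qed

lemma integrable_extension:
  assumes "integrable sphere_measure f"
  shows "integrable sphere_measure (\<lambda>\<xi>. exp (- \<i> * complex_of_real (x \<bullet> \<xi>)) * f \<xi>)"
  using assms by (intro Bochner_Integration.integrable_bound[OF assms]) (auto simp: norm_mult)

text \<open>The first \<open>N\<close> moments of the remainder are 0, so its extension is at most
  the exponential tail times its first-power norm. By Pythagoras that norm is bounded independently
  of \<open>N\<close>.\<close>

lemma extension_harmonic_sum_tendsto:
  fixes f :: "real ^ 'n \<Rightarrow> complex"
  assumes meas: "f \<in> borel_measurable sphere_measure" and f2: "integrable sphere_measure (\<lambda>\<omega>. (norm (f \<omega>))\<^sup>2)"
  shows "(\<lambda>N. extension (harmonic_sum N f) x) \<longlonglongrightarrow> extension f x"
proof -
  note f = square_integrable_imp_integrable(1)[OF meas f2]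
  note F = polyfun_integrable_sphere[OF polyfun_harmonic_sum[OF f]]
  let ?K = "measure sphere_measure (sphere 0 1 :: (real ^ 'n) set) + (\<integral>\<omega>. (norm (f \<omega>))\<^sup>2 \<partial>sphere_measure)"
  let ?t = "\<lambda>N. exp (norm x) - (\<Sum>m<N. norm x ^ m / fact m)"
  have "norm (extension f x - extension (harmonic_sum N f) x) \<le> ?t N * ?K" for N
  proof -
    let ?g = "\<lambda>\<xi>. f \<xi> - harmonic_sum N f \<xi>"
    have g: "integrable sphere_measure ?g" using f F by simp
    have gm: "?g \<in> borel_measurable sphere_measure" using g by (rule borel_measurable_integrable)
    have "extension ?g x = extension f x - extension (harmonic_sum N f) x"
      unfolding extension_def right_diff_distrib
      by (intro Bochner_Integration.integral_diff integrable_extension f F)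
    moreover have "(\<integral>\<xi>. of_real (\<xi> \<bullet> x) ^ m * ?g \<xi> \<partial>sphere_measure) = 0" if "m < N" for m
      using moment_diff_harmonic_sum[OF f that] unfolding moment_def .
    ultimately have "norm (extension f x - extension (harmonic_sum N f) x) \<le> ?t N * (\<integral>\<xi>. norm (?g \<xi>) \<partial>sphere_measure)"
      using extension_partial_sum[OF g, of x N] by simp
    also have "\<dots> \<le> ?t N * ?K"
    proof (rule mult_left_mono)
      have "(\<integral>\<xi>. norm (?g \<xi>) \<partial>sphere_measure) \<le>
          measure sphere_measure (sphere 0 1 :: (real ^ 'n) set) + (\<integral>\<omega>. (norm (?g \<omega>))\<^sup>2 \<partial>sphere_measure)"
        by (rule square_integrable_imp_integrable(2)[OF gm integral_square_diff_harmonic_sum(1)[OF meas f2]])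
      also have "\<dots> \<le> ?K"
        unfolding integral_square_diff_harmonic_sum(2)[OF meas f2]
        by (simp add: sum_nonneg harmonic_energy_nonneg)
      finally show "(\<integral>\<xi>. norm (?g \<xi>) \<partial>sphere_measure) \<le> ?K" .
      show "0 \<le> ?t N"
        by (rule order_trans[OF norm_ge_zero norm_exp_minus_partial_sum_le[of 0]]) simp
    qed
    finally show ?thesis .
  qed
  then have "(\<lambda>N. extension f x - extension (harmonic_sum N f) x) \<longlonglongrightarrow> 0"
    by (intro Lim_null_comparison[OF always_eventually tendsto_mult_left_zero[OF exp_minus_partial_sum_tendsto_0]]) auto
  from tendsto_diff[OF tendsto_const[of "extension f x"] this] show ?thesis by simp
qed

definition bessel_function :: "nat \<Rightarrow> nat \<Rightarrow> real \<Rightarrow> real"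
  where "bessel_function d k r = 2 powr (1 - real d / 2) * bessel_series d k r"

text \<open>With the value of \<open>gauss_mass\<close> inserted this is the classical
  \<open>(2 pi) powr (d / 2)\<close>.\<close>

definition extension_const :: "'n::finite itself \<Rightarrow> real"
  where "extension_const T = 2 * gauss_mass T / 2 powr (1 - real CARD('n) / 2)"

lemma extension_const_pos: "extension_const TYPE('n::finite) > 0"
  using gauss_mass_pos[where 'n='n] by (simp add: extension_const_def)

lemma bessel_function_measurable [measurable]:
  "d \<ge> 2 \<Longrightarrow> bessel_function d k \<in> borel_measurable borel"
  unfolding bessel_function_def
  by (intro borel_measurable_continuous_onI continuous_intros bessel_series_continuous)

lemma extension_solid_harmonic:
  fixes P :: "real ^ 'n \<Rightarrow> complex" and \<omega> :: "real ^ 'n"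
  assumes "CARD('n) \<ge> 2" "solid_harmonic k P" "norm \<omega> = 1"
  shows "extension P (r *\<^sub>R \<omega>) =
    (- \<i>) ^ k * of_real (extension_const TYPE('n) * bessel_function CARD('n) k r) * P \<omega>"
  unfolding extension_solid_harmonic_series[OF assms]
  by (simp add: extension_const_def bessel_function_def)

lemma nn_integral_extension_le:
  fixes f :: "real ^ 'n \<Rightarrow> complex"
  assumes d: "CARD('n) \<ge> 2"
    and meas: "f \<in> borel_measurable sphere_measure" and f2: "integrable sphere_measure (\<lambda>\<omega>. (norm (f \<omega>))\<^sup>2)"
  shows "(\<integral>\<^sup>+ \<omega>. ennreal ((norm (extension f (r *\<^sub>R \<omega>)))\<^sup>2) \<partial>sphere_measure) \<le>
    (SUP N. ennreal (\<Sum>k<N. (extension_const TYPE('n) * bessel_function CARD('n) k r)\<^sup>2 * harmonic_energy k f))"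
proof -
  note f = square_integrable_imp_integrable(1)[OF meas f2]
  have sol: "solid_harmonic k (harmonic_proj k f)" for k by (rule solid_harmonic_proj[OF f])
  note pf = solid_harmonic_polyfun[OF sol]
  define c where "c k = (- \<i>) ^ k * of_real (extension_const TYPE('n) * bessel_function CARD('n) k r)" for k
  have norm_c: "(norm (c k))\<^sup>2 = (extension_const TYPE('n) * bessel_function CARD('n) k r)\<^sup>2" for k
    by (simp add: c_def norm_mult norm_power power_mult_distrib)
  \<comment> \<open>For fixed \<open>r\<close> the extension of the partial sum is, on the sphere, a
    combination of the same harmonics with scalar weights \<open>c k\<close>, so orthogonality
    evaluates its square integral exactly.\<close>
  define u where "u N \<omega> = (\<Sum>k<N. c k * harmonic_proj k f \<omega>)" for N \<omega>
  have u: "extension (harmonic_sum N f) (r *\<^sub>R \<omega>) = u N \<omega>" if "norm \<omega> = 1" for N \<omega>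
  proof -
    have "extension (harmonic_sum N f) (r *\<^sub>R \<omega>) = (\<Sum>k<N. extension (harmonic_proj k f) (r *\<^sub>R \<omega>))"
      unfolding extension_def harmonic_sum_def sum_distrib_left
      by (intro Bochner_Integration.integral_sum integrable_extension polyfun_integrable_sphere pf)
    also have "\<dots> = u N \<omega>"
      unfolding u_def c_def by (intro sum.cong refl extension_solid_harmonic[OF d sol that])
    finally show ?thesis .
  qed
  have pu: "polyfun (u N)" for N
  proof -
    have "u N = (\<lambda>\<omega>. \<Sum>k<N. c k * harmonic_proj k f \<omega>)" by (intro ext) (rule u_def)
    then show ?thesis by (simp only:) (intro polyfun_sum polyfun_cmult pf)
  qed
  have um: "u N \<in> borel_measurable sphere_measure" for N
    by (rule borel_measurable_sphere_measure[OF polyfun_measurable[OF pu]])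
  have iu: "(\<integral>\<^sup>+ \<omega>. ennreal ((norm (u N \<omega>))\<^sup>2) \<partial>sphere_measure) =
      ennreal (\<Sum>k<N. (extension_const TYPE('n) * bessel_function CARD('n) k r)\<^sup>2 * harmonic_energy k f)" for N
  proof -
    have "integrable sphere_measure (\<lambda>\<omega>. complex_of_real ((norm (u N \<omega>))\<^sup>2))"
      using polyfun_integrable_sphere[OF polyfun_mult[OF pu polyfun_cnj[OF pu]]]
      by (simp only: complex_norm_square)
    then have "integrable sphere_measure (\<lambda>\<omega>. (norm (u N \<omega>))\<^sup>2)"
      by (simp only: complex_of_real_integrable_eq)
    then have "(\<integral>\<^sup>+ \<omega>. ennreal ((norm (u N \<omega>))\<^sup>2) \<partial>sphere_measure) = ennreal (\<integral>\<omega>. (norm (u N \<omega>))\<^sup>2 \<partial>sphere_measure)"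
      by (rule nn_integral_eq_integral) simp
    then show ?thesis
      unfolding u_def integral_norm_sum_solid_harmonics[OF sol] norm_c harmonic_energy_def .
  qed
  have "(\<integral>\<^sup>+ \<omega>. ennreal ((norm (extension f (r *\<^sub>R \<omega>)))\<^sup>2) \<partial>sphere_measure) =
      (\<integral>\<^sup>+ \<omega>. liminf (\<lambda>N. ennreal ((norm (u N \<omega>))\<^sup>2)) \<partial>sphere_measure)"
  proof (rule nn_integral_cong)
    fix \<omega> :: "real ^ 'n" assume "\<omega> \<in> space sphere_measure"
    then have "(\<lambda>N. u N \<omega>) \<longlonglongrightarrow> extension f (r *\<^sub>R \<omega>)"
      using extension_harmonic_sum_tendsto[OF meas f2, of "r *\<^sub>R \<omega>"] by (simp add: u norm_sphere_measure)
    then have "(\<lambda>N. ennreal ((norm (u N \<omega>))\<^sup>2)) \<longlonglongrightarrow> ennreal ((norm (extension f (r *\<^sub>R \<omega>)))\<^sup>2)"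
      by (intro tendsto_ennrealI tendsto_intros)
    then show "ennreal ((norm (extension f (r *\<^sub>R \<omega>)))\<^sup>2) = liminf (\<lambda>N. ennreal ((norm (u N \<omega>))\<^sup>2))"
      by (rule lim_imp_Liminf[OF sequentially_bot, symmetric])
  qed
  also have "\<dots> \<le> liminf (\<lambda>N. \<integral>\<^sup>+ \<omega>. ennreal ((norm (u N \<omega>))\<^sup>2) \<partial>sphere_measure)"
    using um by (intro nn_integral_liminf) measurable
  also have "\<dots> \<le> (SUP N. \<integral>\<^sup>+ \<omega>. ennreal ((norm (u N \<omega>))\<^sup>2) \<partial>sphere_measure)"
    by (rule order_trans[OF Liminf_le_Limsup Limsup_bounded]) (auto intro!: always_eventually SUP_upper)
  finally show ?thesis unfolding iu .
qed

section \<open>Powers of extended non-negative reals\<close>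

lemma ennpowr_ennreal: "x \<ge> 0 \<Longrightarrow> ennpowr (ennreal x) a = ennreal (x powr a)"
  by (simp add: ennpowr_def)

lemma ennpowr_top [simp]: "ennpowr \<infinity> a = \<infinity>"
  by (simp add: ennpowr_def)

lemma ennpowr_mono:
  assumes "a > 0" "x \<le> y"
  shows "ennpowr x a \<le> ennpowr y a"
proof (cases y)
  case (real y')
  with assms obtain x' where "x = ennreal x'" "x' \<ge> 0" by (cases x) (auto simp: top_unique)
  with real assms show ?thesis by (simp add: ennpowr_ennreal powr_mono2)
qed (simp add: ennpowr_def)

lemma ennpowr_mult:
  assumes "a > 0"
  shows "ennpowr (x * y) a = ennpowr x a * ennpowr y a"
proof -
  have top_mult: "ennpowr (\<infinity> * z) a = \<infinity> * ennpowr z a" for z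
    using assms by (cases z) (auto simp: ennpowr_def ennreal_top_mult ennreal_mult_top)
  show ?thesis
  proof (cases x)
    case (real x')
    show ?thesis
    proof (cases y)
      case (real y')
      with \<open>x = ennreal x'\<close> \<open>0 \<le> x'\<close> show ?thesis
        by (simp add: ennpowr_ennreal powr_mult flip: ennreal_mult)
    next
      case top
      then show ?thesis using top_mult[of x] by (simp add: mult.commute ennpowr_def)
    qed
  next
    case top
    then show ?thesis using top_mult[of y] by (simp add: ennpowr_def)
  qed
qed

lemma ennpowr_ennpowr: "ennpowr (ennpowr x a) b = ennpowr x (a * b)"
  by (cases x) (auto simp: ennpowr_def powr_powr)

lemma ennpowr_one [simp]: "ennpowr x 1 = x"
  by (cases x) (auto simp: ennpowr_def)

text \<open>Continuity from below, obtained from the monotonicity of the inverse power.\<close>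

lemma ennpowr_SUP_le:
  assumes "a > 0"
  shows "ennpowr (SUP n. f n) a \<le> (SUP n. ennpowr (f n) a)"
proof -
  let ?Y = "SUP n. ennpowr (f n) a"
  have "f n \<le> ennpowr ?Y (1 / a)" for n
    using ennpowr_mono[of "1 / a" "ennpowr (f n) a" ?Y, OF _ SUP_upper[of n]] assms
    by (simp add: ennpowr_ennpowr)
  then have "(SUP n. f n) \<le> ennpowr ?Y (1 / a)" by (rule SUP_least)
  from ennpowr_mono[OF assms this] show ?thesis using assms by (simp add: ennpowr_ennpowr)
qed

lemma ennpowr_measurable [measurable]: "(\<lambda>x. ennpowr x a) \<in> borel_measurable borel"
  unfolding ennpowr_def by measurable

text \<open>Degenerate denominators are consistent with the conventions: \<open>y = 0\<close> forces
  \<open>x = 0\<close>, and both \<open>0 / 0\<close> and \<open>x / \<infinity>\<close> are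
  0.\<close>

lemma ennreal_divide_le_of_le_mult:
  fixes x y M :: ennreal
  assumes "x \<le> M * y"
  shows "x / y \<le> M"
proof (cases "y = 0 \<or> y = \<infinity>")
  case True
  with assms show ?thesis by (auto simp: divide_ennreal_def)
next
  case False
  then have "M * y / y = M"
    by (simp add: mult_divide_eq_ennreal)
  with divide_right_mono_ennreal[OF assms, of y] show ?thesis by simp
qed

text \<open>Jensen's inequality for the convex power, after dividing the weights by their total
  \<open>W\<close>; since \<open>s \<ge> 1\<close>, the factor \<open>W powr (s - 1)\<close> may be
  enlarged to \<open>A powr (s - 1)\<close>. Indices with \<open>x k = 0\<close> contribute to
  neither side and are dropped, leaving positive arguments.\<close>

lemma power_mean_le:
  fixes w x :: "'a \<Rightarrow> real"
  assumes K: "finite K" and w: "\<And>k. k \<in> K \<Longrightarrow> w k \<ge> 0" and x: "\<And>k. k \<in> K \<Longrightarrow> x k \<ge> 0"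
    and A: "(\<Sum>k\<in>K. w k) \<le> A" and s: "s \<ge> 1"
  shows "(\<Sum>k\<in>K. w k * x k) powr s \<le> A powr (s - 1) * (\<Sum>k\<in>K. w k * x k powr s)"
proof -
  define L where "L = {k \<in> K. x k > 0}"
  define W where "W = (\<Sum>k\<in>L. w k)"
  have L: "finite L" "L \<subseteq> K" using K by (auto simp: L_def)
  have sumL: "(\<Sum>k\<in>K. w k * x k) = (\<Sum>k\<in>L. w k * x k)"
    "(\<Sum>k\<in>K. w k * x k powr s) = (\<Sum>k\<in>L. w k * x k powr s)"
    using K x by (auto intro!: sum.mono_neutral_right simp: L_def order_less_le)
  have W0: "W \<ge> 0" unfolding W_def using w L by (intro sum_nonneg) auto
  have "W \<le> (\<Sum>k\<in>K. w k)" unfolding W_def using K w L by (intro sum_mono2) auto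
  then have WA: "W \<le> A" using A by linarith
  show ?thesis
  proof (cases "W = 0")
    case True
    then have "\<forall>k\<in>L. w k = 0"
      unfolding W_def using w L by (subst (asm) sum_nonneg_eq_0_iff) auto
    then show ?thesis unfolding sumL by simp
  next
    case False
    then have W: "W > 0" using W0 by simp
    have "L \<noteq> {}" using False by (auto simp: W_def)
    have "(\<Sum>k\<in>L. (w k / W) *\<^sub>R x k) powr s \<le> (\<Sum>k\<in>L. (w k / W) * x k powr s)"
    proof (rule convex_on_sum[OF L(1) \<open>L \<noteq> {}\<close> powr_convex[OF s]])
      show "(\<Sum>k\<in>L. w k / W) = 1" using False by (simp add: W_def flip: sum_divide_distrib)
    qed (use w W L in \<open>auto simp: L_def\<close>)
    then have *: "((\<Sum>k\<in>L. w k * x k) / W) powr s \<le> (\<Sum>k\<in>L. w k * x k powr s) / W"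
      by (simp add: sum_divide_distrib)
    have nn: "(\<Sum>k\<in>L. w k * x k) \<ge> 0" "(\<Sum>k\<in>L. w k * x k powr s) \<ge> 0"
      using w x L by (auto intro!: sum_nonneg)
    have "(\<Sum>k\<in>L. w k * x k) powr s = W powr s * ((\<Sum>k\<in>L. w k * x k) / W) powr s"
      using W nn by (simp add: powr_divide)
    also have "\<dots> \<le> W powr s * ((\<Sum>k\<in>L. w k * x k powr s) / W)"
      by (intro mult_left_mono *) simp
    also have "\<dots> = W powr (s - 1) * (\<Sum>k\<in>L. w k * x k powr s)"
      using W by (simp add: powr_diff)
    also have "\<dots> \<le> A powr (s - 1) * (\<Sum>k\<in>L. w k * x k powr s)"
      using W WA s nn by (intro mult_right_mono powr_mono2) auto
    finally show ?thesis unfolding sumL .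
  qed
qed

section \<open>Radial norms\<close>

text \<open>\<open>Lambda\<close> for finite exponents before the root is taken; in this form
  contributions of different \<open>k\<close> add up.\<close>

definition bessel_integral :: "nat \<Rightarrow> real \<Rightarrow> nat \<Rightarrow> ennreal"
  where "bessel_integral d q k =
    (\<integral>\<^sup>+ r\<in>{0<..}. ennreal (\<bar>bessel_function d k r\<bar> powr q * r ^ (d - 1)) \<partial>lborel)"

lemma Lambda_eq_bessel_integral:
  assumes "d \<ge> 2" "p \<noteq> \<infinity>"
  shows "Lambda d p k = ennpowr (bessel_integral d (enn2real p) k) (1 / enn2real p)"
proof -
  have "(\<integral>\<^sup>+ r\<in>{0<..}. ennreal (\<bar>bessel_profile d k r\<bar> powr enn2real p * r ^ (d - 1)) \<partial>lborel) =
      bessel_integral d (enn2real p) k"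
    unfolding bessel_integral_def
    by (intro nn_integral_cong)
       (auto simp: bessel_profile_eq_series[OF assms(1)] bessel_function_def split: split_indicator)
  with assms show ?thesis by (simp add: Lambda_def)
qed

lemma Lambda_infinity_eq:
  assumes "d \<ge> 2"
  shows "Lambda d \<infinity> k = (SUP r\<in>{0..}. ennreal \<bar>bessel_function d k r\<bar>)"
  unfolding Lambda_def
  by (simp, intro SUP_cong refl) (simp add: bessel_profile0_eq_series[OF assms] bessel_function_def)

lemma solid_harmonic_const: "solid_harmonic 0 (\<lambda>_ :: real ^ 'n. c)"
proof -
  have "dirderiv v (\<lambda>_. a) = (\<lambda>_. 0)" for v :: "real ^ 'n" and a by (intro ext) simp
  then show ?thesis by (simp add: solid_harmonic_def polyfun_const laplacian_eq)
qed

text \<open>The mass of the sphere is the eigenvalue \<open>sphere_moment 0 0\<close> belonging to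
  the constant 1, already known to be positive.\<close>

lemma emeasure_sphere_pos: "emeasure (sphere_measure :: (real ^ 'n) measure) (sphere 0 1) > 0"
proof -
  have "complex_of_real (measure (sphere_measure :: (real ^ 'n) measure) (sphere 0 1)) = sphere_moment TYPE('n) 0 0"
    using sphere_moment_solid_harmonic[OF solid_harmonic_const[of 1], of "axis undefined 1 :: real ^ 'n" 0]
    by (simp add: space_sphere_measure scaleR_conv_of_real)
  then have "measure (sphere_measure :: (real ^ 'n) measure) (sphere 0 1) > 0"
    using sphere_moment_self_pos[of 0, where 'n='n] by (simp only: of_real_eq_iff)
  then show ?thesis by (simp add: sphere.emeasure_eq_measure)
qed

lemma Lp_norm_2:
  assumes "f \<in> borel_measurable sphere_measure" "Lp_norm 2 sphere_measure f < \<infinity>"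
  shows "integrable sphere_measure (\<lambda>\<omega>. (norm (f \<omega>))\<^sup>2)"
    and "Lp_norm 2 sphere_measure f = ennreal (sqrt (\<integral>\<omega>. (norm (f \<omega>))\<^sup>2 \<partial>sphere_measure))"
proof -
  have L: "Lp_norm 2 sphere_measure f = ennpowr (\<integral>\<^sup>+ \<omega>. ennreal ((norm (f \<omega>))\<^sup>2) \<partial>sphere_measure) (1 / 2)"
    by (simp add: Lp_norm_def)
  with assms(2) have "(\<integral>\<^sup>+ \<omega>. ennreal ((norm (f \<omega>))\<^sup>2) \<partial>sphere_measure) < \<infinity>"
    by (metis ennpowr_top infinity_ennreal_def less_top)
  then show i: "integrable sphere_measure (\<lambda>\<omega>. (norm (f \<omega>))\<^sup>2)"
    using assms(1) by (intro integrableI_nonneg) auto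
  have "(\<integral>\<^sup>+ \<omega>. ennreal ((norm (f \<omega>))\<^sup>2) \<partial>sphere_measure) = ennreal (\<integral>\<omega>. (norm (f \<omega>))\<^sup>2 \<partial>sphere_measure)"
    by (rule nn_integral_eq_integral[OF i]) simp
  then show "Lp_norm 2 sphere_measure f = ennreal (sqrt (\<integral>\<omega>. (norm (f \<omega>))\<^sup>2 \<partial>sphere_measure))"
    unfolding L by (simp add: ennpowr_ennreal powr_half_sqrt)
qed

text \<open>Used with \<open>s = p / 2\<close> and the energies as weights. The power mean
  inequality, applied at each \<open>r\<close>, makes the integrand linear in the weights; each
  Bessel integral is then replaced by that of \<open>k = 0\<close>, and the total weight supplies
  the missing factor \<open>A\<close>.\<close>

lemma nn_integral_harmonic_partial_sum_le:
  assumes d: "d \<ge> 2" and s: "s \<ge> 1" and E: "E > 0"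
    and a: "\<And>k. a k \<ge> 0" and A: "(\<Sum>k<N. a k) \<le> A"
    and bess: "\<And>k. bessel_integral d (2 * s) k \<le> bessel_integral d (2 * s) 0"
  shows "(\<integral>\<^sup>+ r\<in>{0<..}. ennpowr (ennreal (\<Sum>k<N. (E * bessel_function d k r)\<^sup>2 * a k)) s * ennreal (r ^ (d - 1)) \<partial>lborel)
    \<le> ennreal (A powr s * E powr (2 * s)) * bessel_integral d (2 * s) 0"
proof -
  let ?b = "bessel_function d"
  note [measurable] = bessel_function_measurable[OF d]
  have A0: "A \<ge> 0" using order_trans[OF sum_nonneg A] a by blast
  have sq: "(E * y)\<^sup>2 powr s = E powr (2 * s) * \<bar>y\<bar> powr (2 * s)" for y
  proof -
    have "(E * y)\<^sup>2 = (E * \<bar>y\<bar>) powr 2" using E by (simp add: power_mult_distrib)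
    then show ?thesis using E by (simp only: powr_powr) (simp add: powr_mult)
  qed
  have "(\<integral>\<^sup>+ r\<in>{0<..}. ennpowr (ennreal (\<Sum>k<N. (E * ?b k r)\<^sup>2 * a k)) s * ennreal (r ^ (d - 1)) \<partial>lborel)
    \<le> (\<integral>\<^sup>+ r. (\<Sum>k<N. ennreal (A powr (s - 1) * E powr (2 * s) * a k) *
        (ennreal (\<bar>?b k r\<bar> powr (2 * s) * r ^ (d - 1)) * indicator {0<..} r)) \<partial>lborel)"
  proof (rule nn_integral_mono)
    fix r :: real
    show "ennpowr (ennreal (\<Sum>k<N. (E * ?b k r)\<^sup>2 * a k)) s * ennreal (r ^ (d - 1)) * indicator {0<..} r \<le>
      (\<Sum>k<N. ennreal (A powr (s - 1) * E powr (2 * s) * a k) *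
        (ennreal (\<bar>?b k r\<bar> powr (2 * s) * r ^ (d - 1)) * indicator {0<..} r))"
    proof (cases "r > 0")
      case True
      have "(\<Sum>k<N. a k * (E * ?b k r)\<^sup>2) powr s * r ^ (d - 1) \<le>
          A powr (s - 1) * (\<Sum>k<N. a k * ((E * ?b k r)\<^sup>2) powr s) * r ^ (d - 1)"
        using True A a s by (intro mult_right_mono power_mean_le) auto
      also have "\<dots> = (\<Sum>k<N. (A powr (s - 1) * E powr (2 * s) * a k) * (\<bar>?b k r\<bar> powr (2 * s) * r ^ (d - 1)))"
        unfolding sq by (simp add: sum_distrib_left sum_distrib_right mult_ac)
      finally have *: "(\<Sum>k<N. a k * (E * ?b k r)\<^sup>2) powr s * r ^ (d - 1) \<le> \<dots>" .
      have "ennpowr (ennreal (\<Sum>k<N. (E * ?b k r)\<^sup>2 * a k)) s * ennreal (r ^ (d - 1)) =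
          ennreal ((\<Sum>k<N. a k * (E * ?b k r)\<^sup>2) powr s * r ^ (d - 1))"
        using a True by (subst ennpowr_ennreal) (auto intro!: sum_nonneg simp: ennreal_mult' mult.commute)
      also have "\<dots> \<le> ennreal (\<Sum>k<N. (A powr (s - 1) * E powr (2 * s) * a k) * (\<bar>?b k r\<bar> powr (2 * s) * r ^ (d - 1)))"
        by (rule ennreal_leI[OF *])
      also have "\<dots> = (\<Sum>k<N. ennreal (A powr (s - 1) * E powr (2 * s) * a k) * ennreal (\<bar>?b k r\<bar> powr (2 * s) * r ^ (d - 1)))"
        using True a by (subst sum_ennreal[symmetric]) (auto simp: ennreal_mult)
      finally show ?thesis using True by simp
    qed simp
  qed
  also have "\<dots> = (\<Sum>k<N. ennreal (A powr (s - 1) * E powr (2 * s) * a k) * bessel_integral d (2 * s) k)"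
    unfolding bessel_integral_def by (subst nn_integral_sum) (auto simp: nn_integral_cmult)
  also have "\<dots> \<le> (\<Sum>k<N. ennreal (A powr (s - 1) * E powr (2 * s) * a k) * bessel_integral d (2 * s) 0)"
    by (intro sum_mono mult_left_mono bess) simp
  also have "\<dots> = ennreal (A powr (s - 1) * E powr (2 * s) * (\<Sum>k<N. a k)) * bessel_integral d (2 * s) 0"
    using a by (simp add: sum_distrib_left flip: sum_distrib_right sum_ennreal)
  also have "\<dots> \<le> ennreal (A powr s * E powr (2 * s)) * bessel_integral d (2 * s) 0"
  proof (intro mult_right_mono ennreal_leI)
    have "A powr (s - 1) * E powr (2 * s) * (\<Sum>k<N. a k) \<le> A powr (s - 1) * E powr (2 * s) * A"
      by (intro mult_left_mono A) simp
    also have "\<dots> = A powr s * E powr (2 * s)"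
      using A0 by (cases "A = 0") (auto simp: powr_diff)
    finally show "A powr (s - 1) * E powr (2 * s) * (\<Sum>k<N. a k) \<le> A powr s * E powr (2 * s)" .
  qed simp
  finally show ?thesis .
qed

lemma Phi_mn_le:
  fixes f :: "real ^ 'n \<Rightarrow> complex"
  assumes d: "CARD('n) \<ge> 2" and p: "p > 2"
    and Lam: "\<And>k. Lambda CARD('n) p k \<le> Lambda CARD('n) p 0"
    and f: "f \<in> borel_measurable sphere_measure" "Lp_norm 2 sphere_measure f < \<infinity>"
  shows "Phi_mn p f \<le> ennreal (extension_const TYPE('n)) * Lambda CARD('n) p 0"
  unfolding Phi_mn_def
proof (rule ennreal_divide_le_of_le_mult)
  let ?d = "CARD('n)" and ?E = "extension_const TYPE('n)"
  let ?a = "\<lambda>k. harmonic_energy k f"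
  let ?A = "\<integral>\<omega>. (norm (f \<omega>))\<^sup>2 \<partial>sphere_measure"
  let ?S = "\<lambda>N r. \<Sum>k<N. (?E * bessel_function ?d k r)\<^sup>2 * ?a k"
  let ?I = "\<lambda>r. \<integral>\<^sup>+ \<omega>. ennreal ((norm (extension f (r *\<^sub>R \<omega>)))\<^sup>2) \<partial>sphere_measure"
  note f2 = Lp_norm_2(1)[OF f]
  note E = extension_const_pos[where 'n='n]
  have A0: "?A \<ge> 0" by simp
  have A: "(\<Sum>k<N. ?a k) \<le> ?A" for N by (rule bessel_inequality[OF f(1) f2])
  have I: "?I r \<le> (SUP N. ennreal (?S N r))" for r
    by (rule nn_integral_extension_le[OF d f(1) f2])
  have S0: "?S N r \<ge> 0" for N r by (intro sum_nonneg mult_nonneg_nonneg harmonic_energy_nonneg) auto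
  have incS: "?S N r \<le> ?S M r" if "N \<le> M" for N M r
    using that by (intro sum_mono2) (auto intro!: mult_nonneg_nonneg harmonic_energy_nonneg)
  show "mixed_norm p (extension f) \<le> ennreal ?E * Lambda ?d p 0 * Lp_norm 2 sphere_measure f"
  proof (cases "p = \<infinity>")
    case True
    show ?thesis
    proof (cases "Lambda ?d \<infinity> 0")
      case (real L)
      have b: "\<bar>bessel_function ?d k r\<bar> \<le> L" if "r \<ge> 0" for k r
      proof -
        have "ennreal \<bar>bessel_function ?d k r\<bar> \<le> Lambda ?d \<infinity> k"
          unfolding Lambda_infinity_eq[OF d] using that by (intro SUP_upper) auto
        also have "\<dots> \<le> ennreal L" using Lam[of k] True real by simp
        finally show ?thesis using real by (simp add: ennreal_le_iff)
      qed
      have "ennpowr (?I r) (1 / 2) \<le> ennreal ?E * ennreal L * ennreal (sqrt ?A)" if r: "r \<ge> 0" for r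
      proof -
        have "?S N r \<le> (?E * L)\<^sup>2 * ?A" for N
        proof -
          have "?S N r \<le> (\<Sum>k<N. (?E * L)\<^sup>2 * ?a k)"
            using b[OF r] E real by (intro sum_mono mult_right_mono harmonic_energy_nonneg)
              (auto simp: power_mult_distrib abs_le_square_iff[symmetric] intro!: mult_left_mono)
          also have "\<dots> \<le> (?E * L)\<^sup>2 * ?A"
            unfolding sum_distrib_left[symmetric] by (intro mult_left_mono A) simp
          finally show ?thesis .
        qed
        then have "?I r \<le> ennreal ((?E * L)\<^sup>2 * ?A)"
          by (intro order_trans[OF I] SUP_least ennreal_leI)
        then have "ennpowr (?I r) (1 / 2) \<le> ennpowr (ennreal ((?E * L)\<^sup>2 * ?A)) (1 / 2)"
          by (intro ennpowr_mono) auto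
        also have "\<dots> = ennreal (?E * L * sqrt ?A)"
          using E real A0 by (subst ennpowr_ennreal) (auto simp: powr_half_sqrt real_sqrt_mult)
        also have "\<dots> = ennreal ?E * ennreal L * ennreal (sqrt ?A)"
          using E real by (simp add: ennreal_mult)
        finally show ?thesis .
      qed
      then show ?thesis
        unfolding mixed_norm_def Lp_norm_2(2)[OF f] using True real by (auto intro!: SUP_least)
    next
      \<comment> \<open>An infinite \<open>Lambda\<close> makes the right-hand side infinite unless
        \<open>f\<close> has norm 0. Then the product is 0, and the left-hand side must be shown to
        vanish, which holds because all energies are 0.\<close>
      case top
      show ?thesis
      proof (cases "?A = 0")
        case False
        then have "ennreal ?E * Lambda ?d p 0 * Lp_norm 2 sphere_measure f = \<infinity>"
          unfolding Lp_norm_2(2)[OF f] using top True E A0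
          by (simp add: ennreal_mult_top ennreal_top_mult ennreal_mult_eq_top_iff)
        then show ?thesis by simp
      next
        case A: True
        have "?a k = 0" for k
          using bessel_inequality[OF f(1) f2, of "Suc k"] A harmonic_energy_nonneg[of _ f]
            sum_nonneg[of "{..<k}" "\<lambda>k. ?a k"] by (simp add: order_antisym add_nonneg_eq_0_iff order_class.order_eq_iff) 
        then have "?I r = 0" for r using I[of r] by simp
        then show ?thesis using True by (simp add: mixed_norm_def ennpowr_def)
      qed
    qed
  next
    case False
    define q where "q = enn2real p"
    have q: "q > 2" "p = ennreal q"
      using p False by (cases p; auto simp: q_def)+
    \<comment> \<open>Raising to the power \<open>q\<close> undoes the root in
      \<open>Lambda\<close>.\<close>
    have Lq: "bessel_integral ?d q k \<le> bessel_integral ?d q 0" for k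
    proof -
      have "ennpowr (bessel_integral ?d q k) (1 / q) \<le> ennpowr (bessel_integral ?d q 0) (1 / q)"
        using Lam[of k] by (simp add: Lambda_eq_bessel_integral[OF d False] q_def[symmetric])
      from ennpowr_mono[OF _ this, of q] show ?thesis using q(1) by (simp add: ennpowr_ennpowr)
    qed
    \<comment> \<open>The supremum over \<open>N\<close> is pulled out of the power by continuity
      from below and out of the integral by monotone convergence, as the partial sums
      increase.\<close>
    have "(\<integral>\<^sup>+ r\<in>{0::real<..}. ennpowr (?I r) (q / 2) * ennreal (r ^ (?d - 1)) \<partial>lborel) \<le>
        (\<integral>\<^sup>+ r. (SUP N. ennpowr (ennreal (?S N r)) (q / 2) * ennreal (r ^ (?d - 1)) * indicator {0<..} r) \<partial>lborel)"
    proof (rule nn_integral_mono)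
      fix r :: real
      have "ennpowr (?I r) (q / 2) \<le> (SUP N. ennpowr (ennreal (?S N r)) (q / 2))"
        using q by (intro order_trans[OF ennpowr_mono[OF _ I] ennpowr_SUP_le]) auto
      then have "ennpowr (?I r) (q / 2) * ennreal (r ^ (?d - 1)) * indicator {0<..} r \<le>
          (SUP N. ennpowr (ennreal (?S N r)) (q / 2)) * (ennreal (r ^ (?d - 1)) * indicator {0<..} r)"
        by (simp add: mult.assoc mult_right_mono)
      also have "\<dots> = (SUP N. ennpowr (ennreal (?S N r)) (q / 2) * (ennreal (r ^ (?d - 1)) * indicator {0<..} r))"
        by (rule SUP_mult_right_ennreal)
      finally show "ennpowr (?I r) (q / 2) * ennreal (r ^ (?d - 1)) * indicator {0<..} r \<le>
          (SUP N. ennpowr (ennreal (?S N r)) (q / 2) * ennreal (r ^ (?d - 1)) * indicator {0<..} r)"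
        by (simp add: mult.assoc)
    qed
    also have "\<dots> = (SUP N. \<integral>\<^sup>+ r\<in>{0<..}. ennpowr (ennreal (?S N r)) (q / 2) * ennreal (r ^ (?d - 1)) \<partial>lborel)"
    proof (rule nn_integral_monotone_convergence_SUP)
      show "incseq (\<lambda>N r. ennpowr (ennreal (?S N r)) (q / 2) * ennreal (r ^ (?d - 1)) * indicator {0<..} r)"
        using q(1) by (intro incseq_SucI le_funI mult_right_mono ennpowr_mono ennreal_leI incS) auto
      note [measurable] = bessel_function_measurable[OF d]
      show "(\<lambda>r. ennpowr (ennreal (?S N r)) (q / 2) * ennreal (r ^ (?d - 1)) * indicator {0<..} r) \<in> borel_measurable lborel" for N
        by measurable
    qed
    also have "\<dots> \<le> ennreal (?A powr (q / 2) * ?E powr (2 * (q / 2))) * bessel_integral ?d (2 * (q / 2)) 0"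
      using q Lq by (intro SUP_least nn_integral_harmonic_partial_sum_le[OF d _ E harmonic_energy_nonneg A]) auto
    finally have "mixed_norm p (extension f) \<le>
        ennpowr (ennreal (?A powr (q / 2) * ?E powr q) * bessel_integral ?d q 0) (1 / q)"
      unfolding mixed_norm_def using False q by (auto simp: q_def[symmetric] intro!: ennpowr_mono)
    also have "\<dots> = ennreal ((?A powr (q / 2) * ?E powr q) powr (1 / q)) * Lambda ?d p 0"
      using q(1) by (simp add: ennpowr_mult ennpowr_ennreal Lambda_eq_bessel_integral[OF d False] q_def[symmetric])
    also have "(?A powr (q / 2) * ?E powr q) powr (1 / q) = ?E * sqrt ?A"
      using q E A0 by (simp add: powr_mult powr_powr powr_half_sqrt)
    finally show ?thesis
      unfolding Lp_norm_2(2)[OF f] using E A0 by (simp add: ennreal_mult mult_ac)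
  qed
qed

lemma square_powr_half: "(x\<^sup>2) powr (q / 2) = \<bar>x\<bar> powr q" for x :: real
proof -
  have "x\<^sup>2 = \<bar>x\<bar> powr 2" by simp
  then show ?thesis by (simp only: powr_powr) simp
qed

lemma ennpowr_emeasure_sphere:
  assumes "a > 0"
  shows "ennpowr (emeasure (sphere_measure :: (real ^ 'n) measure) (sphere 0 1)) a \<noteq> 0"
    "ennpowr (emeasure (sphere_measure :: (real ^ 'n) measure) (sphere 0 1)) a \<noteq> \<infinity>"
  using emeasure_sphere_pos[where 'n='n] assms
  by (simp_all add: sphere.emeasure_eq_measure ennpowr_ennreal)

text \<open>The extension of a constant is radial, so the inner integral is a square times the mass
  of the sphere; the square root of that mass is also the norm of 1 and cancels.\<close>

lemma Phi_mn_one: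
  assumes d: "CARD('n) \<ge> 2" and p: "p > 2"
  shows "Phi_mn p (\<lambda>_ :: real ^ 'n. 1) = ennreal (extension_const TYPE('n)) * Lambda CARD('n) p 0"
proof -
  let ?d = "CARD('n)" and ?E = "extension_const TYPE('n)" and ?b = "bessel_function CARD('n) 0"
  let ?m = "emeasure (sphere_measure :: (real ^ 'n) measure) (sphere 0 1)"
  let ?I = "\<lambda>r. \<integral>\<^sup>+ \<omega>. ennreal ((norm (extension (\<lambda>_ :: real ^ 'n. 1) (r *\<^sub>R \<omega>)))\<^sup>2) \<partial>sphere_measure"
  note E = extension_const_pos[where 'n='n]
  have I: "?I r = ennreal ((?E * ?b r)\<^sup>2) * ?m" for r
  proof -
    have "?I r = (\<integral>\<^sup>+ \<omega>. ennreal ((?E * ?b r)\<^sup>2) \<partial>(sphere_measure :: (real ^ 'n) measure))"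
      using extension_solid_harmonic[OF d solid_harmonic_const[of 1]]
      by (intro nn_integral_cong) (simp add: norm_sphere_measure norm_mult power_mult_distrib)
    then show ?thesis by (simp add: space_sphere_measure)
  qed
  have L2: "Lp_norm 2 sphere_measure (\<lambda>_ :: real ^ 'n. 1) = ennpowr ?m (1 / 2)"
    by (simp add: Lp_norm_def space_sphere_measure)
  have "mixed_norm p (extension (\<lambda>_ :: real ^ 'n. 1)) = ennreal ?E * Lambda ?d p 0 * ennpowr ?m (1 / 2)"
  proof (cases "p = \<infinity>")
    case True
    have "ennpowr (?I r) (1 / 2) = ennreal ?E * ennreal \<bar>?b r\<bar> * ennpowr ?m (1 / 2)" for r
      using E square_powr_half[of "?E * ?b r" 1] unfolding I
      by (simp add: ennpowr_mult ennpowr_ennreal abs_mult flip: ennreal_mult)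
    then show ?thesis
      unfolding mixed_norm_def True Lambda_infinity_eq[OF d]
      by (simp add: SUP_mult_left_ennreal SUP_mult_right_ennreal)
  next
    case False
    define q where "q = enn2real p"
    have q: "q > 2" "p = ennreal q"
      using p False by (cases p; auto simp: q_def)+
    note [measurable] = bessel_function_measurable[OF d]
    have "(\<integral>\<^sup>+ r\<in>{0::real<..}. ennpowr (?I r) (q / 2) * ennreal (r ^ (?d - 1)) \<partial>lborel) =
        (\<integral>\<^sup>+ r. ennreal (?E powr q) * ennpowr ?m (q / 2) *
          (ennreal (\<bar>?b r\<bar> powr q * r ^ (?d - 1)) * indicator {0<..} r) \<partial>lborel)"
    proof (rule nn_integral_cong)
      fix r :: real
      have "ennpowr (?I r) (q / 2) = ennreal (?E powr q) * ennreal (\<bar>?b r\<bar> powr q) * ennpowr ?m (q / 2)"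
        using q(1) E unfolding I
        by (simp add: ennpowr_mult ennpowr_ennreal square_powr_half abs_mult powr_mult ennreal_mult)
      moreover have "ennreal (\<bar>?b r\<bar> powr q * r ^ (?d - 1)) = ennreal (\<bar>?b r\<bar> powr q) * ennreal (r ^ (?d - 1))"
        by (rule ennreal_mult') simp
      ultimately show "ennpowr (?I r) (q / 2) * ennreal (r ^ (?d - 1)) * indicator {0<..} r =
          ennreal (?E powr q) * ennpowr ?m (q / 2) * (ennreal (\<bar>?b r\<bar> powr q * r ^ (?d - 1)) * indicator {0<..} r)"
        by (simp only: mult_ac)
    qed
    also have "\<dots> = ennreal (?E powr q) * ennpowr ?m (q / 2) * bessel_integral ?d q 0"
      unfolding bessel_integral_def by (rule nn_integral_cmult) measurable
    finally have "mixed_norm p (extension (\<lambda>_ :: real ^ 'n. 1)) =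
        ennpowr (ennreal (?E powr q) * ennpowr ?m (q / 2) * bessel_integral ?d q 0) (1 / q)"
      unfolding mixed_norm_def using False by (simp add: q_def)
    also have "\<dots> = ennreal ?E * ennpowr ?m (1 / 2) * Lambda ?d p 0"
      using q(1) E by (simp add: ennpowr_mult ennpowr_ennreal ennpowr_ennpowr powr_powr
          Lambda_eq_bessel_integral[OF d False] q_def[symmetric])
    finally show ?thesis by (simp add: mult_ac)
  qed
  then show ?thesis
    unfolding Phi_mn_def L2 using ennpowr_emeasure_sphere[of "1 / 2", where 'n='n]
    by (simp add: mult_divide_eq_ennreal)
qed

section \<open>Norms of extensions of harmonics\<close>

lemma extension_measurable:
  fixes f :: "real ^ 'n \<Rightarrow> complex"
  assumes [measurable]: "f \<in> borel_measurable sphere_measure"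
  shows "extension f \<in> borel_measurable borel"
proof -
  have "(\<lambda>x. \<integral>\<xi>. exp (- \<i> * complex_of_real (x \<bullet> \<xi>)) * f \<xi> \<partial>sphere_measure) \<in> borel_measurable (borel :: (real ^ 'n) measure)"
    by (rule sphere.borel_measurable_lebesgue_integral) (simp add: split_beta', measurable)
  then show ?thesis by (simp only: extension_def[abs_def])
qed

text \<open>By polar coordinates the cone over a null set of the sphere is a Lebesgue null set; this
  transfers essential bounds from the sphere to the space.\<close>

lemma AE_direction:
  fixes Q :: "real ^ 'n \<Rightarrow> bool"
  assumes [measurable]: "Measurable.pred sphere_measure Q" and Q: "AE \<omega> in sphere_measure. Q \<omega>"
  shows "AE x in lborel. Q (direction x)"
proof -
  have d: "CARD('n) \<ge> 1" by (simp add: Suc_leI)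
  interpret R: sigma_finite_measure "radial_measure CARD('n)"
    by (rule sigma_finite_radial_measure[OF d])
  interpret RS: pair_sigma_finite "radial_measure CARD('n)" "sphere_measure :: (real^'n) measure"
    by unfold_locales
  have "AE z in radial_measure CARD('n) \<Otimes>\<^sub>M sphere_measure. Q (snd z)"
  proof (rule RS.AE_pair_measure)
    show "{z \<in> space (radial_measure CARD('n) \<Otimes>\<^sub>M sphere_measure). Q (snd z)} \<in>
        sets (radial_measure CARD('n) \<Otimes>\<^sub>M sphere_measure)"
      by measurable
  qed (use Q in simp)
  then show ?thesis
    unfolding polar_coordinates_distr by (subst (asm) AE_distr_iff) auto
qed

text \<open>The modulus of the extension is a function of the radius times a function of the
  direction, so the integral in polar coordinates is a product. This holds with equality in every
  degree.\<close>

lemma Lp_norm_extension_solid_harmonic: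
  fixes P :: "real ^ 'n \<Rightarrow> complex"
  assumes d: "CARD('n) \<ge> 2" and p: "p > 2" "p \<noteq> \<infinity>" and P: "solid_harmonic k P"
  shows "Lp_norm p lborel (extension P) =
    ennreal (extension_const TYPE('n)) * Lambda CARD('n) p k * Lp_norm p sphere_measure P"
proof -
  let ?d = "CARD('n)" and ?E = "extension_const TYPE('n)" and ?b = "bessel_function CARD('n) k"
  note E = extension_const_pos[where 'n='n]
  define q where "q = enn2real p"
  have q: "q > 2" "p = ennreal q"
    using p by (cases p; auto simp: q_def)+
  have Pm: "P \<in> borel_measurable sphere_measure"
    by (rule borel_measurable_sphere_measure[OF polyfun_measurable[OF solid_harmonic_polyfun[OF P]]])
  note [measurable] = bessel_function_measurable[OF d] extension_measurable[OF Pm] Pm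
  let ?N = "\<integral>\<^sup>+ \<omega>. ennreal (norm (P \<omega>) powr q) \<partial>sphere_measure"
  have inner: "(\<integral>\<^sup>+ \<omega>. ennreal (norm (extension P (r *\<^sub>R \<omega>)) powr q) \<partial>sphere_measure) =
      ennreal (?E powr q * \<bar>?b r\<bar> powr q) * ?N" for r
  proof -
    have "(\<integral>\<^sup>+ \<omega>. ennreal (norm (extension P (r *\<^sub>R \<omega>)) powr q) \<partial>sphere_measure) =
        (\<integral>\<^sup>+ \<omega>. ennreal (?E powr q * \<bar>?b r\<bar> powr q) * ennreal (norm (P \<omega>) powr q) \<partial>sphere_measure)"
      using E by (intro nn_integral_cong)
        (simp add: extension_solid_harmonic[OF d P] norm_sphere_measure norm_mult norm_power abs_mult powr_mult
           flip: ennreal_mult)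
    then show ?thesis by (simp add: nn_integral_cmult)
  qed
  have "(\<integral>\<^sup>+ x. ennreal (norm (extension P x) powr q) \<partial>lborel) =
      (\<integral>\<^sup>+ r. ennreal (?E powr q) * ?N * (ennreal (\<bar>?b r\<bar> powr q * r ^ (?d - 1)) * indicator {0<..} r) \<partial>lborel)"
    by (subst nn_integral_polar)
       (auto simp: inner ennreal_mult mult_ac intro!: nn_integral_cong split: split_indicator)
  also have "\<dots> = ennreal (?E powr q) * ?N * bessel_integral ?d q k"
    unfolding bessel_integral_def by (rule nn_integral_cmult) measurable
  finally have "Lp_norm p lborel (extension P) = ennpowr (ennreal (?E powr q) * ?N * bessel_integral ?d q k) (1 / q)"
    using p by (simp add: Lp_norm_def q_def)
  also have "\<dots> = ennreal ?E * Lp_norm p sphere_measure P * Lambda ?d p k"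
    using q(1) E p by (simp add: ennpowr_mult ennpowr_ennreal powr_powr Lp_norm_def
        Lambda_eq_bessel_integral[OF d p(2)] q_def[symmetric])
  finally show ?thesis by (simp add: mult_ac)
qed

lemma Linfty_norm_extension_solid_harmonic_le:
  fixes P :: "real ^ 'n \<Rightarrow> complex"
  assumes d: "CARD('n) \<ge> 2" and P: "solid_harmonic k P"
  shows "Lp_norm \<infinity> lborel (extension P) \<le>
    ennreal (extension_const TYPE('n)) * Lambda CARD('n) \<infinity> k * Lp_norm \<infinity> sphere_measure P"
proof -
  let ?E = "extension_const TYPE('n)" and ?b = "bessel_function CARD('n) k"
  let ?S = "esssup sphere_measure (\<lambda>\<omega>. ennreal (norm (P \<omega>)))"
  note E = extension_const_pos[where 'n='n]
  have Pm: "P \<in> borel_measurable sphere_measure"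
    by (rule borel_measurable_sphere_measure[OF polyfun_measurable[OF solid_harmonic_polyfun[OF P]]])
  note [measurable] = extension_measurable[OF Pm] Pm
  have "AE x in lborel. ennreal (norm (P (direction x))) \<le> ?S"
    by (rule AE_direction[OF _ esssup_AE]) measurable
  then have "AE x in lborel. ennreal (norm (extension P x)) \<le> ennreal ?E * Lambda CARD('n) \<infinity> k * ?S"
  proof eventually_elim
    fix x :: "real ^ 'n" assume x: "ennreal (norm (P (direction x))) \<le> ?S"
    have "norm (extension P x) = norm (extension P (norm x *\<^sub>R direction x))"
      by (simp add: norm_scaleR_direction)
    also have "\<dots> = ?E * \<bar>?b (norm x)\<bar> * norm (P (direction x))"
      using E by (simp add: extension_solid_harmonic[OF d P] norm_mult norm_power abs_mult)
    finally have "ennreal (norm (extension P x)) = ennreal ?E * ennreal \<bar>?b (norm x)\<bar> * ennreal (norm (P (direction x)))"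
      using E by (simp add: ennreal_mult)
    also have "\<dots> \<le> ennreal ?E * Lambda CARD('n) \<infinity> k * ?S"
      unfolding Lambda_infinity_eq[OF d] by (intro mult_mono x SUP_upper) auto
    finally show "ennreal (norm (extension P x)) \<le> ennreal ?E * Lambda CARD('n) \<infinity> k * ?S" .
  qed
  then show ?thesis by (auto simp: Lp_norm_def intro!: esssup_I)
qed

text \<open>\<open>Lambda\<close> is a genuine supremum over radii, the norm an essential one.
  Continuity closes the gap: the points where the extension is at most \<open>z\<close> form a
  closed set, and a closed set containing almost every point is everything, in particular a point of
  norm \<open>r\<close>.\<close>

lemma Linfty_norm_extension_const_ge:
  assumes d: "CARD('n) \<ge> 2"
  shows "ennreal (extension_const TYPE('n)) * Lambda CARD('n) \<infinity> 0 * ennreal (norm c) \<le>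
    Lp_norm \<infinity> lborel (extension (\<lambda>_ :: real ^ 'n. c))"
proof -
  let ?E = "extension_const TYPE('n)" and ?b = "bessel_function CARD('n) 0"
  let ?Z = "Lp_norm \<infinity> lborel (extension (\<lambda>_ :: real ^ 'n. c))"
  note E = extension_const_pos[where 'n='n]
  have ext: "norm (extension (\<lambda>_. c) x) = ?E * \<bar>?b (norm x)\<bar> * norm c" for x :: "real ^ 'n"
    using extension_solid_harmonic[OF d solid_harmonic_const[of c] norm_direction[of x], of "norm x"] E
    by (simp add: norm_scaleR_direction norm_mult abs_mult)
  have "ennreal (?E * \<bar>?b r\<bar> * norm c) \<le> ?Z" if r: "r \<ge> 0" for r
  proof (cases ?Z)
    case (real z)
    have "AE x in lborel. ennreal (norm (extension (\<lambda>_ :: real ^ 'n. c) x)) \<le> ennreal z"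
      using esssup_AE[of "\<lambda>x. ennreal (norm (extension (\<lambda>_ :: real ^ 'n. c) x))" lborel] real
      by (simp add: Lp_norm_def)
    then have "AE x in lborel. x \<in> {x :: real ^ 'n. ?E * \<bar>?b (norm x)\<bar> * norm c \<le> z}"
      using real by (simp add: ext ennreal_le_iff)
    then have AE: "AE x in lebesgue. x \<in> {x :: real ^ 'n. ?E * \<bar>?b (norm x)\<bar> * norm c \<le> z}"
      by (rule AE_completion)
    have "continuous_on UNIV ?b"
      unfolding bessel_function_def by (intro continuous_intros bessel_series_continuous[OF d])
    then have "continuous_on UNIV (\<lambda>x :: real ^ 'n. ?b (norm x))"
      by (rule continuous_on_compose2[OF _ continuous_on_norm_id]) simp
    then have "closed {x :: real ^ 'n. ?E * \<bar>?b (norm x)\<bar> * norm c \<le> z}"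
      by (intro closed_Collect_le continuous_on_mult continuous_on_rabs continuous_on_const)
    from mem_closed_if_AE_lebesgue[OF this AE, of "r *\<^sub>R axis undefined 1"] r real
    show ?thesis by (auto simp: ennreal_le_iff intro: ennreal_leI)
  qed simp
  then have "ennreal ?E * ennreal \<bar>?b r\<bar> * ennreal (norm c) \<le> ?Z" if "r \<ge> 0" for r
    using that E by (simp add: ennreal_mult)
  then show ?thesis
    unfolding Lambda_infinity_eq[OF d] by (simp add: SUP_mult_left_ennreal SUP_mult_right_ennreal SUP_le_iff)
qed

lemma Phi_solid_harmonic_le:
  fixes P :: "real ^ 'n \<Rightarrow> complex"
  assumes "CARD('n) \<ge> 2" "p > 2" "solid_harmonic k P"
  shows "Phi p P \<le> ennreal (extension_const TYPE('n)) * Lambda CARD('n) p k"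
  unfolding Phi_def
proof (rule ennreal_divide_le_of_le_mult, cases "p = \<infinity>")
  case True
  show "Lp_norm p lborel (extension P) \<le>
      ennreal (extension_const TYPE('n)) * Lambda CARD('n) p k * Lp_norm p sphere_measure P"
    unfolding True by (rule Linfty_norm_extension_solid_harmonic_le[OF assms(1,3)])
next
  case False
  show "Lp_norm p lborel (extension P) \<le>
      ennreal (extension_const TYPE('n)) * Lambda CARD('n) p k * Lp_norm p sphere_measure P"
    by (rule eq_refl[OF Lp_norm_extension_solid_harmonic[OF assms(1,2) False assms(3)]])
qed

text \<open>Dividing the norm estimate in \<open>ennreal\<close> requires the norm of the constant
  to be neither 0 nor infinite, which follows from the positive finite mass of the sphere.\<close>

lemma Phi_const_ge:
  assumes d: "CARD('n) \<ge> 2" and p: "p > 2" and c: "c \<noteq> 0"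
  shows "ennreal (extension_const TYPE('n)) * Lambda CARD('n) p 0 \<le> Phi p (\<lambda>_ :: real ^ 'n. c)"
proof -
  let ?N = "Lp_norm p sphere_measure (\<lambda>_ :: real ^ 'n. c)"
  let ?M = "ennreal (extension_const TYPE('n)) * Lambda CARD('n) p 0"
  have N: "?N \<noteq> 0 \<and> ?N \<noteq> \<infinity> \<and> ?M * ?N \<le> Lp_norm p lborel (extension (\<lambda>_ :: real ^ 'n. c))"
  proof (cases "p = \<infinity>")
    case True
    have "?N = ennreal (norm c)"
      using True emeasure_sphere_pos[where 'n='n] by (simp add: Lp_norm_def esssup_const space_sphere_measure)
    then show ?thesis using True c Linfty_norm_extension_const_ge[OF d, of c] by simp
  next
    case False
    define q where "q = enn2real p"
    have q: "q > 2" using p False by (cases p; auto simp: q_def)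
    have "?N = ennreal (norm c) * ennpowr (emeasure (sphere_measure :: (real ^ 'n) measure) (sphere 0 1)) (1 / q)"
      using q False by (simp add: Lp_norm_def space_sphere_measure ennpowr_mult ennpowr_ennreal powr_powr q_def[symmetric])
    moreover have "1 / q > 0" using q by simp
    ultimately have "?N \<noteq> 0 \<and> ?N \<noteq> \<infinity>"
      using c ennpowr_emeasure_sphere[of "1 / q", where 'n='n] by (simp add: ennreal_mult_eq_top_iff)
    then show ?thesis
      using Lp_norm_extension_solid_harmonic[OF d p False solid_harmonic_const[of c]] by simp
  qed
  then have "?M = ?M * ?N / ?N" by (simp add: mult_divide_eq_ennreal)
  also have "\<dots> \<le> Phi p (\<lambda>_ :: real ^ 'n. c)"
    unfolding Phi_def using N by (intro divide_right_mono_ennreal) simp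
  finally show ?thesis .
qed

text \<open>A spherical harmonic is arbitrary off the sphere; this lemma allows it to be replaced by
  the solid harmonic with the same values on the sphere.\<close>

lemma Phi_cong_sphere:
  assumes "\<And>\<omega>. norm \<omega> = 1 \<Longrightarrow> f \<omega> = g \<omega>"
  shows "Phi p f = Phi p g"
proof -
  have "extension f = extension g"
    unfolding extension_def
    by (intro ext Bochner_Integration.integral_cong) (auto simp: assms norm_sphere_measure)
  moreover have "Lp_norm p sphere_measure f = Lp_norm p sphere_measure g"
  proof (cases "p = \<infinity>")
    case True
    \<comment> \<open>\<open>esssup\<close> is defined by cases on measurability, so both functions
      must fall into the same case before their limits superior are compared.\<close>
    have "(\<lambda>\<omega>. ennreal (norm (f \<omega>))) \<in> borel_measurable sphere_measure \<longleftrightarrow>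
        (\<lambda>\<omega>. ennreal (norm (g \<omega>))) \<in> borel_measurable sphere_measure"
      by (intro measurable_cong) (simp add: assms norm_sphere_measure)
    moreover have "Limsup (ae_filter sphere_measure) (\<lambda>\<omega>. ennreal (norm (f \<omega>))) =
        Limsup (ae_filter sphere_measure) (\<lambda>\<omega>. ennreal (norm (g \<omega>)))"
      by (intro Limsup_eq AE_I2) (simp add: assms norm_sphere_measure)
    ultimately show ?thesis using True by (simp add: Lp_norm_def esssup_def)
  next
    case False
    have "(\<integral>\<^sup>+ \<omega>. ennreal (norm (f \<omega>) powr enn2real p) \<partial>sphere_measure) =
        (\<integral>\<^sup>+ \<omega>. ennreal (norm (g \<omega>) powr enn2real p) \<partial>sphere_measure)"
      by (intro nn_integral_cong) (simp add: assms norm_sphere_measure)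
    with False show ?thesis by (simp add: Lp_norm_def)
  qed
  ultimately show ?thesis by (simp add: Phi_def)
qed

text \<open>Exceeding the infimum provides an admissible real \<open>q\<close> below
  \<open>p\<close>. Since \<open>q\<close> is at least \<open>2 * d / (d - 1)\<close>, which is at
  least 2, the exponent \<open>p / 2\<close> exceeds 1 as the power mean step requires.\<close>

lemma p0_less_imp:
  assumes d: "d \<ge> 2" and p: "p > p0 d"
  shows "p > 2" and "Lambda d p k \<le> Lambda d p 0"
proof -
  from p obtain q where q: "2 * real d / (real d - 1) \<le> q" "p > ennreal q"
    "\<forall>p>ennreal q. \<forall>k\<ge>1. Lambda d p k < Lambda d p 0"
    unfolding p0_def Inf_less_iff by auto
  have "2 \<le> 2 * real d / (real d - 1)" using d by (simp add: field_simps)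
  then have "ennreal 2 \<le> ennreal q" using q(1) by (intro ennreal_leI) linarith
  from le_less_trans[OF this q(2)] show "p > 2" by simp
  show "Lambda d p k \<le> Lambda d p 0"
    using q(2,3) by (cases k) (auto intro: less_imp_le)
qed

theorem corollary1:
  fixes p :: ennreal
  assumes "CARD('n::finite) \<ge> 2"
    and "p > p0 CARD('n)"
  shows "(SUP f\<in>(nonzero_L2_sphere :: (real ^ 'n \<Rightarrow> complex) set). Phi_mn p f)
           \<le> Phi_mn p (\<lambda>_ :: real ^ 'n. 1)
         \<and> (\<forall>c \<noteq> 0.
              (SUP Y\<in>(nonzero_spherical_harmonics :: (real ^ 'n \<Rightarrow> complex) set). Phi p Y)
                \<le> Phi p (\<lambda>_ :: real ^ 'n. c))"
proof (intro conjI allI impI SUP_least)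
  note p = p0_less_imp(1)[OF assms] and Lam = p0_less_imp(2)[OF assms]
  show "Phi_mn p f \<le> Phi_mn p (\<lambda>_ :: real ^ 'n. 1)" if "f \<in> nonzero_L2_sphere" for f :: "real ^ 'n \<Rightarrow> complex"
    unfolding Phi_mn_one[OF assms(1) p] using that
    by (intro Phi_mn_le[OF assms(1) p Lam]) (auto simp: nonzero_L2_sphere_def)
  fix c :: complex and Y :: "real ^ 'n \<Rightarrow> complex"
  assume c: "c \<noteq> 0" and "Y \<in> nonzero_spherical_harmonics"
  then obtain k where "spherical_harmonic k Y" by (auto simp: nonzero_spherical_harmonics_def)
  then obtain P where P: "solid_harmonic k P" "\<And>\<omega>. norm \<omega> = 1 \<Longrightarrow> Y \<omega> = P \<omega>"
    by (rule spherical_harmonic_imp_solid) blast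
  have "Phi p Y = Phi p P" by (rule Phi_cong_sphere[OF P(2)])
  also have "\<dots> \<le> ennreal (extension_const TYPE('n)) * Lambda CARD('n) p k"
    by (rule Phi_solid_harmonic_le[OF assms(1) p P(1)])
  also have "\<dots> \<le> ennreal (extension_const TYPE('n)) * Lambda CARD('n) p 0"
    by (intro mult_left_mono Lam) simp
  also have "\<dots> \<le> Phi p (\<lambda>_ :: real ^ 'n. c)"
    by (rule Phi_const_ge[OF assms(1) p c])
  finally show "Phi p Y \<le> Phi p (\<lambda>_ :: real ^ 'n. c)" .
qed

end
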